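(* Let $\mathfrak g$ be a simple Lie algebra. For any simple root $\alpha\in\Pi$, with $d=d_\alpha$, one has $$d\bigl(q_\alpha+q_\alpha(d)\bigr)=2h^*r_\alpha\qquad\text{and}\qquad \frac{2h^*r_\alpha}{d}\in\mathbb N.$$ In particular, if $d=2$, then $q_\alpha+q_\alpha(2)=h^*r_\alpha$.
   Context: The ground field $\Bbbk$ is algebraically closed of characteristic $0$. $\mathfrak g$ is a simple Lie algebra with Killing form $\Phi$, Cartan subalgebra $\mathfrak t$, root system $\Delta$, positive roots $\Delta^+$, simple roots $\Pi$, highest root $\theta$. $(\ ,\ )$ is the bilinear form on $\mathfrak t^*$ induced by $\Phi|_{\mathfrak t}$. $\varphi_\alpha$ is the fundamental weight corresponding to $\alpha\in\Pi$. $h^*$ is the dual Coxeter number of $\mathfrak g$ (so $(\theta,\theta)=1/h^*$), and $r_\alpha=(\theta,\theta)/(\alpha,\alpha)$. For $\gamma=\sum_{\beta\in\Pi}n_\beta\beta$ put $\mathsf{ht}_\alpha(\gamma)=n_\alpha$; $\Delta_\alpha(i)=\{\gamma\in\Delta\mid \mathsf{ht}_\alpha(\gamma)=i\}$; $d_\alpha=\mathsf{ht}_\alpha(\theta)$. For a finite set $M\subset\mathfrak t^*$, $|M|$ denotes the sum of its elements. For $i\ge1$ the integer $q_\alpha(i)$ is defined by $|\Delta_\alpha(i)|=q_\alpha(i)\varphi_\alpha$, and $q_\alpha=\sum_{i\ge1}q_\alpha(i)$. *)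

theory Defs
  imports "HOL-Computational_Algebra.Computational_Algebra" "HOL-Library.Function_Algebras"
begin

section \<open>Weights as functions\<close>

definition fun_scale :: "'k::field \<Rightarrow> ('g \<Rightarrow> 'k) \<Rightarrow> 'g \<Rightarrow> 'k" where
  "fun_scale c f = (\<lambda>x. c * f x)"

interpretation weights: vector_space fun_scale
  by standard (auto simp: fun_scale_def algebra_simps)


section \<open>Finite-dimensional Lie algebras\<close>

text \<open>The underlying vector space of the Lie algebra is the whole type of vectors.\<close>

locale lie_algebra = vector_space scale
  for scale :: "'k::field \<Rightarrow> 'g::ab_group_add \<Rightarrow> 'g" (infixr "*s" 75) +
  fixes bracket :: "'g \<Rightarrow> 'g \<Rightarrow> 'g"
  assumes finite_dim: "\<exists>B. finite B \<and> span B = UNIV"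
    and bracket_linear_left: "Vector_Spaces.linear scale scale (\<lambda>x. bracket x y)"
    and bracket_linear_right: "Vector_Spaces.linear scale scale (bracket x)"
    and bracket_alternating: "bracket x x = 0"
    and jacobi: "bracket x (bracket y z) + bracket y (bracket z x) + bracket z (bracket x y) = 0"
begin

definition ideal :: "'g set \<Rightarrow> bool" where
  "ideal I \<longleftrightarrow> subspace I \<and> (\<forall>x. \<forall>y\<in>I. bracket x y \<in> I)"

definition subalgebra :: "'g set \<Rightarrow> bool" where
  "subalgebra S \<longleftrightarrow> subspace S \<and> (\<forall>x\<in>S. \<forall>y\<in>S. bracket x y \<in> S)"

primrec lower_central_series :: "'g set \<Rightarrow> nat \<Rightarrow> 'g set" where
  "lower_central_series S 0 = S"
| "lower_central_series S (Suc n) =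
     span {bracket x y |x y. x \<in> S \<and> y \<in> lower_central_series S n}"

definition nilpotent_subalgebra :: "'g set \<Rightarrow> bool" where
  "nilpotent_subalgebra S \<longleftrightarrow> subalgebra S \<and> (\<exists>n. lower_central_series S n = {0})"

definition normalizer :: "'g set \<Rightarrow> 'g set" where
  "normalizer S = {x. \<forall>y\<in>S. bracket x y \<in> S}"

definition cartan_subalgebra :: "'g set \<Rightarrow> bool" where
  "cartan_subalgebra T \<longleftrightarrow> nilpotent_subalgebra T \<and> normalizer T = T"

text \<open>\<open>extend_basis {}\<close> is some basis of the Lie algebra; the trace does not depend on it.\<close>

definition trace :: "('g \<Rightarrow> 'g) \<Rightarrow> 'k" where
  "trace f = (\<Sum>b\<in>extend_basis {}. representation (extend_basis {}) (f b) b)"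

definition killing :: "'g \<Rightarrow> 'g \<Rightarrow> 'k" where
  "killing x y = trace (\<lambda>z. bracket x (bracket y z))"

text \<open>A linear form on the subspace \<open>T\<close> is represented by its extension by zero outside of \<open>T\<close>,
  so that equality of linear forms on \<open>T\<close> is equality of functions.\<close>

definition dual :: "'g set \<Rightarrow> ('g \<Rightarrow> 'k) set" where
  "dual T = {f. (\<forall>x\<in>T. \<forall>y\<in>T. f (x + y) = f x + f y) \<and>
                (\<forall>c. \<forall>x\<in>T. f (c *s x) = c * f x) \<and> (\<forall>x. x \<notin> T \<longrightarrow> f x = 0)}"

definition roots :: "'g set \<Rightarrow> ('g \<Rightarrow> 'k) set" where
  "roots T = {\<gamma> \<in> dual T. \<gamma> \<noteq> 0 \<and> (\<exists>x. x \<noteq> 0 \<and> (\<forall>t\<in>T. bracket t x = \<gamma> t *s x))}"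

text \<open>\<open>dual_vector T \<mu>\<close> is the element of \<open>T\<close> that corresponds to \<open>\<mu>\<close> under the isomorphism
  of \<open>T\<close> with its dual given by the Killing form.\<close>

definition dual_vector :: "'g set \<Rightarrow> ('g \<Rightarrow> 'k) \<Rightarrow> 'g" where
  "dual_vector T \<mu> = (THE t. t \<in> T \<and> (\<forall>s\<in>T. killing t s = \<mu> s))"

definition form :: "'g set \<Rightarrow> ('g \<Rightarrow> 'k) \<Rightarrow> ('g \<Rightarrow> 'k) \<Rightarrow> 'k" where
  "form T \<mu> \<nu> = killing (dual_vector T \<mu>) (dual_vector T \<nu>)"

text \<open>Simple roots (for some choice of positive roots).\<close>

definition root_base :: "'g set \<Rightarrow> ('g \<Rightarrow> 'k) set \<Rightarrow> bool" where
  "root_base T P \<longleftrightarrow> finite P \<and> P \<subseteq> roots T \<and> weights.independent P \<and> weights.span P = dual T \<and>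
     (\<forall>\<gamma>\<in>roots T. \<exists>n :: ('g \<Rightarrow> 'k) \<Rightarrow> nat.
        \<gamma> = (\<Sum>\<beta>\<in>P. fun_scale (of_nat (n \<beta>)) \<beta>) \<or> \<gamma> = - (\<Sum>\<beta>\<in>P. fun_scale (of_nat (n \<beta>)) \<beta>))"

end

locale simple_lie_algebra = lie_algebra scale bracket
  for scale :: "'k::field \<Rightarrow> 'g::ab_group_add \<Rightarrow> 'g" (infixr "*s" 75) and bracket +
  assumes not_abelian: "\<exists>x y. bracket x y \<noteq> 0"
    and ideal_trivial: "ideal I \<Longrightarrow> I = {0} \<or> I = UNIV"


section \<open>Root data with respect to a Cartan subalgebra and simple roots\<close>

locale based_simple_lie_algebra = simple_lie_algebra scale bracket
  for scale :: "'k::{alg_closed_field,field_char_0} \<Rightarrow> 'g::ab_group_add \<Rightarrow> 'g" (infixr "*s" 75)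
    and bracket +
  fixes T :: "'g set" and P :: "('g \<Rightarrow> 'k) set"
  assumes cartan: "cartan_subalgebra T"
    and base: "root_base T P"
begin

definition ht :: "('g \<Rightarrow> 'k) \<Rightarrow> ('g \<Rightarrow> 'k) \<Rightarrow> int" where
  "ht \<alpha> \<gamma> = (THE m. of_int m = weights.representation P \<gamma> \<alpha>)"

definition positive_roots :: "('g \<Rightarrow> 'k) set" where
  "positive_roots = {\<gamma> \<in> roots T. \<forall>\<beta>\<in>P. 0 \<le> ht \<beta> \<gamma>}"

definition highest_root :: "'g \<Rightarrow> 'k" where
  "highest_root = (THE \<theta>. \<theta> \<in> roots T \<and> (\<forall>\<gamma>\<in>roots T. \<forall>\<beta>\<in>P. ht \<beta> \<gamma> \<le> ht \<beta> \<theta>))"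

definition coroot :: "('g \<Rightarrow> 'k) \<Rightarrow> 'g \<Rightarrow> 'k" where
  "coroot \<gamma> = fun_scale (2 / form T \<gamma> \<gamma>) \<gamma>"

definition fundamental_weight :: "('g \<Rightarrow> 'k) \<Rightarrow> 'g \<Rightarrow> 'k" where
  "fundamental_weight \<alpha> = (THE \<phi>. \<phi> \<in> dual T \<and>
     (\<forall>\<beta>\<in>P. form T \<phi> (coroot \<beta>) = (if \<beta> = \<alpha> then 1 else 0)))"

definition half_sum :: "'g \<Rightarrow> 'k" where
  "half_sum = fun_scale (1 / 2) (\<Sum>\<gamma>\<in>positive_roots. \<gamma>)"

text \<open>The dual Coxeter number, as an element of the ground field: one plus the height of the
  highest root's coroot with respect to the simple coroots.\<close>

definition dual_coxeter :: 'k where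
  "dual_coxeter = 1 + form T half_sum (coroot highest_root)"

definition length_ratio :: "('g \<Rightarrow> 'k) \<Rightarrow> 'k" where
  "length_ratio \<alpha> = form T highest_root highest_root / form T \<alpha> \<alpha>"

definition roots_of_ht :: "('g \<Rightarrow> 'k) \<Rightarrow> int \<Rightarrow> ('g \<Rightarrow> 'k) set" where
  "roots_of_ht \<alpha> i = {\<gamma> \<in> roots T. ht \<alpha> \<gamma> = i}"

definition q_at :: "('g \<Rightarrow> 'k) \<Rightarrow> int \<Rightarrow> int" where
  "q_at \<alpha> i =
     (THE q. (\<Sum>\<gamma>\<in>roots_of_ht \<alpha> i. \<gamma>) = fun_scale (of_int q) (fundamental_weight \<alpha>))"

text \<open>The sum over all \<open>i \<ge> 1\<close>, which has only finitely many nonzero terms.\<close>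

definition q_total :: "('g \<Rightarrow> 'k) \<Rightarrow> int" where
  "q_total \<alpha> = (\<Sum>i | 1 \<le> i \<and> q_at \<alpha> i \<noteq> 0. q_at \<alpha> i)"

end

end

theory Submission
  imports Defs
begin

text \<open>The identity is a statement about root systems, and it follows from three computations.  Write
  \<open>\<phi>\<close> for the fundamental weight of \<open>\<alpha>\<close> and use \<open>(\<mu>, \<nu>) = \<Sum>\<gamma>. (\<mu>, \<gamma>) (\<gamma>, \<nu>)\<close>, where \<open>\<gamma>\<close> runs over all
  roots (\<open>form_sum_roots\<close>).

  \<^item> With \<open>\<mu> = \<phi>\<close> and \<open>\<nu> = \<alpha>\<close> this says \<open>\<Sum>i. i q(i) = 1 / (\<alpha>, \<alpha>)\<close> (\<open>weighted_sum_q\<close>).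

  \<^item> With \<open>\<mu> = \<nu> = \<theta>\<close> it says \<open>(\<theta>, \<theta>) = 1 / h\<close>, because \<open>\<langle>\<gamma>, \<theta>\<^sup>\<or>\<rangle>\<close> is \<open>0\<close> or \<open>1\<close> for every positive root
  \<open>\<gamma> \<noteq> \<theta>\<close> (\<open>dual_coxeter_norm\<close>).  So the sum above is \<open>h r\<close>.

  \<^item> The reflection in \<open>\<theta>\<close> gives \<open>q(i) = q(d - i)\<close> for \<open>0 < i < d\<close> (\<open>q_at_symmetric\<close>).

  Averaging \<open>i q(i)\<close> with \<open>(d - i) q(d - i)\<close> turns \<open>2 \<Sum>i. i q(i)\<close> into \<open>d (q + q(d))\<close>.  The common value
  \<open>2 / (\<alpha>, \<alpha>)\<close> is a positive rational number, so that \<open>q + q(d)\<close>, which is the quotient of \<open>2 h r\<close> by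
  \<open>d\<close>, is a positive integer.

  Most of the text derives the facts on roots that this needs from the axioms of a simple Lie algebra
  with a nilpotent self-normalizing subalgebra \<open>T\<close> and a base \<open>P\<close>.  The existence of a base makes the
  classical theory short.  Since \<open>P\<close> spans the dual of \<open>T\<close> and roots vanish on \<open>[T, T]\<close>, the subalgebra
  \<open>T\<close> is abelian (\<open>T_abelian\<close>).  If \<open>t \<in> T\<close> takes the value \<open>1\<close> on \<open>P\<close>, then \<open>ad t\<close> has integral
  eigenvalues and the trace of its square is positive, so the Killing form is nonzero and, by
  simplicity, nondegenerate (\<open>killing_nondegenerate\<close>).  Derivations are then inner, which identifies the
  semisimple part of \<open>ad t\<close> with \<open>ad t\<close> and yields the root space decomposition
  (\<open>span_weight_spaces\<close>).

  The geometry of the roots comes from one principle: a commutator \<open>[e, f]\<close> has trace zero on every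
  subspace that is invariant under \<open>e\<close> and \<open>f\<close> (\<open>trace_commutator_zero\<close>).  Applied to suitable sums of
  root spaces it shows that \<open>(\<gamma>, \<gamma>) \<noteq> 0\<close>, that root spaces are one-dimensional, and that root strings
  are symmetric under reflections (\<open>root_string\<close>).  The highest root exists because the Dynkin diagram is
  connected: an orthogonal splitting of the simple roots would produce a proper ideal
  (\<open>simple_roots_connected\<close>).\<close>

section \<open>Traces and generalized eigenspaces\<close>

text \<open>A separate locale keeps these definitions out of the other instances of \<open>vector_space\<close>, which
  would otherwise inherit them.\<close>

locale linear_operators = vector_space scale
  for scale :: "'a::field \<Rightarrow> 'b::ab_group_add \<Rightarrow> 'b" (infixr "*s" 75)
begin

abbreviation endo :: "('b \<Rightarrow> 'b) \<Rightarrow> bool" where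
  "endo f \<equiv> Vector_Spaces.linear scale scale f"

lemma endo_iff: "endo f \<longleftrightarrow> (\<forall>x y. f (x + y) = f x + f y) \<and> (\<forall>c x. f (c *s x) = c *s f x)"
  using vector_space_axioms by (auto simp: Vector_Spaces.linear_iff)

lemma
  assumes "endo f"
  shows endo_add: "f (x + y) = f x + f y"
    and endo_scale: "f (c *s x) = c *s f x"
    and endo_0: "f 0 = 0"
    and endo_minus: "f (- x) = - f x"
    and endo_diff: "f (x - y) = f x - f y"
    and endo_sum: "f (sum g S) = (\<Sum>a\<in>S. f (g a))"
proof -
  interpret h: Vector_Spaces.linear scale scale f by fact
  show "f (x + y) = f x + f y" "f (c *s x) = c *s f x" "f 0 = 0" "f (- x) = - f x"
    "f (x - y) = f x - f y" "f (sum g S) = (\<Sum>a\<in>S. f (g a))"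
    by (rule h.add h.scale h.zero h.neg h.diff h.sum)+
qed

lemma endo_comp: "endo f \<Longrightarrow> endo g \<Longrightarrow> endo (\<lambda>x. f (g x))"
  by (simp add: endo_iff)

lemma endo_funpow: "endo f \<Longrightarrow> endo (f ^^ n)"
  by (induction n) (auto simp: endo_iff)

lemma endo_span_into:
  assumes f: "endo f" and B: "\<And>b. b \<in> B \<Longrightarrow> f b \<in> W" and W: "subspace W" and x: "x \<in> span B"
  shows "f x \<in> W"
  using x
proof (induction rule: span_induct_alt)
  case base
  show ?case using f W by (simp add: endo_0 subspace_0)
next
  case (step c x y)
  then show ?case using f W B by (simp add: endo_add endo_scale subspace_add subspace_scale)
qed

lemma endo_eq_on_span:
  assumes f: "endo f" and g: "endo g" and B: "\<And>b. b \<in> B \<Longrightarrow> f b = g b" and x: "x \<in> span B"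
  shows "f x = g x"
  using x
  by (induction rule: span_induct_alt) (use f g B in \<open>auto simp: endo_0 endo_add endo_scale\<close>)

lemma representation_expand:
  assumes "finite B" "independent B" "x \<in> span B"
  shows "x = (\<Sum>b\<in>B. representation B x b *s b)"
  using sum_representation_eq[OF assms(2,3,1)] by simp

text \<open>For a basis \<open>B\<close> of an invariant subspace this is the trace of the restriction of \<open>f\<close>, without the need
  to restrict \<open>f\<close>.\<close>

definition trace_on :: "'b set \<Rightarrow> ('b \<Rightarrow> 'b) \<Rightarrow> 'a" where
  "trace_on B f = (\<Sum>b\<in>B. representation B (f b) b)"

lemma representation_image_expand:
  assumes "finite C" "independent C" and B: "independent B"
    and f: "endo f" and CB: "\<And>c. c \<in> C \<Longrightarrow> f c \<in> span B" and x: "x \<in> span C"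
  shows "representation B (f x) b = (\<Sum>c\<in>C. representation C x c * representation B (f c) b)"
proof -
  have "f x = (\<Sum>c\<in>C. representation C x c *s f c)"
    by (subst representation_expand[OF assms(1,2) x])
       (simp add: endo_sum[OF f] endo_scale[OF f])
  then show ?thesis
    using CB B by (simp add: representation_sum representation_scale span_scale)
qed

lemma trace_on_comm:
  assumes B: "finite B" "independent B" and f: "endo f" and g: "endo g"
    and fB: "\<And>b. b \<in> B \<Longrightarrow> f b \<in> span B" and gB: "\<And>b. b \<in> B \<Longrightarrow> g b \<in> span B"
  shows "trace_on B (\<lambda>x. f (g x)) = trace_on B (\<lambda>x. g (f x))"
proof -
  have "trace_on B (\<lambda>x. f (g x)) =
      (\<Sum>b\<in>B. \<Sum>c\<in>B. representation B (g b) c * representation B (f c) b)"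
    unfolding trace_on_def
    by (intro sum.cong refl representation_image_expand B f g fB gB)
  also have "\<dots> = (\<Sum>c\<in>B. \<Sum>b\<in>B. representation B (f c) b * representation B (g b) c)"
    by (subst sum.swap) (simp add: mult.commute)
  also have "\<dots> = trace_on B (\<lambda>x. g (f x))"
    unfolding trace_on_def
    by (intro sum.cong refl representation_image_expand[symmetric] B f g fB gB)
  finally show ?thesis .
qed

lemma trace_on_basis_change:
  assumes B: "finite B" "independent B" and C: "finite C" "independent C" and BC: "span B = span C"
    and f: "endo f" and fB: "\<And>x. x \<in> span B \<Longrightarrow> f x \<in> span B"
  shows "trace_on B f = trace_on C f"
proof -
  have "trace_on B f = (\<Sum>b\<in>B. \<Sum>c\<in>C. representation C (f b) c * representation B c b)"
    unfolding trace_on_def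
  proof (intro sum.cong refl)
    fix b assume "b \<in> B"
    then have "f b \<in> span C" using fB[OF span_base] BC by blast
    then show "representation B (f b) b = (\<Sum>c\<in>C. representation C (f b) c * representation B c b)"
      using representation_image_expand[OF C B(2), of "\<lambda>x. x" "f b" b] BC
      by (simp add: span_base linear_ident)
  qed
  also have "\<dots> = (\<Sum>c\<in>C. \<Sum>b\<in>B. representation B c b * representation C (f b) c)"
    by (subst sum.swap) (simp add: mult.commute)
  also have "\<dots> = trace_on C f"
    unfolding trace_on_def
    using BC fB
    by (intro sum.cong refl representation_image_expand[symmetric] B C f) (use span_base in blast)+
  finally show ?thesis .
qed

lemma trace_on_diff:
  assumes "independent B" "span B = UNIV"
  shows "trace_on B (\<lambda>x. f x - g x) = trace_on B f - trace_on B g"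
  using assms by (simp add: trace_on_def representation_diff sum_subtractf)

lemma trace_on_add:
  assumes "independent B" "span B = UNIV"
  shows "trace_on B (\<lambda>x. f x + g x) = trace_on B f + trace_on B g"
  using assms by (simp add: trace_on_def representation_add sum.distrib)

lemma trace_on_scale:
  assumes "independent B" "span B = UNIV"
  shows "trace_on B (\<lambda>x. c *s f x) = c * trace_on B f"
  using assms by (simp add: trace_on_def representation_scale sum_distrib_left)

lemma trace_on_diagonal:
  assumes "independent B" and f: "\<And>b. b \<in> B \<Longrightarrow> f b = ev b *s b"
  shows "trace_on B f = (\<Sum>b\<in>B. ev b)"
  unfolding trace_on_def using assms
  by (intro sum.cong refl) (simp add: representation_scale representation_basis span_base)

lemma exists_projection:
  assumes W: "subspace W"
  obtains \<pi> where "endo \<pi>" "\<And>x. \<pi> x \<in> W" "\<And>x. x \<in> W \<Longrightarrow> \<pi> x = x"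
proof -
  interpret p: vector_space_pair scale scale ..
  obtain B where B: "B \<subseteq> W" "independent B" "W \<subseteq> span B"
    using basis_exists[of W] by metis
  obtain \<pi> where \<pi>: "endo \<pi>" "\<forall>x\<in>B. \<pi> x = x" "range \<pi> = span ((\<lambda>x. x) ` B)"
    using p.linear_independent_extend_subspace[OF B(2), of "\<lambda>x. x"] by metis
  have sW: "span B = W" using B W by (simp add: span_subspace)
  show thesis
  proof
    show "endo \<pi>" by fact
    show "\<pi> x \<in> W" for x using \<pi>(3) sW by auto
    show "\<pi> x = x" if "x \<in> W" for x
      using endo_eq_on_span[OF \<pi>(1), of "\<lambda>x. x" B x] \<pi>(2) that sW by (simp add: endo_iff)
  qed
qed

text \<open>Cutting a nilpotent operator \<open>N\<close> down by a projection onto its range does not change the trace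
  and lowers the nilpotency index.\<close>

lemma trace_on_nilpotent_aux:
  assumes B: "finite B" "independent B" "span B = UNIV"
  shows "endo N \<Longrightarrow> (\<And>x. (N ^^ Suc k) x = 0) \<Longrightarrow> trace_on B N = 0"
proof (induction k arbitrary: N)
  case 0
  then show ?case using B by (simp add: trace_on_def representation_zero)
next
  case (Suc k)
  have "subspace (range N)"
  proof (rule subspaceI)
    note N = Suc.prems(1)
    show "0 \<in> range N" using rangeI[of N 0] endo_0[OF N] by simp
    show "x + y \<in> range N" if "x \<in> range N" "y \<in> range N" for x y
      using that by (auto simp: endo_add[OF N, symmetric])
    show "c *s x \<in> range N" if "x \<in> range N" for c x
      using that by (auto simp: endo_scale[OF N, symmetric])
  qed
  then obtain \<pi> where \<pi>: "endo \<pi>" "\<And>x. \<pi> x \<in> range N" "\<And>x. x \<in> range N \<Longrightarrow> \<pi> x = x"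
    by (rule exists_projection) blast
  have "trace_on B N = trace_on B (\<lambda>x. \<pi> (N x))"
    by (simp add: \<pi>(3))
  also have "\<dots> = trace_on B (\<lambda>x. N (\<pi> x))"
    using B by (intro trace_on_comm \<pi> Suc.prems) auto
  also have "\<dots> = 0"
  proof (rule Suc.IH)
    show "endo (\<lambda>x. N (\<pi> x))" using Suc.prems(1) \<pi>(1) by (rule endo_comp)
    show "((\<lambda>x. N (\<pi> x)) ^^ Suc k) x = 0" for x
    proof -
      have cut: "((\<lambda>x. N (\<pi> x)) ^^ Suc j) x = (N ^^ Suc j) (\<pi> x)" for j
        by (induction j) (simp_all add: \<pi>(3))
      obtain y where "\<pi> x = N y" using \<pi>(2)[of x] by blast
      then have "(N ^^ Suc k) (\<pi> x) = (N ^^ Suc (Suc k)) y"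
        by (simp only: funpow_Suc_right o_apply)
      then show ?thesis using cut Suc.prems(2) by simp
    qed
  qed
  finally show ?case .
qed

lemma trace_on_nilpotent:
  assumes B: "finite B" "independent B" "span B = UNIV" and N: "endo N"
    and nil: "\<And>b. b \<in> B \<Longrightarrow> \<exists>n. (N ^^ n) b = 0"
  shows "trace_on B N = 0"
proof -
  obtain n where n: "\<And>b. b \<in> B \<Longrightarrow> (N ^^ n b) b = 0" using nil by metis
  define m where "m = Suc (\<Sum>b\<in>B. n b)"
  have "(N ^^ m) b = 0" if "b \<in> B" for b
  proof -
    have "n b \<le> (\<Sum>b\<in>B. n b)" using B(1) that by (intro member_le_sum) auto
    then have "m = (m - n b) + n b" by (simp add: m_def)
    then have "(N ^^ m) b = (N ^^ (m - n b)) ((N ^^ n b) b)" by (metis funpow_add o_apply)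
    then show ?thesis using n that by (simp add: endo_0[OF endo_funpow[OF N]])
  qed
  then have "(N ^^ m) x = 0" for x
    using endo_eq_on_span[OF endo_funpow[OF N], of "\<lambda>x. 0" B m x] B(3) by (simp add: endo_iff)
  then show ?thesis
    using trace_on_nilpotent_aux[OF B N] unfolding m_def by blast
qed

abbreviation shift_by :: "('b \<Rightarrow> 'b) \<Rightarrow> 'a \<Rightarrow> 'b \<Rightarrow> 'b" where
  "shift_by f a \<equiv> (\<lambda>x. f x - a *s x)"

definition gen_eigenspace :: "('b \<Rightarrow> 'b) \<Rightarrow> 'a \<Rightarrow> 'b set" where
  "gen_eigenspace f a = {x. \<exists>n. (shift_by f a ^^ n) x = 0}"

lemma endo_shift: "endo f \<Longrightarrow> endo (shift_by f a)"
  by (auto simp: endo_iff algebra_simps)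

lemma endo_shift_funpow: "endo f \<Longrightarrow> endo (shift_by f a ^^ n)"
  by (intro endo_funpow endo_shift)

lemma subspace_gen_eigenspace:
  assumes f: "endo f"
  shows "subspace (gen_eigenspace f a)"
proof (rule subspaceI)
  note l = endo_shift_funpow[OF f, where a = a]
  show "0 \<in> gen_eigenspace f a" using endo_0[OF l] by (auto simp: gen_eigenspace_def)
  show "c *s x \<in> gen_eigenspace f a" if "x \<in> gen_eigenspace f a" for c x
    using that endo_scale[OF l] by (fastforce simp: gen_eigenspace_def)
  fix x y assume "x \<in> gen_eigenspace f a" "y \<in> gen_eigenspace f a"
  then obtain m n where mn: "(shift_by f a ^^ m) x = 0" "(shift_by f a ^^ n) y = 0"
    by (auto simp: gen_eigenspace_def)
  have "(shift_by f a ^^ (m + n)) (x + y) = 0"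
    using mn endo_add[OF l] endo_0[OF l]
    by (metis (no_types, lifting) add.commute add.right_neutral funpow_add o_apply)
  then show "x + y \<in> gen_eigenspace f a" by (auto simp: gen_eigenspace_def)
qed

lemma gen_eigenspace_shiftD:
  assumes "shift_by f a x \<in> gen_eigenspace f a"
  shows "x \<in> gen_eigenspace f a"
proof -
  obtain n where "(shift_by f a ^^ n) (shift_by f a x) = 0"
    using assms unfolding gen_eigenspace_def by blast
  then have "(shift_by f a ^^ Suc n) x = 0" by (simp only: funpow_Suc_right o_apply)
  then show ?thesis unfolding gen_eigenspace_def by blast
qed

lemma gen_eigenspace_commuting:
  assumes f: "endo f" and g: "endo g" and fg: "\<And>y. f (g y) = g (f y)"
    and x: "x \<in> gen_eigenspace f a"
  shows "g x \<in> gen_eigenspace f a"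
proof -
  have "(shift_by f a ^^ n) (g x) = g ((shift_by f a ^^ n) x)" for n
    by (induction n) (simp_all add: fg endo_diff[OF g] endo_scale[OF g])
  moreover obtain n where "(shift_by f a ^^ n) x = 0" using x by (auto simp: gen_eigenspace_def)
  ultimately have "(shift_by f a ^^ n) (g x) = 0" using endo_0[OF g] by simp
  then show ?thesis by (auto simp: gen_eigenspace_def)
qed

lemma gen_eigenspace_shiftI:
  assumes "endo f" "x \<in> gen_eigenspace f a"
  shows "shift_by f b x \<in> gen_eigenspace f a"
  using assms by (intro gen_eigenspace_commuting[where g = "shift_by f b"] endo_shift)
    (simp_all add: endo_diff endo_scale)

lemma eigenvector_in_gen_eigenspace: "f x = a *s x \<Longrightarrow> x \<in> gen_eigenspace f a"
  by (auto simp: gen_eigenspace_def intro!: exI[of _ 1])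

lemma gen_eigenspace_induct [consumes 2, case_names zero shift]:
  assumes f: "endo f" and x: "x \<in> gen_eigenspace f a"
    and zero: "P 0"
    and step: "\<And>x. x \<in> gen_eigenspace f a \<Longrightarrow> P (shift_by f a x) \<Longrightarrow> P x"
  shows "P x"
proof -
  obtain n where "(shift_by f a ^^ n) x = 0" using x by (auto simp: gen_eigenspace_def)
  then show ?thesis
  proof (induction n arbitrary: x)
    case 0
    then show ?case using zero by simp
  next
    case (Suc n)
    then have *: "(shift_by f a ^^ n) (shift_by f a x) = 0" by (simp only: funpow_Suc_right o_apply)
    have "x \<in> gen_eigenspace f a" using Suc.prems unfolding gen_eigenspace_def by blast
    then show ?case using Suc.IH[OF *] by (rule step)
  qed
qed

text \<open>On the generalized eigenspace of \<open>b \<noteq> a\<close> the operator \<open>f - a\<close> is invertible: it is the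
  nonzero scalar \<open>b - a\<close> plus a nilpotent operator.\<close>

lemma shift_surj_gen_eigenspace:
  assumes f: "endo f" and "b \<noteq> a" and "w \<in> gen_eigenspace f b"
  shows "\<exists>u\<in>gen_eigenspace f b. shift_by f a u = w"
  using f assms(3)
proof (induction rule: gen_eigenspace_induct)
  case zero
  show ?case
    using subspace_0[OF subspace_gen_eigenspace[OF f]] by (intro bexI[of _ 0]) (simp_all add: endo_0[OF f])
next
  case (shift w)
  then obtain u where u: "u \<in> gen_eigenspace f b" "shift_by f a u = shift_by f b w" by blast
  define v where "v = inverse (b - a) *s (w - u)"
  have "shift_by f a (w - u) = (b - a) *s w"
    using u(2) by (simp add: endo_diff[OF f] algebra_simps)
  then have "shift_by f a v = w"
    unfolding v_def endo_scale[OF endo_shift[OF f]] using \<open>b \<noteq> a\<close> by simp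
  moreover have "v \<in> gen_eigenspace f b"
    unfolding v_def using subspace_gen_eigenspace[OF f] shift u(1)
    by (intro subspace_scale subspace_diff)
  ultimately show ?case by blast
qed

text \<open>By induction on the nilpotency order the claim holds for \<open>(f - b) y\<close>, and \<open>(f - a) y - (f - b) y\<close> is a
  nonzero multiple of \<open>y\<close>.\<close>

lemma shift_reflects_invariant_subspace:
  assumes f: "endo f" and "b \<noteq> a" and W: "subspace W" "\<And>w. w \<in> W \<Longrightarrow> f w \<in> W"
    and "y \<in> gen_eigenspace f b" "shift_by f a y \<in> W"
  shows "y \<in> W"
  using f assms(5,6)
proof (induction rule: gen_eigenspace_induct)
  case zero
  show ?case using W(1) by (rule subspace_0)
next
  case (shift y)
  have "shift_by f a (shift_by f b y) = f (shift_by f a y) - b *s shift_by f a y"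
    by (simp add: endo_diff[OF f] endo_scale[OF f] algebra_simps)
  also have "\<dots> \<in> W"
    by (rule subspace_diff[OF W(1) W(2)[OF shift.prems] subspace_scale[OF W(1) shift.prems]])
  finally have "shift_by f b y \<in> W" by (rule shift.IH)
  then have "inverse (b - a) *s (shift_by f a y - shift_by f b y) \<in> W"
    by (rule subspace_scale[OF W(1) subspace_diff[OF W(1) shift.prems]])
  moreover have "shift_by f a y - shift_by f b y = (b - a) *s y" by (simp add: algebra_simps)
  ultimately show ?case using \<open>b \<noteq> a\<close> by simp
qed

text \<open>A power of \<open>f - a\<^sub>0\<close> removes the component of \<open>a\<^sub>0\<close>; by induction its values on the other components
  lie in \<open>W\<close>, and there it can be undone.  The case \<open>W = {0}\<close> is the independence of the generalized
  eigenspaces; an eigenspace \<open>W\<close> of a commuting operator gives simultaneous diagonalization.\<close>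

lemma gen_eigenspace_components:
  assumes f: "endo f" and W: "subspace W" "\<And>w. w \<in> W \<Longrightarrow> f w \<in> W"
    and "finite A" "\<And>a. a \<in> A \<Longrightarrow> x a \<in> gen_eigenspace f a" "(\<Sum>a\<in>A. x a) \<in> W" "a \<in> A"
  shows "x a \<in> W"
proof -
  have "\<forall>a\<in>A. x a \<in> W" using assms(4-6)
  proof (induction A arbitrary: x)
    case empty
    then show ?case by simp
  next
    case (insert a0 A)
    obtain n where n: "(shift_by f a0 ^^ n) (x a0) = 0"
      using insert.prems(1)[of a0] by (auto simp: gen_eigenspace_def)
    note l = endo_shift_funpow[OF f, where a = a0]
    have "(shift_by f a0 ^^ n) w \<in> W" if "w \<in> W" for n w
      using that by (induction n) (auto intro: W subspace_diff subspace_scale)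
    from this[OF insert.prems(2), of n]
    have "(\<Sum>a\<in>A. (shift_by f a0 ^^ n) (x a)) \<in> W"
      using insert.hyps n by (simp add: endo_add[OF l] endo_sum[OF l])
    moreover have gen: "(shift_by f a0 ^^ m) y \<in> gen_eigenspace f a" if "y \<in> gen_eigenspace f a" for a y m
      using that by (induction m) (auto intro!: gen_eigenspace_shiftI f)
    ultimately have IH: "\<forall>a\<in>A. (shift_by f a0 ^^ n) (x a) \<in> W"
      using insert.prems(1) by (intro insert.IH) auto
    have pull: "y \<in> W" if "(shift_by f a0 ^^ m) y \<in> W" "y \<in> gen_eigenspace f a" "a \<noteq> a0" for y a m
      using that
      by (induction m) (auto dest: shift_reflects_invariant_subspace[OF f _ W gen])
    have xa: "x a \<in> W" if "a \<in> A" for a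
      using IH that insert.hyps insert.prems(1) by (intro pull[of n "x a" a]) auto
    moreover have "x a0 \<in> W"
    proof -
      have "x a0 = (\<Sum>a\<in>insert a0 A. x a) - (\<Sum>a\<in>A. x a)"
        using insert.hyps by simp
      then show ?thesis using insert.prems(2) xa W(1) by (metis subspace_diff subspace_sum)
    qed
    ultimately show ?case by blast
  qed
  then show ?thesis using assms(7) by blast
qed

text \<open>The operator \<open>f - a\<close> maps the generalized eigenspace of each \<open>b \<noteq> a\<close> onto itself.  So some \<open>u\<close> in the
  span brings \<open>(f - a) (u - w)\<close> into the generalized eigenspace of \<open>a\<close>, which then contains \<open>u - w\<close>.\<close>

lemma span_gen_eigenspaces_shiftD:
  assumes f: "endo f" and w: "shift_by f a w \<in> span (\<Union>b. gen_eigenspace f b)"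
  shows "w \<in> span (\<Union>b. gen_eigenspace f b)"
proof -
  let ?S = "span (\<Union>b. gen_eigenspace f b)"
  note sh = endo_shift[OF f, of a]
  have ex: "\<exists>u\<in>?S. shift_by f a u - w' \<in> gen_eigenspace f a" if "w' \<in> ?S" for w'
    using that
  proof (induction rule: span_induct_alt)
    case base
    show ?case using subspace_0[OF subspace_gen_eigenspace[OF f]]
      by (intro bexI[of _ 0]) (simp_all add: endo_0[OF f] span_zero)
  next
    case (step c x y)
    then obtain b where b: "x \<in> gen_eigenspace f b" by blast
    obtain u where u: "u \<in> ?S" "shift_by f a u - x \<in> gen_eigenspace f a"
    proof (cases "b = a")
      case True
      then show thesis
        using b subspace_neg[OF subspace_gen_eigenspace[OF f]]
        by (intro that[of 0]) (simp_all add: endo_0[OF f] span_zero)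
    next
      case False
      then show thesis
        using shift_surj_gen_eigenspace[OF f False b] subspace_0[OF subspace_gen_eigenspace[OF f]]
        by (metis UN_I UNIV_I diff_self span_base that)
    qed
    obtain v where v: "v \<in> ?S" "shift_by f a v - y \<in> gen_eigenspace f a" using step by blast
    have "shift_by f a (c *s u + v) - (c *s x + y) = c *s (shift_by f a u - x) + (shift_by f a v - y)"
      by (simp add: endo_add[OF f] endo_scale[OF f] algebra_simps)
    then have "shift_by f a (c *s u + v) - (c *s x + y) \<in> gen_eigenspace f a"
      using u v by (metis (no_types, lifting) subspace_add subspace_scale subspace_gen_eigenspace[OF f])
    then show ?case using u v by (intro bexI[of _ "c *s u + v"] span_add span_scale)
  qed
  obtain u where u: "u \<in> ?S" "shift_by f a u - shift_by f a w \<in> gen_eigenspace f a" using ex[OF w] by blast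
  then have "shift_by f a (u - w) \<in> gen_eigenspace f a" using endo_diff[OF sh] by simp
  then have "u - w \<in> gen_eigenspace f a" by (rule gen_eigenspace_shiftD)
  then have "u - w \<in> ?S" by (auto intro: span_base)
  then have "u - (u - w) \<in> ?S" by (rule span_diff[OF u(1)])
  then show ?thesis by (simp only: diff_diff_eq2 add_diff_cancel_left')
qed

lemma polynomial_relation:
  fixes f :: "'b \<Rightarrow> 'b"
  assumes B: "finite B" "span B = UNIV"
  shows "\<exists>p :: 'a poly. p \<noteq> 0 \<and> (\<Sum>i\<le>degree p. coeff p i *s (f ^^ i) w) = 0"
proof -
  let ?v = "\<lambda>i. (f ^^ i) w"
  let ?n = "card B"
  \<comment> \<open>Dependence is a property of sets and does not see repetitions among the vectors \<open>f\<^sup>i w\<close>.\<close>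
  have "\<exists>u. (\<exists>i\<le>?n. u i \<noteq> 0) \<and> (\<Sum>i\<le>?n. u i *s ?v i) = 0"
  proof (cases "inj_on ?v {..?n}")
    case True
    have "dependent (?v ` {..?n})"
    proof (rule ccontr)
      assume "independent (?v ` {..?n})"
      from independent_span_bound[OF B(1) this] B(2) have "card (?v ` {..?n}) \<le> ?n" by simp
      then show False using True by (simp add: card_image)
    qed
    then obtain u where u: "\<exists>v\<in>?v ` {..?n}. u v \<noteq> 0" "(\<Sum>v\<in>?v ` {..?n}. u v *s v) = 0"
      by (subst (asm) dependent_finite) auto
    then have "(\<Sum>i\<le>?n. u (?v i) *s ?v i) = 0" by (simp add: sum.reindex[OF True] o_def)
    then show ?thesis using u(1) by (intro exI[of _ "\<lambda>i. u (?v i)"]) auto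
  next
    case False
    then obtain i j where ij: "i \<le> ?n" "j \<le> ?n" "i \<noteq> j" "?v i = ?v j" by (auto simp: inj_on_def)
    let ?u = "\<lambda>k. if k = i then 1 else if k = j then -1 else (0::'a)"
    have "(\<Sum>k\<le>?n. ?u k *s ?v k) = (\<Sum>k\<in>{i,j}. ?u k *s ?v k)"
      using ij by (intro sum.mono_neutral_right) auto
    also have "\<dots> = 0" using ij by simp
    finally show ?thesis using ij by (intro exI[of _ ?u]) auto
  qed
  then obtain u where u: "\<exists>i\<le>?n. u i \<noteq> 0" "(\<Sum>i\<le>?n. u i *s ?v i) = 0" by blast
  define p where "p = (\<Sum>i\<le>?n. monom (u i) i)"
  have cp: "coeff p i = (if i \<le> ?n then u i else 0)" for i
    by (simp add: p_def coeff_sum if_distrib[of "\<lambda>x. x = _"] cong: if_cong)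
  have "p \<noteq> 0" using u(1) cp by (metis coeff_0)
  moreover have "degree p \<le> ?n" by (rule degree_le) (simp add: cp)
  then have "(\<Sum>i\<le>degree p. coeff p i *s ?v i) = (\<Sum>i\<le>?n. coeff p i *s ?v i)"
    by (intro sum.mono_neutral_left) (auto simp: coeff_eq_0)
  then have "(\<Sum>i\<le>degree p. coeff p i *s ?v i) = 0" using u(2) by (simp add: cp)
  ultimately show ?thesis by blast
qed

text \<open>Over an algebraically closed field, a property of vectors that holds for \<open>0\<close> and passes from
  \<open>(f - a) w\<close> to \<open>w\<close> holds everywhere: every vector is annihilated by a product of such factors.\<close>

lemma shift_induct:
  fixes f :: "'b \<Rightarrow> 'b"
  assumes closed: "\<And>p :: 'a poly. degree p > 0 \<Longrightarrow> \<exists>x. poly p x = 0"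
    and B: "finite B" "span B = UNIV" and f: "endo f"
    and zero: "Q 0" and step: "\<And>a w. Q (shift_by f a w) \<Longrightarrow> Q w"
  shows "Q w"
proof -
  have "Q w" if "p \<noteq> 0" "(\<Sum>i\<le>degree p. coeff p i *s (f ^^ i) w) = 0" for p :: "'a poly" and w
    using that
  proof (induction "degree p" arbitrary: p w)
    case 0
    from 0 have "coeff p 0 *s w = 0" "coeff p 0 \<noteq> 0" by (simp_all flip: leading_coeff_0_iff)
    then show ?case using zero by simp
  next
    case (Suc m)
    obtain a where "poly p a = 0" using closed[of p] Suc.hyps(2) by auto
    then obtain q where q: "p = [:- a, 1:] * q" by (auto simp: poly_eq_0_iff_dvd)
    have q0: "q \<noteq> 0" using Suc.prems(1) q by auto
    have deg: "degree p = Suc (degree q)" unfolding q using q0 by (subst degree_mult_eq) auto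
    have cp: "coeff p i = (case i of 0 \<Rightarrow> 0 | Suc j \<Rightarrow> coeff q j) - a * coeff q i" for i
      by (simp add: q coeff_pCons split: nat.splits)
    have "(\<Sum>i\<le>degree q. coeff q i *s (f ^^ i) (shift_by f a w)) =
        (\<Sum>i\<le>degree q. coeff q i *s (f ^^ Suc i) w) - (\<Sum>i\<le>degree q. (a * coeff q i) *s (f ^^ i) w)"
      by (simp add: endo_diff[OF endo_funpow[OF f]] endo_scale[OF endo_funpow[OF f]] funpow_swap1
          scale_right_diff_distrib sum_subtractf mult.commute)
    also have "(\<Sum>i\<le>degree q. coeff q i *s (f ^^ Suc i) w) =
        (\<Sum>i\<le>degree p. (case i of 0 \<Rightarrow> 0 | Suc j \<Rightarrow> coeff q j) *s (f ^^ i) w)"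
      unfolding deg by (simp only: sum.atMost_Suc_shift) simp
    also have "(\<Sum>i\<le>degree q. (a * coeff q i) *s (f ^^ i) w) =
        (\<Sum>i\<le>degree p. (a * coeff q i) *s (f ^^ i) w)"
      using deg by (intro sum.mono_neutral_left) (auto simp: coeff_eq_0)
    also have "(\<Sum>i\<le>degree p. (case i of 0 \<Rightarrow> 0 | Suc j \<Rightarrow> coeff q j) *s (f ^^ i) w) - \<dots> =
        (\<Sum>i\<le>degree p. coeff p i *s (f ^^ i) w)"
      by (simp add: cp sum_subtractf scale_left_diff_distrib)
    finally have "Q (shift_by f a w)"
      using Suc.hyps(1)[of q "shift_by f a w"] Suc.hyps(2) Suc.prems(2) deg q0 by simp
    then show ?case by (rule step)
  qed
  then show ?thesis using polynomial_relation[OF B] by blast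
qed

lemma span_gen_eigenspaces:
  fixes f :: "'b \<Rightarrow> 'b"
  assumes closed: "\<And>p :: 'a poly. degree p > 0 \<Longrightarrow> \<exists>x. poly p x = 0"
    and B: "finite B" "span B = UNIV" and f: "endo f"
  shows "span (\<Union>a. gen_eigenspace f a) = UNIV"
proof -
  have "w \<in> span (\<Union>a. gen_eigenspace f a)" for w
    by (rule shift_induct[where Q = "\<lambda>w. w \<in> span (\<Union>a. gen_eigenspace f a)", OF closed B f])
       (auto simp: span_zero intro: span_gen_eigenspaces_shiftD[OF f])
  then show ?thesis by blast
qed

lemma exists_gen_eigenbasis:
  fixes f :: "'b \<Rightarrow> 'b"
  assumes closed: "\<And>p :: 'a poly. degree p > 0 \<Longrightarrow> \<exists>x. poly p x = 0"
    and A: "finite A" "span A = UNIV" and f: "endo f"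
  obtains B ev where "independent B" "span B = UNIV" "\<forall>b\<in>B. b \<in> gen_eigenspace f (ev b)"
proof -
  let ?U = "\<Union>a. gen_eigenspace f a"
  obtain B where B: "B \<subseteq> ?U" "independent B" "?U \<subseteq> span B"
    using maximal_independent_subset[of ?U] by metis
  have "span ?U = UNIV" by (rule span_gen_eigenspaces[OF closed A f])
  then have "span B = UNIV" using span_mono[OF B(3)] span_span[of B] by auto
  moreover have "\<forall>b\<in>B. \<exists>a. b \<in> gen_eigenspace f a" using B(1) by blast
  then obtain ev where "\<forall>b\<in>B. b \<in> gen_eigenspace f (ev b)" by metis
  ultimately show thesis using that[of B ev] B(2) by blast
qed

lemma exists_eigenvector_in_subspace:
  fixes f :: "'b \<Rightarrow> 'b"
  assumes closed: "\<And>p :: 'a poly. degree p > 0 \<Longrightarrow> \<exists>x. poly p x = 0"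
    and B: "finite B" "span B = UNIV" and f: "endo f"
    and W: "subspace W" "\<And>w. w \<in> W \<Longrightarrow> f w \<in> W" and w: "w \<in> W" "w \<noteq> 0"
  obtains a x where "x \<in> W" "x \<noteq> 0" "f x = a *s x"
proof -
  have "w \<in> W \<longrightarrow> w \<noteq> 0 \<longrightarrow> (\<exists>a x. x \<in> W \<and> x \<noteq> 0 \<and> f x = a *s x)" (is "?Q w") for w
  proof (rule shift_induct[where Q = ?Q, OF closed B f])
    fix a w assume "?Q (shift_by f a w)"
    moreover have "shift_by f a w \<in> W" if "w \<in> W"
      using that W by (intro subspace_diff subspace_scale)
    ultimately show "?Q w" by (cases "shift_by f a w = 0") auto
  qed simp_all
  then show thesis using w that by blast
qed

lemma gen_eigenspace_decomposition:
  assumes f: "endo f" and w: "w \<in> span (\<Union>a. gen_eigenspace f a)"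
  obtains A x where "finite A" "\<And>a. x a \<in> gen_eigenspace f a" "w = (\<Sum>a\<in>A. x a)"
proof -
  have "\<exists>A x. finite A \<and> (\<forall>a. x a \<in> gen_eigenspace f a) \<and> w = (\<Sum>a\<in>A. x a)"
    using w
  proof (induction rule: span_induct_alt)
    case base
    show ?case using subspace_0[OF subspace_gen_eigenspace[OF f]]
      by (intro exI[of _ "{}"] exI[of _ "\<lambda>_. 0"]) auto
  next
    case (step c v y)
    then obtain b A x where b: "v \<in> gen_eigenspace f b"
      and A: "finite A" "\<And>a. x a \<in> gen_eigenspace f a" "y = (\<Sum>a\<in>A. x a)" by blast
    define x' where "x' a = (if a = b then c *s v else 0) + (if a \<in> A then x a else 0)" for a
    have "x' a \<in> gen_eigenspace f a" for a
      unfolding x'_def using A(2) b subspace_0[OF subspace_gen_eigenspace[OF f]]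
      by (auto intro!: subspace_add[OF subspace_gen_eigenspace[OF f]]
          subspace_scale[OF subspace_gen_eigenspace[OF f]])
    moreover have "c *s v + y = (\<Sum>a\<in>insert b A. x' a)"
    proof -
      have "(\<Sum>a\<in>insert b A. if a \<in> A then x a else 0) = (\<Sum>a\<in>A. x a)"
        using A(1) by (intro sum.mono_neutral_cong_right) auto
      then show ?thesis using A(1,3) unfolding x'_def sum.distrib by (subst sum.delta) auto
    qed
    ultimately show ?case using A(1) by blast
  qed
  then show thesis using that by blast
qed

text \<open>The operator \<open>f\<^sup>2 - a\<^sup>2 = (f + a) (f - a)\<close> is locally nilpotent wherever \<open>f - a\<close> is.\<close>

lemma gen_eigenspace_square:
  assumes f: "endo f" and x: "x \<in> gen_eigenspace f a"
  shows "x \<in> gen_eigenspace (\<lambda>y. f (f y)) (a\<^sup>2)"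
  using f x
proof (induction rule: gen_eigenspace_induct)
  case zero
  show ?case by (rule subspace_0[OF subspace_gen_eigenspace[OF endo_comp[OF f f]]])
next
  case (shift x)
  have "endo (\<lambda>y. f y + a *s y)" using f by (auto simp: endo_iff algebra_simps)
  then have "(\<lambda>y. f y + a *s y) (shift_by f a x) \<in> gen_eigenspace (\<lambda>y. f (f y)) (a\<^sup>2)"
    by (rule gen_eigenspace_commuting[OF endo_comp[OF f f] _ _ shift(2)])
      (simp add: endo_add[OF f] endo_scale[OF f])
  then have "shift_by (\<lambda>y. f (f y)) (a\<^sup>2) x \<in> gen_eigenspace (\<lambda>y. f (f y)) (a\<^sup>2)"
    by (simp add: endo_diff[OF f] endo_scale[OF f] algebra_simps power2_eq_square)
  then show ?case by (rule gen_eigenspace_shiftD)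
qed

text \<open>The coordinates of \<open>x\<close>, grouped by generalized eigenspaces, and \<open>- x\<close> form a vanishing sum of
  components, so that the groups of the other eigenvalues are zero.\<close>

lemma gen_eigenbasis_support:
  assumes B: "finite B" "independent B" "span B = UNIV" and f: "endo f"
    and ev: "\<And>b. b \<in> B \<Longrightarrow> b \<in> gen_eigenspace f (ev b)"
    and x: "x \<in> gen_eigenspace f a" and b: "b \<in> B" "representation B x b \<noteq> 0"
  shows "ev b = a"
proof (rule ccontr)
  assume ne: "ev b \<noteq> a"
  define y where "y c = (\<Sum>b | b \<in> B \<and> ev b = c. representation B x b *s b)" for c
  define z where "z c = y c - (if c = a then x else 0)" for c
  let ?A = "insert a (ev ` B)"
  have fin: "finite ?A" using B(1) by simp
  have sub: "subspace (gen_eigenspace f c)" for c by (rule subspace_gen_eigenspace[OF f])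
  have "y c \<in> gen_eigenspace f c" for c
    unfolding y_def using sub ev by (auto intro!: subspace_sum subspace_scale)
  then have zin: "z c \<in> gen_eigenspace f c" for c
    unfolding z_def using x sub subspace_0[OF sub] by (auto intro!: subspace_diff)
  have "(\<Sum>c\<in>?A. y c) = (\<Sum>b\<in>B. representation B x b *s b)"
    unfolding y_def using B(1) by (intro sum.group) auto
  also have "\<dots> = x" using representation_expand[OF B(1,2), of x] B(3) by simp
  finally have "(\<Sum>c\<in>?A. z c) = 0" using fin by (simp add: z_def sum_subtractf)
  then have "z (ev b) \<in> {0}"
    using zin fin b endo_0[OF f] by (intro gen_eigenspace_components[OF f, where W = "{0}" and A = ?A and x = z]) auto
  then have "y (ev b) = 0" using ne by (simp add: z_def)
  then have "representation B x b = 0"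
    unfolding y_def using B b
    by (intro independentD[OF B(2), of "{b' \<in> B. ev b' = ev b}" "representation B x" b]) auto
  then show False using b by simp
qed

text \<open>The semisimple part of an operator for which \<open>B\<close> is a basis of generalized eigenvectors with
  eigenvalues \<open>ev\<close>.\<close>

definition diag_part :: "'b set \<Rightarrow> ('b \<Rightarrow> 'a) \<Rightarrow> 'b \<Rightarrow> 'b" where
  "diag_part B ev x = (\<Sum>b\<in>B. (representation B x b * ev b) *s b)"

lemma endo_diag_part: "independent B \<Longrightarrow> span B = UNIV \<Longrightarrow> endo (diag_part B ev)"
  unfolding endo_iff diag_part_def
  by (simp add: representation_add representation_scale scale_sum_right algebra_simps sum.distrib)

lemma diag_part_gen_eigenspace:
  assumes B: "finite B" "independent B" "span B = UNIV" and f: "endo f"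
    and ev: "\<And>b. b \<in> B \<Longrightarrow> b \<in> gen_eigenspace f (ev b)" and x: "x \<in> gen_eigenspace f a"
  shows "diag_part B ev x = a *s x"
proof -
  have "diag_part B ev x = (\<Sum>b\<in>B. a *s (representation B x b *s b))"
    unfolding diag_part_def
    using gen_eigenbasis_support[OF B f ev x] by (intro sum.cong refl) (auto simp: mult.commute)
  also have "\<dots> = a *s x"
    unfolding scale_sum_right[symmetric] using representation_expand[OF B(1,2), of x] B(3) by simp
  finally show ?thesis .
qed

text \<open>The difference of \<open>f\<close> and its semisimple part is nilpotent and has trace zero.\<close>

lemma trace_on_gen_eigenbasis:
  assumes B: "finite B" "independent B" "span B = UNIV" and f: "endo f"
    and ev: "\<And>b. b \<in> B \<Longrightarrow> b \<in> gen_eigenspace f (ev b)"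
  shows "trace_on B f = (\<Sum>b\<in>B. ev b)"
proof -
  let ?s = "diag_part B ev"
  note s = endo_diag_part[OF B(2,3), of ev]
  define N where "N = (\<lambda>x. f x - ?s x)"
  have N: "endo N" unfolding N_def using f s by (auto simp: endo_iff algebra_simps)
  have Nx: "N x = shift_by f a x" if "x \<in> gen_eigenspace f a" for x a
    using diag_part_gen_eigenspace[OF B f ev that] by (simp add: N_def)
  have Nn: "(N ^^ n) x = (shift_by f a ^^ n) x \<and> (N ^^ n) x \<in> gen_eigenspace f a"
    if "x \<in> gen_eigenspace f a" for x a n
    using that by (induction n) (auto simp: Nx intro: gen_eigenspace_shiftI[OF f])
  have "trace_on B N = 0"
  proof (rule trace_on_nilpotent[OF B N])
    fix b assume "b \<in> B"
    then show "\<exists>n. (N ^^ n) b = 0"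
      using Nn[OF ev] ev[of b] unfolding gen_eigenspace_def by fastforce
  qed
  then have "trace_on B f = trace_on B ?s" unfolding N_def by (simp add: trace_on_diff[OF B(2,3)])
  also have "\<dots> = (\<Sum>b\<in>B. ev b)"
    using diag_part_gen_eigenspace[OF B f ev ev] B by (intro trace_on_diagonal) auto
  finally show ?thesis .
qed

text \<open>A form that is nondegenerate on a finite-dimensional space represents every functional: the
  injective map \<open>x \<mapsto> (F x b)\<^sub>b\<close> into the coordinate space is onto.\<close>

lemma nondegenerate_represents:
  assumes B: "finite B" "independent B"
    and F_add: "\<And>x y z. F (x + y) z = F x z + F y z" and F_scale: "\<And>c x z. F (c *s x) z = c * F x z"
    and nondeg: "\<And>x. x \<in> span B \<Longrightarrow> (\<And>b. b \<in> B \<Longrightarrow> F x b = 0) \<Longrightarrow> x = 0"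
  obtains x where "x \<in> span B" "\<And>b. b \<in> B \<Longrightarrow> F x b = \<phi> b"
proof -
  define g where "g x = (\<Sum>b\<in>B. F x b *s b)" for x
  have g: "endo g"
    by (simp add: endo_iff g_def F_add F_scale scale_left_distrib sum.distrib scale_sum_right)
  have coord: "F x b = u b" if "g x = (\<Sum>b\<in>B. u b *s b)" "b \<in> B" for x u b
  proof -
    have "(\<Sum>b\<in>B. (F x b - u b) *s b) = 0"
      using that(1) by (simp add: g_def scale_left_diff_distrib sum_subtractf)
    then have "F x b - u b = 0" using B that(2) by (intro independentD[OF B(2,1)]) auto
    then show ?thesis by simp
  qed
  interpret h: Vector_Spaces.linear scale scale g by (rule g)
  have inj: "inj_on g (span B)"
    unfolding h.inj_on_iff_eq_0[OF subspace_span]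
  proof (intro ballI impI)
    fix x assume "x \<in> span B" "g x = 0"
    then show "x = 0" using coord[of x "\<lambda>_. 0"] nondeg by simp
  qed
  have ind: "independent (g ` B)" using B(2) inj by (rule h.independent_injective_image)
  have card: "card (g ` B) = card B"
    using inj by (intro card_image inj_on_subset[OF inj]) (auto intro: span_base)
  have "g x \<in> span B" for x unfolding g_def by (intro span_sum span_scale span_base)
  have onto: "y \<in> span (g ` B)" if "y \<in> span B" for y
  proof (rule ccontr)
    assume "y \<notin> span (g ` B)"
    then have "independent (insert y (g ` B))" "y \<notin> g ` B"
      using independent_insertI[OF _ ind] by (auto intro: span_base)
    moreover have "insert y (g ` B) \<subseteq> span B" using that \<open>\<And>x. g x \<in> span B\<close> by blast
    ultimately have "card (insert y (g ` B)) \<le> card B"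
      using independent_span_bound[OF B(1)] by blast
    then show False using card \<open>y \<notin> g ` B\<close> B(1) by simp
  qed
  have "(\<Sum>b\<in>B. \<phi> b *s b) \<in> span B" by (intro span_sum span_scale span_base)
  from onto[OF this] have "(\<Sum>b\<in>B. \<phi> b *s b) \<in> g ` span B" by (simp add: h.span_image)
  then obtain x where "x \<in> span B" "g x = (\<Sum>b\<in>B. \<phi> b *s b)" by (metis imageE)
  then show thesis using coord that by blast
qed

end

section \<open>The Killing form\<close>

context lie_algebra
begin

sublocale linear_operators scale ..

lemma endo_bracket: "endo (bracket x)"
  by (rule bracket_linear_right)

lemma endo_bracket_left: "endo (\<lambda>x. bracket x y)"
  by (rule bracket_linear_left)

lemmas bracket_add_right = endo_add[OF endo_bracket]
  and bracket_scale_right = endo_scale[OF endo_bracket]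
  and bracket_zero_right = endo_0[OF endo_bracket]
  and bracket_minus_right = endo_minus[OF endo_bracket]
  and bracket_diff_right = endo_diff[OF endo_bracket]
  and bracket_add_left = endo_add[OF endo_bracket_left]
  and bracket_scale_left = endo_scale[OF endo_bracket_left]
  and bracket_zero_left = endo_0[OF endo_bracket_left]
  and bracket_diff_left = endo_diff[OF endo_bracket_left]

lemma bracket_skew: "bracket y x = - bracket x y"
proof -
  have "bracket (x + y) (x + y) = 0" by (rule bracket_alternating)
  moreover have "bracket (x + y) (x + y) = bracket x y + bracket y x"
    unfolding bracket_add_left bracket_add_right by (simp add: bracket_alternating)
  ultimately have "bracket x y + bracket y x = 0" by simp
  then show ?thesis by (simp add: add_eq_0_iff)
qed

lemma bracket_derivation: "bracket x (bracket y z) = bracket (bracket x y) z + bracket y (bracket x z)"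
proof -
  have "bracket y (bracket z x) = - bracket y (bracket x z)"
    by (subst bracket_skew) (simp add: bracket_minus_right)
  moreover have "bracket z (bracket x y) = - bracket (bracket x y) z" by (rule bracket_skew)
  ultimately show ?thesis using jacobi[of x y z] by (simp add: algebra_simps add_eq_0_iff)
qed

lemma bracket_bracket_left: "bracket (bracket x y) z = bracket x (bracket y z) - bracket y (bracket x z)"
  by (simp add: bracket_derivation[of x y z])

lemma basis_finite:
  assumes "independent B"
  shows "finite B"
proof -
  obtain A where "finite A" "span A = UNIV" using finite_dim by blast
  then show ?thesis using independent_span_bound[of A B] assms by simp
qed

lemma trace_eq_trace_on:
  assumes "independent B" "span B = UNIV" "endo f"
  shows "trace f = trace_on B f"
proof -
  have E: "independent (extend_basis {})" "span (extend_basis {}) = UNIV"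
    by (simp_all add: independent_extend_basis span_extend_basis independent_empty)
  have "trace_on (extend_basis {}) f = trace_on B f"
    using assms E by (intro trace_on_basis_change basis_finite) auto
  then show ?thesis unfolding trace_def trace_on_def .
qed

lemma
  assumes "endo f" "endo g"
  shows trace_comm: "trace (\<lambda>x. f (g x)) = trace (\<lambda>x. g (f x))"
    and trace_add: "trace (\<lambda>x. f x + g x) = trace f + trace g"
    and trace_diff: "trace (\<lambda>x. f x - g x) = trace f - trace g"
    and trace_scale: "trace (\<lambda>x. c *s f x) = c * trace f"
proof -
  let ?E = "extend_basis {}"
  have E: "independent ?E" "span ?E = UNIV"
    by (simp_all add: independent_extend_basis span_extend_basis independent_empty)
  have tr: "trace = trace_on ?E" unfolding trace_def trace_on_def ..
  show "trace (\<lambda>x. f (g x)) = trace (\<lambda>x. g (f x))"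
    unfolding tr using E assms by (intro trace_on_comm basis_finite) auto
  show "trace (\<lambda>x. f x + g x) = trace f + trace g" "trace (\<lambda>x. f x - g x) = trace f - trace g"
    "trace (\<lambda>x. c *s f x) = c * trace f"
    unfolding tr by (rule trace_on_add trace_on_diff trace_on_scale E)+
qed

lemma killing_sym: "killing x y = killing y x"
  unfolding killing_def by (rule trace_comm[OF endo_bracket endo_bracket])

lemma killing_add_left: "killing (x + y) z = killing x z + killing y z"
  unfolding killing_def bracket_add_left
  by (rule trace_add[OF endo_comp[OF endo_bracket endo_bracket] endo_comp[OF endo_bracket endo_bracket]])

lemma killing_scale_left: "killing (c *s x) z = c * killing x z"
  unfolding killing_def bracket_scale_left
  by (rule trace_scale[OF endo_comp[OF endo_bracket endo_bracket] endo_bracket])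

lemma killing_add_right: "killing z (x + y) = killing z x + killing z y"
  using killing_add_left[of x y z] by (simp add: killing_sym[of z])

lemma killing_scale_right: "killing z (c *s x) = c * killing z x"
  using killing_scale_left[of c x z] by (simp add: killing_sym[of z])

lemma killing_zero_left: "killing 0 z = 0"
  using killing_scale_left[of 0 0 z] by simp

lemma killing_minus_left: "killing (- x) z = - killing x z"
  using killing_scale_left[of "- 1" x z] by simp

lemma killing_diff_left: "killing (x - y) z = killing x z - killing y z"
  using killing_add_left[of x "- y" z] by (simp add: killing_minus_left)

lemma killing_invariant: "killing (bracket x y) z = killing x (bracket y z)"
proof -
  note c = endo_bracket endo_comp[OF endo_bracket endo_bracket]
    endo_comp[OF endo_bracket endo_comp[OF endo_bracket endo_bracket]]
  have "killing (bracket x y) z =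
      trace (\<lambda>w. bracket x (bracket y (bracket z w))) - trace (\<lambda>w. bracket y (bracket x (bracket z w)))"
    unfolding killing_def bracket_bracket_left by (rule trace_diff) (rule c)+
  also have "trace (\<lambda>w. bracket y (bracket x (bracket z w))) =
      trace (\<lambda>w. bracket x (bracket z (bracket y w)))"
    by (rule trace_comm[of "bracket y" "\<lambda>w. bracket x (bracket z w)"]) (rule c)+
  also have "trace (\<lambda>w. bracket x (bracket y (bracket z w))) - \<dots> = killing x (bracket y z)"
    unfolding killing_def bracket_bracket_left bracket_diff_right
    by (rule trace_diff[symmetric]) (rule c)+
  finally show ?thesis .
qed

text \<open>Since \<open>ad (D y)\<close> is the commutator of \<open>D\<close> and \<open>ad y\<close>, cyclicity of the trace turns
  \<open>tr (ad (D y) ad z)\<close> into \<open>tr (D ad [y, z])\<close>.\<close>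

lemma killing_derivation_eq_0:
  assumes D: "endo D" "\<And>x y. D (bracket x y) = bracket (D x) y + bracket x (D y)"
    and 0: "\<And>y. trace (\<lambda>z. D (bracket y z)) = 0"
  shows "killing (D y) z = 0"
proof -
  note bb = endo_comp[OF endo_bracket endo_bracket]
  note c = endo_bracket endo_comp[OF D(1) endo_bracket] endo_comp[OF D(1) bb]
    endo_comp[OF endo_bracket endo_comp[OF D(1) endo_bracket]]
  have "killing (D y) z = trace (\<lambda>w. D (bracket y (bracket z w)) - bracket y (D (bracket z w)))"
    unfolding killing_def by (simp add: D(2))
  also have "\<dots> = trace (\<lambda>w. D (bracket y (bracket z w))) - trace (\<lambda>w. bracket y (D (bracket z w)))"
    by (rule trace_diff) (rule c)+
  also have "trace (\<lambda>w. bracket y (D (bracket z w))) = trace (\<lambda>w. D (bracket z (bracket y w)))"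
    by (rule trace_comm[of "bracket y" "\<lambda>w. D (bracket z w)"]) (rule c)+
  also have "trace (\<lambda>w. D (bracket y (bracket z w))) - \<dots> = trace (\<lambda>w. D (bracket (bracket y z) w))"
    unfolding bracket_bracket_left endo_diff[OF D(1)]
    by (rule trace_diff[symmetric]) (rule c)+
  also have "\<dots> = 0" by (rule 0)
  finally show ?thesis .
qed

text \<open>A derivation \<open>D\<close> is inner when the Killing form is nondegenerate: subtract the \<open>ad x\<close> that
  represents the functional \<open>y \<mapsto> tr (D (ad y))\<close>.\<close>

lemma derivation_inner:
  assumes nondeg: "\<And>x. (\<And>y. killing x y = 0) \<Longrightarrow> x = 0"
    and D: "endo D" "\<And>x y. D (bracket x y) = bracket (D x) y + bracket x (D y)"
  obtains x where "\<And>y. D y = bracket x y"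
proof -
  let ?E = "extend_basis {}"
  let ?\<phi> = "\<lambda>y. trace (\<lambda>z. D (bracket y z))"
  have E: "independent ?E" "span ?E = UNIV" "finite ?E"
    by (simp_all add: independent_extend_basis span_extend_basis independent_empty basis_finite)
  note c = endo_comp[OF D(1) endo_bracket] endo_comp[OF endo_bracket endo_bracket]
  have \<phi>_add: "?\<phi> (x + y) = ?\<phi> x + ?\<phi> y" for x y
    unfolding bracket_add_left endo_add[OF D(1)] by (rule trace_add) (rule c)+
  have \<phi>_scale: "?\<phi> (a *s y) = a * ?\<phi> y" for a y
    unfolding bracket_scale_left endo_scale[OF D(1)] by (rule trace_scale) (rule c)+
  obtain x where x: "\<And>b. b \<in> ?E \<Longrightarrow> killing x b = ?\<phi> b"
  proof (rule nondegenerate_represents[OF E(3,1), of killing ?\<phi>])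
    show "x = 0" if *: "\<And>b. b \<in> ?E \<Longrightarrow> killing x b = 0" for x
    proof (rule nondeg)
      fix y
      have "y \<in> span ?E" using E by simp
      then show "killing x y = 0"
        by (induction rule: span_induct_alt)
          (simp_all add: * killing_add_right killing_scale_right killing_sym[of x 0] killing_zero_left)
    qed
  qed (auto simp: killing_add_left killing_scale_left)
  have x': "killing x y = ?\<phi> y" for y
  proof -
    have "y \<in> span ?E" using E by simp
    then show ?thesis
    proof (induction rule: span_induct_alt)
      case base
      show ?case using \<phi>_scale[of 0 0] by (simp add: killing_sym[of x 0] killing_zero_left)
    next
      case (step c b y)
      then show ?case by (simp only: \<phi>_add \<phi>_scale killing_add_right killing_scale_right x)
    qed
  qed
  define F where "F y = D y - bracket x y" for y
  have F: "endo F" unfolding F_def using D(1) endo_bracket[of x] by (auto simp: endo_iff algebra_simps)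
  have "killing (F y) z = 0" for y z
  proof (rule killing_derivation_eq_0[OF F])
    show "F (bracket u v) = bracket (F u) v + bracket u (F v)" for u v
      unfolding F_def D(2) bracket_derivation[of x u v] by (simp add: bracket_diff_left bracket_diff_right)
    show "trace (\<lambda>z. F (bracket y z)) = 0" for y
    proof -
      have "trace (\<lambda>z. F (bracket y z)) = ?\<phi> y - killing x y"
        unfolding F_def killing_def by (rule trace_diff) (rule c)+
      then show ?thesis using x' by simp
    qed
  qed
  then have "F y = 0" for y using nondeg by blast
  then show thesis using that unfolding F_def by simp
qed

text \<open>The derivation rule reads \<open>(ad t - (a + b)) [x, y] = [(ad t - a) x, y] + [x, (ad t - b) y]\<close>, which
  allows a double induction on the nilpotency orders.\<close>

lemma gen_eigenspace_bracket:
  assumes x: "x \<in> gen_eigenspace (bracket t) a" and y: "y \<in> gen_eigenspace (bracket t) b"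
  shows "bracket x y \<in> gen_eigenspace (bracket t) (a + b)"
proof -
  let ?U = "gen_eigenspace (bracket t) (a + b)"
  have sub: "subspace ?U" by (rule subspace_gen_eigenspace[OF endo_bracket])
  have "\<forall>y\<in>gen_eigenspace (bracket t) b. bracket x y \<in> ?U" using endo_bracket[of t] x
  proof (induction rule: gen_eigenspace_induct)
    case zero
    show ?case using sub by (simp add: bracket_zero_left subspace_0)
  next
    case (shift x)
    show ?case
    proof
      fix y assume "y \<in> gen_eigenspace (bracket t) b"
      with endo_bracket[of t] show "bracket x y \<in> ?U"
      proof (induction rule: gen_eigenspace_induct)
        case zero
        show ?case using sub by (simp add: bracket_zero_right subspace_0)
      next
        case (shift y)
        have "shift_by (bracket t) (a + b) (bracket x y) =
            bracket (shift_by (bracket t) a x) y + bracket x (shift_by (bracket t) b y)"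
          by (simp add: bracket_derivation[of t x y] bracket_diff_left bracket_diff_right
              bracket_scale_left bracket_scale_right algebra_simps)
        then have "shift_by (bracket t) (a + b) (bracket x y) \<in> ?U"
          using sub shift \<open>\<forall>y\<in>gen_eigenspace (bracket t) b. bracket (shift_by (bracket t) a x) y \<in> ?U\<close>
          by (simp add: subspace_add)
        then show ?case by (rule gen_eigenspace_shiftD)
      qed
    qed
  qed
  then show ?thesis using y by blast
qed

text \<open>The semisimple part of \<open>ad t\<close> is a derivation, because generalized eigenspaces multiply like
  eigenspaces.\<close>

lemma diag_part_derivation:
  assumes B: "independent B" "span B = UNIV"
    and ev: "\<And>b. b \<in> B \<Longrightarrow> b \<in> gen_eigenspace (bracket t) (ev b)"
  shows "diag_part B ev (bracket x y) = bracket (diag_part B ev x) y + bracket x (diag_part B ev y)"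
proof -
  let ?s = "diag_part B ev"
  note s = endo_diag_part[OF B, of ev]
  note fB = basis_finite[OF B(1)]
  note gen = diag_part_gen_eigenspace[OF fB B endo_bracket ev]
  have 1: "?s (bracket b c) = bracket (?s b) c + bracket b (?s c)" if "b \<in> B" "c \<in> B" for b c
    using gen[OF _ gen_eigenspace_bracket[OF ev ev], OF _ that] gen[OF _ ev] that
    by (simp add: bracket_scale_left bracket_scale_right scale_left_distrib)
  have 2: "?s (bracket b y) = bracket (?s b) y + bracket b (?s y)" if "b \<in> B" for b y
  proof (rule endo_eq_on_span[where B = B and x = y])
    show "endo (\<lambda>y. ?s (bracket b y))" by (rule endo_comp[OF s endo_bracket])
    show "endo (\<lambda>y. bracket (?s b) y + bracket b (?s y))"
      using endo_bracket[of "?s b"] endo_comp[OF endo_bracket[of b] s] by (simp add: endo_iff algebra_simps)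
  qed (use 1 that B in auto)
  show ?thesis
  proof (rule endo_eq_on_span[where B = B and x = x])
    show "endo (\<lambda>x. ?s (bracket x y))" by (rule endo_comp[OF s endo_bracket_left])
    show "endo (\<lambda>x. bracket (?s x) y + bracket x (?s y))"
      using endo_bracket_left[of "?s y"] endo_comp[OF endo_bracket_left[of y] s]
      by (simp add: endo_iff algebra_simps)
  qed (use 2 B in auto)
qed

end

section \<open>Weights of the Cartan subalgebra\<close>

lemma fun_scale_apply [simp]: "fun_scale c f x = c * f x"
  by (simp add: fun_scale_def)

lemma sum_fun_apply [simp]: "(\<Sum>a\<in>A. f a) x = (\<Sum>a\<in>A. f a x)"
  for f :: "'a \<Rightarrow> 'b \<Rightarrow> 'c::comm_monoid_add"
  by (induction A rule: infinite_finite_induct) auto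

context lie_algebra
begin

lemma dual_add: "\<mu> \<in> dual T \<Longrightarrow> x \<in> T \<Longrightarrow> y \<in> T \<Longrightarrow> \<mu> (x + y) = \<mu> x + \<mu> y"
  by (simp add: dual_def)

lemma dual_scale: "\<mu> \<in> dual T \<Longrightarrow> x \<in> T \<Longrightarrow> \<mu> (c *s x) = c * \<mu> x"
  by (simp add: dual_def)

lemma dual_outside: "\<mu> \<in> dual T \<Longrightarrow> x \<notin> T \<Longrightarrow> \<mu> x = 0"
  by (simp add: dual_def)

lemma dual_zero: "subspace T \<Longrightarrow> \<mu> \<in> dual T \<Longrightarrow> \<mu> 0 = 0"
  using dual_scale[of \<mu> T 0 0] by (simp add: subspace_0)

lemma dual_diff:
  assumes "subspace T" "\<mu> \<in> dual T" "x \<in> T" "y \<in> T"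
  shows "\<mu> (x - y) = \<mu> x - \<mu> y"
  using dual_add[OF assms(2,3), of "(-1) *s y"] dual_scale[OF assms(2,4), of "-1"] assms
  by (simp add: subspace_neg)

lemma dual_sum:
  assumes T: "subspace T" and \<mu>: "\<mu> \<in> dual T" and "\<And>a. a \<in> A \<Longrightarrow> f a \<in> T"
  shows "\<mu> (\<Sum>a\<in>A. f a) = (\<Sum>a\<in>A. \<mu> (f a))"
  using assms(3)
proof (induction A rule: infinite_finite_induct)
  case (insert a A)
  then have "f a \<in> T" "sum f A \<in> T" using subspace_sum[OF T] by blast+
  then have "\<mu> (f a + sum f A) = \<mu> (f a) + \<mu> (sum f A)" by (rule dual_add[OF \<mu>])
  then show ?case using insert by simp
qed (simp_all add: dual_zero[OF T \<mu>])

lemma dual_eqI: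
  assumes "\<mu> \<in> dual T" "\<nu> \<in> dual T" "\<And>t. t \<in> T \<Longrightarrow> \<mu> t = \<nu> t"
  shows "\<mu> = \<nu>"
proof
  show "\<mu> x = \<nu> x" for x
    using assms(3) dual_outside[OF assms(1)] dual_outside[OF assms(2)] by (cases "x \<in> T") auto
qed

lemma subspace_dual: "weights.subspace (dual T)"
  by (rule weights.subspaceI) (auto simp: dual_def algebra_simps)

lemmas zero_in_dual = weights.subspace_0[OF subspace_dual]
  and add_in_dual = weights.subspace_add[OF subspace_dual]
  and diff_in_dual = weights.subspace_diff[OF subspace_dual]
  and scale_in_dual = weights.subspace_scale[OF subspace_dual]
  and minus_in_dual = weights.subspace_neg[OF subspace_dual]
  and sum_in_dual = weights.subspace_sum[OF subspace_dual]

text \<open>Cut off outside of \<open>T\<close> like all elements of \<open>dual T\<close>.\<close>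

definition coordinate_form :: "'g set \<Rightarrow> 'g set \<Rightarrow> 'g \<Rightarrow> 'g \<Rightarrow> 'k" where
  "coordinate_form T B b x = (if x \<in> T then representation B x b else 0)"

lemma coordinate_form_in_dual:
  assumes "independent B" "span B = T"
  shows "coordinate_form T B b \<in> dual T"
proof -
  have T: "subspace T" using assms(2) by auto
  then show ?thesis
    using assms
    by (simp add: dual_def coordinate_form_def representation_add representation_scale
        subspace_add subspace_scale)
qed

lemma coordinate_form_expand:
  assumes B: "independent B" "span B = T" and \<mu>: "\<mu> \<in> dual T"
  shows "\<mu> = (\<Sum>b\<in>B. fun_scale (\<mu> b) (coordinate_form T B b))"
proof (rule dual_eqI[OF \<mu>])
  show "(\<Sum>b\<in>B. fun_scale (\<mu> b) (coordinate_form T B b)) \<in> dual T"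
    by (intro sum_in_dual scale_in_dual coordinate_form_in_dual B)
  have T: "subspace T" using B by auto
  fix t assume t: "t \<in> T"
  have "\<mu> t = \<mu> (\<Sum>b\<in>B. representation B t b *s b)"
    using representation_expand[OF basis_finite[OF B(1)] B(1), of t] t B by simp
  also have "\<dots> = (\<Sum>b\<in>B. \<mu> (representation B t b *s b))"
    by (rule dual_sum[OF T \<mu>]) (use B in \<open>auto intro: span_scale span_base\<close>)
  also have "\<dots> = (\<Sum>b\<in>B. fun_scale (\<mu> b) (coordinate_form T B b)) t"
    using B t \<mu> by (auto simp: coordinate_form_def dual_scale span_base intro!: sum.cong)
  finally show "\<mu> t = (\<Sum>b\<in>B. fun_scale (\<mu> b) (coordinate_form T B b)) t" .
qed

end

context based_simple_lie_algebra
begin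

lemma field_closed: "degree p > 0 \<Longrightarrow> \<exists>x. poly p x = 0" for p :: "'k poly"
  by (rule alg_closed_imp_poly_has_root)

lemma subspace_T: "subspace T"
  and bracket_in_T: "\<And>x y. x \<in> T \<Longrightarrow> y \<in> T \<Longrightarrow> bracket x y \<in> T"
  and normalizer_T: "normalizer T = T"
  using cartan by (auto simp: cartan_subalgebra_def nilpotent_subalgebra_def subalgebra_def)

lemma finite_P: "finite P"
  and P_roots: "P \<subseteq> roots T"
  and independent_P: "weights.independent P"
  and span_P: "weights.span P = dual T"
  using base by (auto simp: root_base_def)

lemma root_in_dual: "\<gamma> \<in> roots T \<Longrightarrow> \<gamma> \<in> dual T"
  by (simp add: roots_def)

lemma P_in_dual: "\<beta> \<in> P \<Longrightarrow> \<beta> \<in> dual T"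
  using P_roots root_in_dual by blast

lemma basis_T:
  obtains B where "independent B" "span B = T" "finite B"
proof -
  obtain B where "B \<subseteq> T" "independent B" "T \<subseteq> span B"
    using maximal_independent_subset[of T] by metis
  then show thesis using that[of B] subspace_T by (simp add: basis_finite span_subspace)
qed

text \<open>The dual of \<open>T\<close> separates points, and the simple roots span it.\<close>

lemma simple_roots_separate:
  assumes t: "t \<in> T" and 0: "\<And>\<beta>. \<beta> \<in> P \<Longrightarrow> \<beta> t = 0"
  shows "t = 0"
proof -
  obtain B where B: "independent B" "span B = T" "finite B" by (rule basis_T)
  have vanish: "\<mu> t = 0" if "\<mu> \<in> weights.span P" for \<mu>
    using that by (induction rule: weights.span_induct_alt) (auto simp: 0)
  have "representation B t b = 0" for b
    using vanish[of "coordinate_form T B b"] coordinate_form_in_dual[OF B(1,2)] span_P t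
    by (simp add: coordinate_form_def)
  then show ?thesis using representation_expand[OF B(3,1), of t] t B by simp
qed

text \<open>Without simple roots \<open>T\<close> would be zero, and the normalizer of \<open>{0}\<close> is everything.\<close>

lemma P_nonempty: "P \<noteq> {}"
proof
  assume "P = {}"
  then have "T = {0}" using simple_roots_separate subspace_0[OF subspace_T] by blast
  then have "T = UNIV" using normalizer_T by (simp add: normalizer_def bracket_zero_right)
  then show False using \<open>T = {0}\<close> not_abelian by (metis UNIV_I singletonD)
qed

lemma roots_separate:
  assumes "t \<in> T" "\<And>\<beta>. \<beta> \<in> roots T \<Longrightarrow> \<beta> t = 0"
  shows "t = 0"
  by (rule simple_roots_separate[OF assms(1)]) (use assms(2) P_roots in blast)

text \<open>The simple roots form a basis of the dual of \<open>T\<close>, so \<open>c\<close> extends to a functional on this dual.  Like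
  every such functional it is the evaluation at a point of \<open>T\<close>.\<close>

lemma simple_root_values:
  obtains t where "t \<in> T" "\<And>\<beta>. \<beta> \<in> P \<Longrightarrow> \<beta> t = c \<beta>"
proof -
  obtain B where B: "independent B" "span B = T" "finite B" by (rule basis_T)
  define F where "F \<mu> = (\<Sum>\<beta>\<in>P. weights.representation P \<mu> \<beta> * c \<beta>)" for \<mu>
  define t where "t = (\<Sum>b\<in>B. F (coordinate_form T B b) *s b)"
  have Bd: "coordinate_form T B b \<in> dual T" for b by (rule coordinate_form_in_dual[OF B(1,2)])
  have BT: "b \<in> T" if "b \<in> B" for b using B that by (auto intro: span_base)
  have "\<beta> t = c \<beta>" if \<beta>: "\<beta> \<in> P" for \<beta>
  proof -
    note d = P_in_dual[OF \<beta>]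
    have "\<beta> t = (\<Sum>b\<in>B. \<beta> (F (coordinate_form T B b) *s b))"
      unfolding t_def by (intro dual_sum[OF subspace_T d] subspace_scale[OF subspace_T] BT)
    also have "\<dots> = (\<Sum>b\<in>B. \<beta> b * F (coordinate_form T B b))"
      using BT by (intro sum.cong refl) (simp add: dual_scale[OF d] mult.commute)
    also have "\<dots> = F (\<Sum>b\<in>B. fun_scale (\<beta> b) (coordinate_form T B b))"
    proof -
      have "weights.representation P (\<Sum>b\<in>B. fun_scale (\<beta> b) (coordinate_form T B b)) \<delta> =
          (\<Sum>b\<in>B. \<beta> b * weights.representation P (coordinate_form T B b) \<delta>)" for \<delta>
        using Bd independent_P span_P
        by (simp add: weights.representation_sum weights.representation_scale scale_in_dual)
      then show ?thesis unfolding F_def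
        by (simp add: sum_distrib_left sum_distrib_right mult.assoc) (rule sum.swap)
    qed
    also have "\<dots> = F \<beta>" using coordinate_form_expand[OF B(1,2) d] by simp
    also have "\<dots> = (\<Sum>\<beta>'\<in>P. if \<beta>' = \<beta> then c \<beta> else 0)"
      unfolding F_def using \<beta> independent_P
      by (intro sum.cong refl) (simp add: weights.representation_basis)
    also have "\<dots> = c \<beta>" using finite_P \<beta> by simp
    finally show ?thesis .
  qed
  moreover have "t \<in> T" unfolding t_def using BT subspace_T by (auto intro: subspace_sum subspace_scale)
  ultimately show thesis using that by blast
qed

text \<open>Roots vanish on brackets of elements of \<open>T\<close>, so a spanning set of roots leaves no room for
  nonzero brackets.\<close>

lemma T_abelian:
  assumes "s \<in> T" "t \<in> T"
  shows "bracket s t = 0"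
proof (rule roots_separate)
  show "bracket s t \<in> T" using assms by (rule bracket_in_T)
  fix \<beta> assume "\<beta> \<in> roots T"
  then obtain x where x: "x \<noteq> 0" "\<forall>t\<in>T. bracket t x = \<beta> t *s x" by (auto simp: roots_def)
  have "\<beta> (bracket s t) *s x = bracket (bracket s t) x"
    using x(2) assms by (simp add: bracket_in_T)
  also have "\<dots> = 0"
    using x(2) assms by (simp add: bracket_bracket_left bracket_scale_right mult.commute)
  finally show "\<beta> (bracket s t) = 0" using x(1) by simp
qed

lemma T_commute: "s \<in> T \<Longrightarrow> t \<in> T \<Longrightarrow> bracket s (bracket t x) = bracket t (bracket s x)"
  by (simp add: bracket_derivation[of s t x] T_abelian bracket_zero_left)

lemma centralizer_T:
  assumes "\<And>t. t \<in> T \<Longrightarrow> bracket t x = 0"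
  shows "x \<in> T"
proof -
  have "bracket x t = 0" if "t \<in> T" for t using assms[OF that] bracket_skew[of t x] by simp
  then have "x \<in> normalizer T" using subspace_T by (simp add: normalizer_def subspace_0)
  then show ?thesis by (simp add: normalizer_T)
qed

definition weight_space :: "('g \<Rightarrow> 'k) \<Rightarrow> 'g set" where
  "weight_space \<gamma> = {x. \<forall>t\<in>T. bracket t x = \<gamma> t *s x}"

lemma weight_spaceD: "x \<in> weight_space \<gamma> \<Longrightarrow> t \<in> T \<Longrightarrow> bracket t x = \<gamma> t *s x"
  by (simp add: weight_space_def)

lemma subspace_weight_space: "subspace (weight_space \<gamma>)"
  by (rule subspaceI)
    (auto simp: weight_space_def bracket_zero_right bracket_add_right bracket_scale_right
      scale_right_distrib mult.commute)

lemma weight_space_0: "weight_space 0 = T"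
proof
  show "weight_space 0 \<subseteq> T" using centralizer_T by (auto simp: weight_space_def)
  show "T \<subseteq> weight_space 0" using T_abelian by (auto simp: weight_space_def)
qed

lemma root_iff: "\<gamma> \<in> roots T \<longleftrightarrow> \<gamma> \<in> dual T \<and> \<gamma> \<noteq> 0 \<and> (\<exists>x. x \<noteq> 0 \<and> x \<in> weight_space \<gamma>)"
  by (auto simp: roots_def weight_space_def)

lemma weight_in_dual:
  assumes x: "x \<noteq> 0" and c: "\<And>t. t \<in> T \<Longrightarrow> bracket t x = c t *s x"
  obtains \<gamma> where "\<gamma> \<in> dual T" "x \<in> weight_space \<gamma>" "\<And>t. t \<in> T \<Longrightarrow> \<gamma> t = c t"
proof
  define \<gamma> where "\<gamma> t = (if t \<in> T then c t else 0)" for t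
  show "x \<in> weight_space \<gamma>" by (simp add: weight_space_def \<gamma>_def c)
  show "\<gamma> t = c t" if "t \<in> T" for t using that by (simp add: \<gamma>_def)
  have "c (s + t) = c s + c t" if "s \<in> T" "t \<in> T" for s t
  proof -
    have "c (s + t) *s x = (c s + c t) *s x"
      using that c[of "s + t"] c[of s] c[of t] subspace_add[OF subspace_T]
      by (simp add: bracket_add_left scale_left_distrib)
    then show ?thesis using x by simp
  qed
  moreover have "c (a *s t) = a * c t" if "t \<in> T" for a t
  proof -
    have "c (a *s t) *s x = bracket (a *s t) x"
      using that c subspace_scale[OF subspace_T] by simp
    also have "\<dots> = (a * c t) *s x" using that c by (simp only: bracket_scale_left scale_scale)
    finally have "c (a *s t) *s x = (a * c t) *s x" .
    then show ?thesis using x by simp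
  qed
  ultimately show "\<gamma> \<in> dual T"
    using subspace_T by (auto simp: dual_def \<gamma>_def subspace_add subspace_scale)
qed

lemma basis_exists_UNIV:
  obtains B where "independent B" "span B = UNIV" "finite B"
  using that[of "extend_basis {}"]
  by (simp add: independent_extend_basis span_extend_basis independent_empty basis_finite)

text \<open>A nonzero invariant subspace of least dimension consists of common eigenvectors: each \<open>ad t\<close>
  has an eigenvalue on it, and the eigenspace is again invariant.\<close>

lemma common_eigenvector:
  assumes W: "subspace W" "\<And>t w. t \<in> T \<Longrightarrow> w \<in> W \<Longrightarrow> bracket t w \<in> W" and w: "w \<in> W" "w \<noteq> 0"
  obtains x \<gamma> where "x \<in> W" "x \<noteq> 0" "\<gamma> \<in> dual T" "x \<in> weight_space \<gamma>"
proof -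
  obtain B where B: "independent B" "span B = UNIV" "finite B" by (rule basis_exists_UNIV)
  interpret fd: finite_dimensional_vector_space scale B by unfold_locales (use B in auto)
  let ?inv = "\<lambda>V. subspace V \<and> V \<subseteq> W \<and> V \<noteq> {0} \<and> (\<forall>t\<in>T. \<forall>w\<in>V. bracket t w \<in> V)"
  have "?inv W" using W w by auto
  then obtain V where V: "?inv V" and least: "\<And>V'. ?inv V' \<Longrightarrow> dim V \<le> dim V'"
    using ex_has_least_nat[of ?inv W dim] by blast
  have "\<exists>c. \<forall>x\<in>V. bracket t x = c *s x" if t: "t \<in> T" for t
  proof -
    obtain v where v: "v \<in> V" "v \<noteq> 0" using V subspace_0 by blast
    obtain a x where ax: "x \<in> V" "x \<noteq> 0" "bracket t x = a *s x"
      using exists_eigenvector_in_subspace[OF field_closed B(3,2) endo_bracket, of V t v] V v t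
      by metis
    define V' where "V' = {x \<in> V. bracket t x = a *s x}"
    have "?inv V'"
    proof (intro conjI ballI)
      show "subspace V'"
        unfolding V'_def using V
        by (intro subspaceI) (auto simp: subspace_0 subspace_add subspace_scale bracket_zero_right
            bracket_add_right bracket_scale_right scale_right_distrib mult.commute)
      show "V' \<subseteq> W" using V by (auto simp: V'_def)
      show "V' \<noteq> {0}" using ax by (auto simp: V'_def)
      show "bracket s w \<in> V'" if "s \<in> T" "w \<in> V'" for s w
        using that V t T_commute[of t s w] by (auto simp: V'_def bracket_scale_right)
    qed
    then have "dim V \<le> dim V'" by (rule least)
    then have "V' = V"
      using V \<open>?inv V'\<close> by (intro fd.subspace_dim_equal) (auto simp: V'_def)
    then show ?thesis by (auto simp: V'_def)
  qed
  then obtain c where c: "\<And>t x. t \<in> T \<Longrightarrow> x \<in> V \<Longrightarrow> bracket t x = c t *s x" by metis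
  obtain x where x: "x \<in> V" "x \<noteq> 0" using V subspace_0 by blast
  obtain \<gamma> where "\<gamma> \<in> dual T" "x \<in> weight_space \<gamma>"
    using weight_in_dual[OF x(2), of c] c x(1) by metis
  then show thesis using that x V by blast
qed

text \<open>The generalized eigenspace is invariant under \<open>T\<close>, so it contains a common eigenvector.\<close>

lemma gen_eigenvalue_weight:
  assumes t: "t \<in> T" and x: "x \<in> gen_eigenspace (bracket t) a" "x \<noteq> 0"
  obtains \<gamma> where "\<gamma> = 0 \<or> \<gamma> \<in> roots T" "\<gamma> t = a"
proof -
  obtain y \<gamma> where y: "y \<in> gen_eigenspace (bracket t) a" "y \<noteq> 0" "\<gamma> \<in> dual T" "y \<in> weight_space \<gamma>"
  proof (rule common_eigenvector[OF subspace_gen_eigenspace[OF endo_bracket] _ x])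
    show "bracket s w \<in> gen_eigenspace (bracket t) a"
      if "s \<in> T" "w \<in> gen_eigenspace (bracket t) a" for s w
      by (rule gen_eigenspace_commuting[OF endo_bracket endo_bracket T_commute[OF t that(1)] that(2)])
  qed
  have "(shift_by (bracket t) a ^^ n) y = (\<gamma> t - a) ^ n *s y" for n
    using weight_spaceD[OF y(4) t]
    by (induction n) (simp_all add: bracket_scale_right algebra_simps)
  moreover obtain n where "(shift_by (bracket t) a ^^ n) y = 0"
    using y(1) by (auto simp: gen_eigenspace_def)
  ultimately have "\<gamma> t = a" using y(2) by (simp add: scale_eq_0_iff)
  moreover have "\<gamma> = 0 \<or> \<gamma> \<in> roots T" using y by (auto simp: root_iff)
  ultimately show thesis using that by blast
qed

lemma root_coefficients:
  assumes "\<gamma> \<in> roots T"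
  obtains n :: "('g \<Rightarrow> 'k) \<Rightarrow> nat" and s :: int
  where "s = 1 \<or> s = -1" "\<gamma> = (\<Sum>\<beta>\<in>P. fun_scale (of_int (s * int (n \<beta>))) \<beta>)"
proof -
  obtain n :: "('g \<Rightarrow> 'k) \<Rightarrow> nat" where "\<gamma> = (\<Sum>\<beta>\<in>P. fun_scale (of_nat (n \<beta>)) \<beta>) \<or>
      \<gamma> = - (\<Sum>\<beta>\<in>P. fun_scale (of_nat (n \<beta>)) \<beta>)"
    using base assms unfolding root_base_def by blast
  then show thesis
  proof
    assume "\<gamma> = (\<Sum>\<beta>\<in>P. fun_scale (of_nat (n \<beta>)) \<beta>)"
    then show thesis by (intro that[of 1 n]) simp_all
  next
    assume "\<gamma> = - (\<Sum>\<beta>\<in>P. fun_scale (of_nat (n \<beta>)) \<beta>)"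
    then have "\<gamma> = (\<Sum>\<beta>\<in>P. fun_scale (of_int (-1 * int (n \<beta>))) \<beta>)"
      by (auto simp: fun_eq_iff sum_negf)
    then show thesis by (intro that[of "-1" n]) simp_all
  qed
qed

end

section \<open>Nondegeneracy and diagonalizability\<close>

context based_simple_lie_algebra
begin

text \<open>Let \<open>t \<in> T\<close> take the value \<open>1\<close> on every simple root.  All eigenvalues of \<open>ad t\<close> are then
  integers, and not all are zero, so the trace of \<open>(ad t)\<^sup>2\<close> is a positive integer.\<close>

lemma killing_nonzero:
  assumes "\<alpha> \<in> P"
  obtains t where "killing t t \<noteq> 0"
proof -
  obtain t where t: "t \<in> T" "\<And>\<beta>. \<beta> \<in> P \<Longrightarrow> \<beta> t = 1"
    using simple_root_values[of "\<lambda>_. 1"] by metis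
  have int: "\<exists>m. \<gamma> t = of_int m" if "\<gamma> = 0 \<or> \<gamma> \<in> roots T" for \<gamma>
  proof (cases "\<gamma> = 0")
    case True
    then show ?thesis by (intro exI[of _ 0]) simp
  next
    case False
    then have "\<gamma> \<in> roots T" using that by blast
    then obtain n s where "s = 1 \<or> s = -1" "\<gamma> = (\<Sum>\<beta>\<in>P. fun_scale (of_int (s * int (n \<beta>))) \<beta>)"
      by (rule root_coefficients)
    then have "\<gamma> t = of_int (\<Sum>\<beta>\<in>P. s * int (n \<beta>))"
      using t(2) by (auto intro!: sum.cong)
    then show ?thesis by blast
  qed
  obtain A where A: "finite A" "span A = UNIV" using finite_dim by blast
  obtain B ev where B: "independent B" "span B = UNIV"
    and "\<forall>b\<in>B. b \<in> gen_eigenspace (bracket t) (ev b)"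
    by (rule exists_gen_eigenbasis[OF field_closed A endo_bracket[of t]])
  then have ev: "\<And>b. b \<in> B \<Longrightarrow> b \<in> gen_eigenspace (bracket t) (ev b)" by blast
  have "\<exists>m. ev b = of_int m" if "b \<in> B" for b
  proof -
    have "b \<noteq> 0" using that B(1) dependent_zero by blast
    then show ?thesis using gen_eigenvalue_weight[OF t(1) ev[OF that]] int by metis
  qed
  then obtain m where m: "\<And>b. b \<in> B \<Longrightarrow> ev b = of_int (m b)" by metis
  have fB: "finite B" by (rule basis_finite[OF B(1)])
  have "killing t t = trace_on B (\<lambda>z. bracket t (bracket t z))"
    unfolding killing_def by (rule trace_eq_trace_on[OF B endo_comp[OF endo_bracket endo_bracket]])
  also have "\<dots> = (\<Sum>b\<in>B. (ev b)\<^sup>2)"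
    by (rule trace_on_gen_eigenbasis[OF fB B endo_comp[OF endo_bracket endo_bracket]])
      (rule gen_eigenspace_square[OF endo_bracket ev])
  also have "\<dots> = of_int (\<Sum>b\<in>B. (m b)\<^sup>2)" by (simp add: m)
  finally have tr: "killing t t = of_int (\<Sum>b\<in>B. (m b)\<^sup>2)" .
  obtain x where x: "x \<noteq> 0" "x \<in> weight_space \<alpha>" using P_roots assms root_iff[of \<alpha>] by blast
  then have "x \<in> gen_eigenspace (bracket t) 1"
    using weight_spaceD[OF x(2) t(1)] t(2)[OF assms] by (intro eigenvector_in_gen_eigenspace) simp
  moreover have "\<exists>b\<in>B. representation B x b \<noteq> 0"
    by (rule ccontr) (use representation_expand[OF fB B(1), of x] B(2) x(1) in simp)
  ultimately obtain b where b: "b \<in> B" "ev b = 1"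
    using gen_eigenbasis_support[OF fB B endo_bracket ev] by metis
  then have "m b = 1" using m[of b] by (metis of_int_1 of_int_eq_iff)
  then have "(\<Sum>b\<in>B. (m b)\<^sup>2) > 0" using fB b by (intro sum_pos2[of B b]) auto
  then have "killing t t \<noteq> 0" unfolding tr by (metis less_irrefl of_int_eq_0_iff)
  then show thesis by (rule that)
qed

lemma killing_nondegenerate:
  assumes "\<And>y. killing x y = 0"
  shows "x = 0"
proof -
  let ?R = "{x. \<forall>y. killing x y = 0}"
  have "ideal ?R"
    unfolding ideal_def
  proof (intro conjI allI ballI)
    show "subspace ?R"
      by (rule subspaceI) (auto simp: killing_zero_left killing_add_left killing_scale_left)
    show "bracket z x \<in> ?R" if "x \<in> ?R" for z x
    proof -
      have "bracket z x = - bracket x z" by (rule bracket_skew)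
      then show ?thesis using that by (simp add: killing_minus_left killing_invariant)
    qed
  qed
  moreover obtain \<alpha> where "\<alpha> \<in> P" using P_nonempty by blast
  then obtain t where "killing t t \<noteq> 0" by (rule killing_nonzero)
  then have "?R \<noteq> UNIV" by blast
  ultimately have "?R = {0}" using ideal_trivial by blast
  then show ?thesis using assms by blast
qed

text \<open>The semisimple part of \<open>ad t\<close> is an inner derivation \<open>ad x\<close>.  It kills \<open>T\<close>, so \<open>x \<in> T\<close>, and
  all roots agree on \<open>x\<close> and \<open>t\<close>, so \<open>x = t\<close>.\<close>

lemma gen_eigenspace_eigenvector:
  assumes t: "t \<in> T" and y: "y \<in> gen_eigenspace (bracket t) a"
  shows "bracket t y = a *s y"
proof -
  obtain A where A: "finite A" "span A = UNIV" using finite_dim by blast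
  obtain B ev where B: "independent B" "span B = UNIV"
    and "\<forall>b\<in>B. b \<in> gen_eigenspace (bracket t) (ev b)"
    by (rule exists_gen_eigenbasis[OF field_closed A endo_bracket[of t]])
  then have ev: "\<And>b. b \<in> B \<Longrightarrow> b \<in> gen_eigenspace (bracket t) (ev b)" by blast
  note gen = diag_part_gen_eigenspace[OF basis_finite[OF B(1)] B endo_bracket ev]
  obtain x where x: "\<And>y. diag_part B ev y = bracket x y"
    by (rule derivation_inner[OF killing_nondegenerate endo_diag_part[OF B]
        diag_part_derivation[OF B ev]]) blast+
  have "bracket u x = 0" if "u \<in> T" for u
  proof -
    have "u \<in> gen_eigenspace (bracket t) 0"
      by (rule eigenvector_in_gen_eigenspace) (simp add: T_abelian t that)
    then have "bracket x u = 0" using gen x by simp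
    then show ?thesis using bracket_skew[of u x] by simp
  qed
  then have xT: "x \<in> T" by (rule centralizer_T)
  have "x - t = 0"
  proof (rule roots_separate)
    show "x - t \<in> T" using xT t subspace_T by (simp add: subspace_diff)
    fix \<beta> assume \<beta>: "\<beta> \<in> roots T"
    then obtain z where z: "z \<noteq> 0" "z \<in> weight_space \<beta>" by (auto simp: root_iff)
    have "z \<in> gen_eigenspace (bracket t) (\<beta> t)"
      using weight_spaceD[OF z(2) t] by (rule eigenvector_in_gen_eigenspace)
    then have "bracket x z = \<beta> t *s z" using gen x by simp
    then have "\<beta> x *s z = \<beta> t *s z" using weight_spaceD[OF z(2) xT] by simp
    then show "\<beta> (x - t) = 0"
      using z(1) dual_diff[OF subspace_T root_in_dual[OF \<beta>] xT t] by simp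
  qed
  then have "x = t" by simp
  then show ?thesis using gen[OF _ y] x by simp
qed

text \<open>Induction on \<open>F\<close>: when a joint eigenvector of \<open>F\<close> is decomposed under one more \<open>ad t\<close>, the components
  stay in its joint eigenspace.\<close>

lemma span_joint_eigenvectors:
  assumes "finite F" "F \<subseteq> T"
  shows "span {x. \<exists>c. \<forall>t\<in>F. bracket t x = c t *s x} = UNIV"
  using assms
proof (induction F rule: finite_induct)
  case empty
  then show ?case by simp
next
  case (insert t F)
  let ?E = "\<lambda>F. {x. \<exists>c. \<forall>t\<in>F. bracket t x = c t *s x}"
  obtain A where A: "finite A" "span A = UNIV" using finite_dim by blast
  have t: "t \<in> T" using insert.prems by blast
  have "x \<in> span (?E (insert t F))" if x: "x \<in> ?E F" for x
  proof -
    obtain c where c: "\<And>s. s \<in> F \<Longrightarrow> bracket s x = c s *s x" using x by blast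
    let ?W = "{y. \<forall>s\<in>F. bracket s y = c s *s y}"
    have W: "subspace ?W"
      by (rule subspaceI) (auto simp: bracket_zero_right bracket_add_right bracket_scale_right
          scale_right_distrib mult.commute)
    have Wt: "bracket t w \<in> ?W" if "w \<in> ?W" for w
      using that insert.prems T_commute[OF _ t] by (auto simp: bracket_scale_right)
    have "x \<in> span (\<Union>a. gen_eigenspace (bracket t) a)"
      using span_gen_eigenspaces[OF field_closed A endo_bracket] by blast
    then obtain A y where y: "finite A" "\<And>a. y a \<in> gen_eigenspace (bracket t) a" "x = (\<Sum>a\<in>A. y a)"
      by (rule gen_eigenspace_decomposition[OF endo_bracket]) blast
    have "y a \<in> ?W" if "a \<in> A" for a
      using gen_eigenspace_components[OF endo_bracket W Wt y(1) y(2) _ that] y(3) c by blast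
    then have "y a \<in> ?E (insert t F)" if "a \<in> A" for a
      using gen_eigenspace_eigenvector[OF t y(2)] that insert.hyps(2)
      by (auto intro!: exI[of _ "\<lambda>s. if s = t then a else c s"])
    then show ?thesis unfolding y(3) by (intro span_sum span_base)
  qed
  then have "?E F \<subseteq> span (?E (insert t F))" by blast
  then show ?case using insert.IH insert.prems span_minimal[OF _ subspace_span] by blast
qed

lemma span_weight_spaces:
  "span (\<Union>\<gamma>\<in>dual T. weight_space \<gamma>) = UNIV"
proof -
  obtain F where F: "independent F" "span F = T" "finite F" by (rule basis_T)
  have FT: "F \<subseteq> T" using F by (auto intro: span_base)
  have "x \<in> span (\<Union>\<gamma>\<in>dual T. weight_space \<gamma>)" if c: "\<forall>t\<in>F. bracket t x = c t *s x" for x c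
  proof (cases "x = 0")
    case False
    have "\<exists>a. bracket t x = a *s x" if "t \<in> T" for t
      using that[folded F(2)]
    proof (induction rule: span_induct_alt)
      case base
      show ?case by (intro exI[of _ 0]) (simp add: bracket_zero_left)
    next
      case (step a s t)
      then obtain b where "bracket t x = b *s x" by blast
      then have "bracket (a *s s + t) x = (a * c s + b) *s x"
        using c step(1) by (simp add: bracket_add_left bracket_scale_left scale_left_distrib)
      then show ?case by blast
    qed
    then obtain a where "\<And>t. t \<in> T \<Longrightarrow> bracket t x = a t *s x" by metis
    then obtain \<gamma> where "\<gamma> \<in> dual T" "x \<in> weight_space \<gamma>"
      using weight_in_dual[OF False] by metis
    then show ?thesis by (intro span_base) blast
  qed (simp add: span_zero)
  then have "{x. \<exists>c. \<forall>t\<in>F. bracket t x = c t *s x} \<subseteq> span (\<Union>\<gamma>\<in>dual T. weight_space \<gamma>)" by blast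
  then show ?thesis
    using span_joint_eigenvectors[OF F(3) FT] span_minimal[OF _ subspace_span] by blast
qed

end

section \<open>Root spaces\<close>

context based_simple_lie_algebra
begin

definition weight_basis :: "'g set \<Rightarrow> ('g \<Rightarrow> 'g \<Rightarrow> 'k) \<Rightarrow> bool" where
  "weight_basis B wt \<longleftrightarrow> independent B \<and> span B = UNIV \<and>
     (\<forall>b\<in>B. wt b \<in> dual T \<and> b \<in> weight_space (wt b))"

lemma
  assumes "weight_basis B wt"
  shows weight_basis_independent: "independent B"
    and weight_basis_span: "span B = UNIV"
    and weight_basis_finite: "finite B"
    and weight_basis_dual: "\<And>b. b \<in> B \<Longrightarrow> wt b \<in> dual T"
    and weight_basis_weight: "\<And>b. b \<in> B \<Longrightarrow> b \<in> weight_space (wt b)"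
    and weight_basis_nonzero: "\<And>b. b \<in> B \<Longrightarrow> b \<noteq> 0"
  using assms dependent_zero by (auto simp: weight_basis_def basis_finite)

lemma exists_weight_basis: obtains B wt where "weight_basis B wt"
proof -
  let ?U = "\<Union>\<gamma>\<in>dual T. weight_space \<gamma>"
  obtain B where B: "B \<subseteq> ?U" "independent B" "?U \<subseteq> span B"
    using maximal_independent_subset[of ?U] by metis
  have "span B = UNIV" using span_mono[OF B(3)] span_span[of B] span_weight_spaces by auto
  moreover have "\<forall>b\<in>B. \<exists>\<gamma>. \<gamma> \<in> dual T \<and> b \<in> weight_space \<gamma>" using B(1) by blast
  then obtain wt where "\<forall>b\<in>B. wt b \<in> dual T \<and> b \<in> weight_space (wt b)" by metis
  ultimately show thesis using that[of B wt] B(2) by (simp add: weight_basis_def)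
qed

text \<open>Compare coordinates in \<open>[t, x] = \<gamma>(t) x\<close>, where \<open>ad t\<close> is diagonal.\<close>

lemma weight_basis_support:
  assumes B: "weight_basis B wt" and \<gamma>: "\<gamma> \<in> dual T" and x: "x \<in> weight_space \<gamma>"
    and b: "representation B x b \<noteq> 0"
  shows "b \<in> B" "wt b = \<gamma>"
proof -
  note ind = weight_basis_independent[OF B] and sp = weight_basis_span[OF B]
  show bB: "b \<in> B" using b representation_ne_zero by blast
  show "wt b = \<gamma>"
  proof (rule dual_eqI[OF weight_basis_dual[OF B bB] \<gamma>])
    fix t assume t: "t \<in> T"
    have "\<gamma> t * representation B x b = representation B (bracket t x) b"
      using weight_spaceD[OF x t] ind sp by (simp add: representation_scale)
    also have "\<dots> = (\<Sum>c\<in>B. representation B x c * representation B (bracket t c) b)"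
      using ind sp by (intro representation_image_expand weight_basis_finite[OF B] endo_bracket) auto
    also have "\<dots> = (\<Sum>c\<in>B. if c = b then wt b t * representation B x b else 0)"
      using weight_spaceD[OF weight_basis_weight[OF B] t] ind sp
      by (intro sum.cong refl) (simp add: representation_scale representation_basis)
    also have "\<dots> = wt b t * representation B x b" using bB weight_basis_finite[OF B] by simp
    finally show "wt b t = \<gamma> t" using b by simp
  qed
qed

lemma weight_space_subset_span:
  assumes B: "weight_basis B wt" and \<gamma>: "\<gamma> \<in> dual T" and x: "x \<in> weight_space \<gamma>"
    and C: "\<And>b. b \<in> B \<Longrightarrow> wt b = \<gamma> \<Longrightarrow> b \<in> C"
  shows "x \<in> span C"
proof -
  have "x = (\<Sum>b\<in>B. representation B x b *s b)"
    using representation_expand[OF weight_basis_finite weight_basis_independent] weight_basis_span B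
    by blast
  also have "\<dots> \<in> span C"
  proof (rule span_sum)
    fix b assume "b \<in> B"
    then show "representation B x b *s b \<in> span C"
      using weight_basis_support[OF B \<gamma> x, of b] C[of b]
      by (cases "representation B x b = 0") (auto intro: span_scale span_base span_zero)
  qed
  finally show ?thesis .
qed

lemma weight_basis_root_iff:
  assumes B: "weight_basis B wt"
  shows "\<gamma> \<in> roots T \<longleftrightarrow> \<gamma> \<noteq> 0 \<and> (\<exists>b\<in>B. wt b = \<gamma>)"
proof
  assume \<gamma>: "\<gamma> \<in> roots T"
  then obtain x where x: "x \<noteq> 0" "x \<in> weight_space \<gamma>" by (auto simp: root_iff)
  have "\<exists>b\<in>B. wt b = \<gamma>"
  proof (rule ccontr)
    assume "\<not> (\<exists>b\<in>B. wt b = \<gamma>)"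
    then have "x \<in> span {}"
      using weight_space_subset_span[OF B root_in_dual[OF \<gamma>] x(2)] by blast
    then show False using x(1) by simp
  qed
  then show "\<gamma> \<noteq> 0 \<and> (\<exists>b\<in>B. wt b = \<gamma>)" using \<gamma> root_iff by blast
next
  assume "\<gamma> \<noteq> 0 \<and> (\<exists>b\<in>B. wt b = \<gamma>)"
  then show "\<gamma> \<in> roots T"
    using weight_basis_dual[OF B] weight_basis_weight[OF B] weight_basis_nonzero[OF B]
    unfolding root_iff by blast
qed

lemma finite_roots: "finite (roots T)"
proof -
  obtain B wt where B: "weight_basis B wt" by (rule exists_weight_basis)
  have "roots T \<subseteq> wt ` B"
  proof
    fix \<gamma> assume "\<gamma> \<in> roots T"
    then obtain b where "b \<in> B" "wt b = \<gamma>" using weight_basis_root_iff[OF B, of \<gamma>] by blast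
    then show "\<gamma> \<in> wt ` B" by blast
  qed
  then show ?thesis using weight_basis_finite[OF B] finite_surj by blast
qed

lemma weight_space_trivial:
  assumes "\<gamma> \<in> dual T" "\<gamma> \<noteq> 0" "\<gamma> \<notin> roots T" "x \<in> weight_space \<gamma>"
  shows "x = 0"
  using assms root_iff by blast

lemma bracket_weight_space:
  assumes "x \<in> weight_space \<gamma>" "y \<in> weight_space \<delta>"
  shows "bracket x y \<in> weight_space (\<gamma> + \<delta>)"
  using assms
  by (auto simp: weight_space_def bracket_derivation[of _ x y] bracket_scale_left
      bracket_scale_right scale_left_distrib)

lemma killing_orthogonal:
  assumes x: "x \<in> weight_space \<gamma>" and y: "y \<in> weight_space \<delta>" and d: "\<gamma> \<in> dual T" "\<delta> \<in> dual T"
    and ne: "\<gamma> + \<delta> \<noteq> 0"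
  shows "killing x y = 0"
proof -
  have "\<not> (\<forall>t\<in>T. (\<gamma> + \<delta>) t = 0)"
    using ne dual_eqI[OF add_in_dual[OF d] zero_in_dual] by auto
  then obtain t where t: "t \<in> T" "\<gamma> t + \<delta> t \<noteq> 0" by auto
  have "\<gamma> t * killing x y = killing (bracket t x) y"
    using weight_spaceD[OF x t(1)] by (simp add: killing_scale_left)
  also have "\<dots> = - killing (bracket x t) y"
    using bracket_skew[of t x] by (simp add: killing_minus_left)
  also have "\<dots> = - (\<delta> t * killing x y)"
    using weight_spaceD[OF y t(1)] by (simp add: killing_invariant killing_scale_right)
  finally have "(\<gamma> t + \<delta> t) * killing x y = 0" by (simp add: algebra_simps)
  then show ?thesis using t(2) by simp
qed

text \<open>Weight spaces are orthogonal unless their weights are opposite, so by nondegeneracy \<open>x\<close> pairs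
  nontrivially with some vector of weight \<open>- \<gamma>\<close>.\<close>

lemma killing_pairing:
  assumes x: "x \<noteq> 0" "x \<in> weight_space \<gamma>" and \<gamma>: "\<gamma> \<in> dual T"
  obtains y where "y \<in> weight_space (- \<gamma>)" "killing x y = 1"
proof -
  obtain B wt where B: "weight_basis B wt" by (rule exists_weight_basis)
  have "\<exists>b\<in>B. killing x b \<noteq> 0"
  proof (rule ccontr)
    assume *: "\<not> (\<exists>b\<in>B. killing x b \<noteq> 0)"
    have "killing x y = 0" for y
    proof -
      have "y \<in> span B" using weight_basis_span[OF B] by simp
      then show ?thesis
        by (induction rule: span_induct_alt)
          (use * in \<open>simp_all add: killing_add_right killing_scale_right killing_sym[of x 0] killing_zero_left\<close>)
    qed
    then show False using killing_nondegenerate x(1) by blast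
  qed
  then obtain b where b: "b \<in> B" "killing x b \<noteq> 0" by blast
  have "\<gamma> + wt b = 0"
    using killing_orthogonal[OF x(2) weight_basis_weight[OF B b(1)] \<gamma> weight_basis_dual[OF B b(1)]] b(2)
    by blast
  then have "wt b = - \<gamma>" by (simp add: add_eq_0_iff)
  then have "b \<in> weight_space (- \<gamma>)" using weight_basis_weight[OF B b(1)] by simp
  then show thesis
    using that[of "inverse (killing x b) *s b"] b(2) subspace_scale[OF subspace_weight_space]
    by (simp add: killing_scale_right)
qed

lemma root_uminus: "\<gamma> \<in> roots T \<Longrightarrow> - \<gamma> \<in> roots T"
proof -
  assume \<gamma>: "\<gamma> \<in> roots T"
  then obtain x where x: "x \<noteq> 0" "x \<in> weight_space \<gamma>" by (auto simp: root_iff)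
  obtain y where y: "y \<in> weight_space (- \<gamma>)" "killing x y = 1"
    using killing_pairing[OF x root_in_dual[OF \<gamma>]] .
  have "y \<noteq> 0" using y(2) by (auto simp: killing_sym[of x] killing_zero_left)
  then show ?thesis using y \<gamma> minus_in_dual[OF root_in_dual[OF \<gamma>]] by (auto simp: root_iff)
qed

lemma killing_nondegenerate_T:
  assumes t: "t \<in> T" and 0: "\<And>s. s \<in> T \<Longrightarrow> killing t s = 0"
  shows "t = 0"
proof (rule ccontr)
  assume "t \<noteq> 0"
  obtain s where "s \<in> weight_space (- 0)" "killing t s = 1"
    using killing_pairing[of t 0] \<open>t \<noteq> 0\<close> t weight_space_0 zero_in_dual by metis
  then show False using 0[of s] weight_space_0 by simp
qed

text \<open>Nondegeneracy on \<open>T\<close> gives existence and uniqueness in the definite description.\<close>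

lemma dual_vector:
  assumes \<mu>: "\<mu> \<in> dual T"
  shows "dual_vector T \<mu> \<in> T" "\<And>s. s \<in> T \<Longrightarrow> killing (dual_vector T \<mu>) s = \<mu> s"
proof -
  obtain B where B: "independent B" "span B = T" "finite B" by (rule basis_T)
  have ext: "\<forall>s\<in>T. killing t s = \<mu> s" if t: "\<And>b. b \<in> B \<Longrightarrow> killing t b = \<mu> b" for t
  proof -
    have "span B \<subseteq> {s \<in> T. killing t s = \<mu> s}"
    proof (rule span_minimal)
      show "B \<subseteq> {s \<in> T. killing t s = \<mu> s}" using t B by (auto intro: span_base)
      show "subspace {s \<in> T. killing t s = \<mu> s}"
        using subspace_T dual_zero[OF subspace_T \<mu>] dual_add[OF \<mu>] dual_scale[OF \<mu>]
        by (intro subspaceI) (auto simp: subspace_0 subspace_add subspace_scale killing_add_right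
            killing_scale_right killing_sym[of t 0] killing_zero_left)
    qed
    then show ?thesis using B(2) by blast
  qed
  obtain t where t: "t \<in> span B" "\<And>b. b \<in> B \<Longrightarrow> killing t b = \<mu> b"
  proof (rule nondegenerate_represents[OF B(3,1), of killing \<mu>])
    fix x assume x: "x \<in> span B" and 0: "\<And>b. b \<in> B \<Longrightarrow> killing x b = 0"
    show "x = 0"
    proof (rule killing_nondegenerate_T)
      show "x \<in> T" using x B by simp
      fix s assume "s \<in> T"
      then have "s \<in> span B" by (simp add: B)
      then show "killing x s = 0"
        by (induction rule: span_induct_alt)
          (simp_all add: 0 killing_add_right killing_scale_right killing_sym[of x 0] killing_zero_left)
    qed
  qed (auto simp: killing_add_left killing_scale_left)
  have "\<exists>!t. t \<in> T \<and> (\<forall>s\<in>T. killing t s = \<mu> s)"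
  proof (intro ex1I[of _ t] conjI)
    show "t \<in> T" using t B by simp
    show "\<forall>s\<in>T. killing t s = \<mu> s" by (rule ext[OF t(2)])
    fix u assume u: "u \<in> T \<and> (\<forall>s\<in>T. killing u s = \<mu> s)"
    have "u - t = 0"
      using u \<open>t \<in> T\<close> \<open>\<forall>s\<in>T. killing t s = \<mu> s\<close> subspace_T
      by (intro killing_nondegenerate_T) (auto simp: subspace_diff killing_diff_left)
    then show "u = t" by simp
  qed
  from theI'[OF this] show "dual_vector T \<mu> \<in> T"
    "\<And>s. s \<in> T \<Longrightarrow> killing (dual_vector T \<mu>) s = \<mu> s"
    unfolding dual_vector_def by blast+
qed

lemma form_eval: "\<mu> \<in> dual T \<Longrightarrow> \<nu> \<in> dual T \<Longrightarrow> form T \<mu> \<nu> = \<mu> (dual_vector T \<nu>)"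
  by (simp add: form_def dual_vector)

lemma form_sym: "form T \<mu> \<nu> = form T \<nu> \<mu>"
  by (simp add: form_def killing_sym)

lemma form_add_left:
  "\<mu> \<in> dual T \<Longrightarrow> \<mu>' \<in> dual T \<Longrightarrow> \<nu> \<in> dual T \<Longrightarrow> form T (\<mu> + \<mu>') \<nu> = form T \<mu> \<nu> + form T \<mu>' \<nu>"
  by (simp add: form_eval add_in_dual)

lemma form_diff_left:
  "\<mu> \<in> dual T \<Longrightarrow> \<mu>' \<in> dual T \<Longrightarrow> \<nu> \<in> dual T \<Longrightarrow> form T (\<mu> - \<mu>') \<nu> = form T \<mu> \<nu> - form T \<mu>' \<nu>"
  by (simp add: form_eval diff_in_dual)

lemma form_uminus_left:
  "\<mu> \<in> dual T \<Longrightarrow> \<nu> \<in> dual T \<Longrightarrow> form T (- \<mu>) \<nu> = - form T \<mu> \<nu>"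
  by (simp add: form_eval minus_in_dual)

lemma form_scale_left:
  "\<mu> \<in> dual T \<Longrightarrow> \<nu> \<in> dual T \<Longrightarrow> form T (fun_scale c \<mu>) \<nu> = c * form T \<mu> \<nu>"
  by (simp add: form_eval scale_in_dual)

lemma form_scale_right:
  "\<mu> \<in> dual T \<Longrightarrow> \<nu> \<in> dual T \<Longrightarrow> form T \<mu> (fun_scale c \<nu>) = c * form T \<mu> \<nu>"
  using form_scale_left[of \<nu> \<mu> c] by (simp add: form_sym)

lemma form_sum_left:
  "(\<And>a. a \<in> A \<Longrightarrow> f a \<in> dual T) \<Longrightarrow> \<nu> \<in> dual T \<Longrightarrow> form T (\<Sum>a\<in>A. f a) \<nu> = (\<Sum>a\<in>A. form T (f a) \<nu>)"
  by (simp add: form_eval sum_in_dual)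

text \<open>Both sides have the same products with \<open>s \<in> T\<close>, as \<open>\<kappa>([e, f], s) = \<kappa>(e, [f, s]) = \<gamma>(s) \<kappa>(e, f)\<close>.\<close>

lemma bracket_dual_vector:
  assumes e: "e \<in> weight_space \<gamma>" and f: "f \<in> weight_space (- \<gamma>)" and \<gamma>: "\<gamma> \<in> dual T"
  shows "bracket e f = killing e f *s dual_vector T \<gamma>"
proof -
  have T1: "bracket e f \<in> T" using bracket_weight_space[OF e f] weight_space_0 by simp
  have T2: "killing e f *s dual_vector T \<gamma> \<in> T"
    by (rule subspace_scale[OF subspace_T dual_vector(1)[OF \<gamma>]])
  have "bracket e f - killing e f *s dual_vector T \<gamma> = 0"
  proof (rule killing_nondegenerate_T[OF subspace_diff[OF subspace_T T1 T2]])
    fix s assume s: "s \<in> T"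
    have "bracket f s = \<gamma> s *s f"
      using weight_spaceD[OF f s] bracket_skew[of s f] by simp
    then have "killing (bracket e f) s = \<gamma> s * killing e f"
      by (simp add: killing_invariant killing_scale_right)
    then show "killing (bracket e f - killing e f *s dual_vector T \<gamma>) s = 0"
      using dual_vector(2)[OF \<gamma> s] by (simp add: killing_diff_left killing_scale_left)
  qed
  then show ?thesis by simp
qed

lemma root_triple:
  assumes \<gamma>: "\<gamma> \<in> roots T" and e: "e \<noteq> 0" "e \<in> weight_space \<gamma>"
  obtains f where "f \<in> weight_space (- \<gamma>)" "bracket e f = dual_vector T \<gamma>"
proof -
  obtain f where "f \<in> weight_space (- \<gamma>)" "killing e f = 1"
    using killing_pairing[OF e root_in_dual[OF \<gamma>]] .
  then show thesis using that bracket_dual_vector[OF e(2) _ root_in_dual[OF \<gamma>]] by simp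
qed

text \<open>A commutator has trace zero on every invariant subspace.  This takes the place of the
  representation theory of \<open>sl\<^sub>2\<close>: the three applications below differ only in the subspace.\<close>

lemma trace_commutator_zero:
  assumes B: "weight_basis B wt" and C: "C \<subseteq> B"
    and e: "\<And>c. c \<in> C \<Longrightarrow> bracket e c \<in> span C" and f: "\<And>c. c \<in> C \<Longrightarrow> bracket f c \<in> span C"
    and h: "bracket e f \<in> T"
  shows "(\<Sum>c\<in>C. wt c (bracket e f)) = 0"
proof -
  have C': "finite C" "independent C"
    using finite_subset[OF C weight_basis_finite[OF B]]
      independent_mono[OF weight_basis_independent[OF B] C] by blast+
  have ee: "bracket e x \<in> span C" and ff: "bracket f x \<in> span C" if "x \<in> span C" for x
    using that by (auto intro: endo_span_into[OF endo_bracket] e f)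
  have "(\<Sum>c\<in>C. wt c (bracket e f)) = trace_on C (bracket (bracket e f))"
    using weight_spaceD[OF weight_basis_weight[OF B] h] C
    by (intro trace_on_diagonal[symmetric] C') auto
  also have "\<dots> = trace_on C (\<lambda>x. bracket e (bracket f x)) - trace_on C (\<lambda>x. bracket f (bracket e x))"
    unfolding trace_on_def bracket_bracket_left sum_subtractf[symmetric]
    using C'(2) ee ff by (intro sum.cong refl) (simp add: representation_diff span_base)
  also have "\<dots> = 0"
    using trace_on_comm[OF C' endo_bracket endo_bracket e f] by simp
  finally show ?thesis .
qed

lemma weight_basis_root:
  assumes B: "weight_basis B wt" and \<gamma>: "\<gamma> \<in> roots T"
  obtains b where "b \<in> B" "wt b = \<gamma>"
  using weight_basis_root_iff[OF B] \<gamma> by blast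

lemma fun_scale_cancel:
  assumes "\<gamma> \<noteq> 0" "\<beta> + fun_scale a \<gamma> = \<beta> + fun_scale b \<gamma>"
  shows "a = b"
  using assms by (metis add_left_cancel weights.scale_cancel_right)

text \<open>If \<open>(\<gamma>, \<gamma>) = 0\<close>, then tracing over the whole \<open>\<gamma>\<close>-string through \<open>\<beta>\<close> gives \<open>(\<beta>, \<gamma>) = 0\<close>, for
  every root \<open>\<beta>\<close>, although the form is nondegenerate.\<close>

lemma form_root_nonzero:
  assumes \<gamma>: "\<gamma> \<in> roots T"
  shows "form T \<gamma> \<gamma> \<noteq> 0"
proof
  assume 0: "form T \<gamma> \<gamma> = 0"
  note \<gamma>d = root_in_dual[OF \<gamma>]
  let ?h = "dual_vector T \<gamma>"
  have h: "?h \<in> T" by (rule dual_vector(1)[OF \<gamma>d])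
  have \<gamma>h: "\<gamma> ?h = 0" using 0 form_eval[OF \<gamma>d \<gamma>d] by simp
  obtain B wt where B: "weight_basis B wt" by (rule exists_weight_basis)
  obtain e where e: "e \<noteq> 0" "e \<in> weight_space \<gamma>" using \<gamma> by (auto simp: root_iff)
  obtain f where f: "f \<in> weight_space (- \<gamma>)" "bracket e f = ?h" by (rule root_triple[OF \<gamma> e])
  have "?h = 0"
  proof (rule roots_separate[OF h])
    fix \<beta> assume \<beta>: "\<beta> \<in> roots T"
    define C where "C = {b \<in> B. \<exists>n::int. wt b = \<beta> + fun_scale (of_int n) \<gamma>}"
    have str: "\<beta> + fun_scale (of_int n) \<gamma> \<in> dual T" for n
      by (intro add_in_dual scale_in_dual root_in_dual \<beta> \<gamma>)
    have sub: "x \<in> span C" if "x \<in> weight_space (\<beta> + fun_scale (of_int n) \<gamma>)" for x n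
      using weight_space_subset_span[OF B str that] by (auto simp: C_def)
    have "(\<Sum>c\<in>C. wt c (bracket e f)) = 0"
    proof (rule trace_commutator_zero[OF B])
      show "C \<subseteq> B" by (auto simp: C_def)
      show "bracket e f \<in> T" using f h by simp
      fix c assume "c \<in> C"
      then obtain n where c: "c \<in> B" "wt c = \<beta> + fun_scale (of_int n) \<gamma>" by (auto simp: C_def)
      have "\<gamma> + wt c = \<beta> + fun_scale (of_int (n + 1)) \<gamma>" "- \<gamma> + wt c = \<beta> + fun_scale (of_int (n - 1)) \<gamma>"
        unfolding c(2) by (auto simp: fun_eq_iff algebra_simps)
      then show "bracket e c \<in> span C" "bracket f c \<in> span C"
        using sub bracket_weight_space[OF e(2) weight_basis_weight[OF B c(1)]]
          bracket_weight_space[OF f(1) weight_basis_weight[OF B c(1)]] by metis+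
    qed
    moreover have "(\<Sum>c\<in>C. wt c (bracket e f)) = (\<Sum>c\<in>C. \<beta> ?h)"
      by (intro sum.cong refl) (auto simp: C_def f(2) \<gamma>h)
    moreover have "C \<noteq> {}"
    proof -
      obtain b where "b \<in> B" "wt b = \<beta>" by (rule weight_basis_root[OF B \<beta>])
      then have "b \<in> C" by (auto simp: C_def fun_eq_iff intro!: exI[of _ 0])
      then show ?thesis by blast
    qed
    moreover have "finite C" using weight_basis_finite[OF B] by (simp add: C_def)
    ultimately show "\<beta> ?h = 0" by simp
  qed
  then have "\<gamma> = 0"
    using dual_vector(2)[OF \<gamma>d] dual_eqI[OF \<gamma>d zero_in_dual] by (simp add: killing_zero_left)
  then show False using \<gamma> by (simp add: root_iff)
qed

text \<open>Let \<open>g(\<delta>)\<close> be the weight space of \<open>\<delta>\<close>.  The trace of \<open>[e, f]\<close> over the sum of the line of \<open>e\<close> and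
  \<open>T, g(-\<gamma>), g(-2\<gamma>), \<dots>\<close> is \<open>(1 - \<Sum>n. n dim g(-n\<gamma>)) (\<gamma>, \<gamma>)\<close>.  Adding only a line of \<open>g(\<gamma>)\<close> keeps the
  subspace invariant, because \<open>ad e\<close> maps \<open>T\<close> into this line.\<close>

lemma root_multiplicity_sum:
  assumes B: "weight_basis B wt" and \<gamma>: "\<gamma> \<in> roots T"
    and n: "\<And>b. b \<in> B \<Longrightarrow> (\<exists>m::nat. wt b = fun_scale (- of_nat m) \<gamma>) \<Longrightarrow> wt b = fun_scale (- of_nat (n b)) \<gamma>"
  shows "(\<Sum>b | b \<in> B \<and> (\<exists>m::nat. wt b = fun_scale (- of_nat m) \<gamma>). n b) = (1::nat)"
proof -
  let ?D = "{b \<in> B. \<exists>m::nat. wt b = fun_scale (- of_nat m) \<gamma>}"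
  let ?h = "dual_vector T \<gamma>"
  note \<gamma>d = root_in_dual[OF \<gamma>]
  have \<gamma>0: "\<gamma> \<noteq> 0" using \<gamma> by (simp add: root_iff)
  obtain e where eB: "e \<in> B" "wt e = \<gamma>" by (rule weight_basis_root[OF B \<gamma>])
  have e: "e \<noteq> 0" "e \<in> weight_space \<gamma>"
    using weight_basis_nonzero[OF B eB(1)] weight_basis_weight[OF B eB(1)] eB(2) by auto
  obtain f where f: "f \<in> weight_space (- \<gamma>)" "bracket e f = ?h" by (rule root_triple[OF \<gamma> e])
  have h: "?h \<in> T" by (rule dual_vector(1)[OF \<gamma>d])
  have sub: "x \<in> span (insert e ?D)" if "x \<in> weight_space (fun_scale (- of_nat m) \<gamma>)" for x m
    by (rule weight_space_subset_span[OF B scale_in_dual[OF \<gamma>d] that]) blast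
  have "(\<Sum>c\<in>insert e ?D. wt c (bracket e f)) = 0"
  proof (rule trace_commutator_zero[OF B])
    show "insert e ?D \<subseteq> B" using eB by blast
    show "bracket e f \<in> T" using f h by simp
    fix c assume "c \<in> insert e ?D"
    then consider "c = e" | m :: nat where "c \<in> B" "wt c = fun_scale (- of_nat m) \<gamma>" by blast
    then show "bracket e c \<in> span (insert e ?D)"
    proof cases
      case 1
      then show ?thesis by (simp add: bracket_alternating span_zero)
    next
      case 2
      note cw = weight_basis_weight[OF B 2(1)]
      show ?thesis
      proof (cases m)
        case 0
        then have "wt c = 0" using 2(2) by (simp add: fun_eq_iff)
        then have "c \<in> T" using cw weight_space_0 by simp
        then have "bracket e c = - \<gamma> c *s e" using weight_spaceD[OF e(2)] bracket_skew[of c e] by simp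
        then show ?thesis by (simp add: span_neg span_scale span_base)
      next
        case (Suc k)
        have "\<gamma> + wt c = fun_scale (- of_nat k) \<gamma>" unfolding 2(2) Suc by (simp add: fun_eq_iff algebra_simps)
        then show ?thesis using sub[of "bracket e c" k] bracket_weight_space[OF e(2) cw] by simp
      qed
    qed
    show "bracket f c \<in> span (insert e ?D)"
      using \<open>c \<in> insert e ?D\<close>
    proof (elim insertE)
      assume "c = e"
      have "bracket f e = - ?h" using f(2) bracket_skew[of f e] by simp
      also have "\<dots> \<in> weight_space (fun_scale (- of_nat 0) \<gamma>)"
        using subspace_neg[OF subspace_T h] weight_space_0 by (simp add: zero_fun_def fun_scale_def)
      finally show ?thesis using sub \<open>c = e\<close> by blast
    next
      assume "c \<in> ?D"
      then obtain m :: nat where m: "c \<in> B" "wt c = fun_scale (- of_nat m) \<gamma>" by blast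
      have "- \<gamma> + wt c = fun_scale (- of_nat (Suc m)) \<gamma>" unfolding m(2) by (simp add: fun_eq_iff algebra_simps)
      then show ?thesis
        using sub[of "bracket f c" "Suc m"] bracket_weight_space[OF f(1) weight_basis_weight[OF B m(1)]]
        by simp
    qed
  qed
  moreover have "e \<notin> ?D"
  proof
    assume "e \<in> ?D"
    then obtain m :: nat where "\<gamma> = fun_scale (- of_nat m) \<gamma>" using eB by auto
    then have "0 + fun_scale 1 \<gamma> = 0 + fun_scale (- of_nat m) \<gamma>" by simp
    then have "1 = - (of_nat m :: 'k)" by (rule fun_scale_cancel[OF \<gamma>0])
    then have "of_nat (Suc m) = (0::'k)" by (simp add: eq_neg_iff_add_eq_0)
    then show False by (simp only: of_nat_eq_0_iff)
  qed
  moreover have "finite ?D" using weight_basis_finite[OF B] by simp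
  moreover have "(\<Sum>c\<in>?D. wt c ?h) = - (\<Sum>c\<in>?D. of_nat (n c)) * \<gamma> ?h"
    unfolding sum_negf[symmetric] sum_distrib_right
  proof (intro sum.cong refl)
    fix c assume "c \<in> ?D"
    then have "wt c = fun_scale (- of_nat (n c)) \<gamma>" using n by blast
    then show "wt c ?h = - of_nat (n c) * \<gamma> ?h" by simp
  qed
  ultimately have "\<gamma> ?h = (\<Sum>c\<in>?D. of_nat (n c)) * \<gamma> ?h" using f(2) eB(2) by simp
  moreover have "\<gamma> ?h \<noteq> 0" using form_root_nonzero[OF \<gamma>] form_eval[OF \<gamma>d \<gamma>d] by simp
  ultimately have "(\<Sum>c\<in>?D. of_nat (n c)) = (1::'k)" by simp
  then have "of_nat (\<Sum>c\<in>?D. n c) = (of_nat 1 :: 'k)" by simp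
  then show ?thesis by (simp only: of_nat_eq_iff)
qed

lemma
  assumes B: "weight_basis B wt" and \<gamma>: "\<gamma> \<in> roots T"
  shows root_space_dim_1: "b1 \<in> B \<Longrightarrow> b2 \<in> B \<Longrightarrow> wt b1 = - \<gamma> \<Longrightarrow> wt b2 = - \<gamma> \<Longrightarrow> b1 = b2"
    and negative_multiple_weight: "b1 \<in> B \<Longrightarrow> wt b1 = fun_scale (- of_nat m) \<gamma> \<Longrightarrow> m \<le> 1"
proof -
  let ?D = "{b \<in> B. \<exists>m::nat. wt b = fun_scale (- of_nat m) \<gamma>}"
  have \<gamma>0: "\<gamma> \<noteq> 0" using \<gamma> by (simp add: root_iff)
  define n where "n b = (SOME m::nat. wt b = fun_scale (- of_nat m) \<gamma>)" for b
  have n: "wt b = fun_scale (- of_nat (n b)) \<gamma>" if "\<exists>m::nat. wt b = fun_scale (- of_nat m) \<gamma>" for b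
    unfolding n_def using that by (rule someI_ex)
  have nm: "n b = m" if "wt b = fun_scale (- of_nat m) \<gamma>" for b m
  proof -
    have "0 + fun_scale (- of_nat m) \<gamma> = 0 + fun_scale (- of_nat (n b)) \<gamma>"
      using n[of b] that by auto
    then have "- of_nat m = (- of_nat (n b) :: 'k)" by (rule fun_scale_cancel[OF \<gamma>0])
    then show ?thesis by simp
  qed
  have sum: "(\<Sum>b\<in>?D. n b) = 1" using root_multiplicity_sum[OF B \<gamma>] n by blast
  have fin: "finite ?D" using weight_basis_finite[OF B] by simp
  show "m \<le> 1" if "b1 \<in> B" "wt b1 = fun_scale (- of_nat m) \<gamma>"
  proof -
    have "n b1 \<le> (\<Sum>b\<in>?D. n b)" using that fin by (intro member_le_sum) auto
    then show ?thesis using nm[OF that(2)] sum by simp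
  qed
  show "b1 = b2" if b: "b1 \<in> B" "b2 \<in> B" "wt b1 = - \<gamma>" "wt b2 = - \<gamma>"
  proof (rule ccontr)
    assume "b1 \<noteq> b2"
    have w: "wt b1 = fun_scale (- of_nat 1) \<gamma>" "wt b2 = fun_scale (- of_nat 1) \<gamma>"
      using b by (auto simp: fun_eq_iff)
    have "{b1, b2} \<subseteq> ?D" using b w by blast
    then have "(\<Sum>b\<in>{b1, b2}. n b) \<le> (\<Sum>b\<in>?D. n b)" using fin by (intro sum_mono2) auto
    then show False using \<open>b1 \<noteq> b2\<close> nm[OF w(1)] nm[OF w(2)] sum by simp
  qed
qed

lemma weight_basis_root_unique:
  assumes B: "weight_basis B wt" and "b1 \<in> B" "b2 \<in> B" "wt b1 = wt b2" "wt b1 \<noteq> 0"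
  shows "b1 = b2"
proof -
  have "wt b1 \<in> roots T" using assms weight_basis_root_iff[OF B] by blast
  then have "- wt b1 \<in> roots T" by (rule root_uminus)
  then show ?thesis by (rule root_space_dim_1[OF B]) (use assms in auto)
qed

lemma root_multiple:
  assumes \<gamma>: "\<gamma> \<in> roots T" and n: "fun_scale (of_int n) \<gamma> \<in> roots T"
  shows "n = 1 \<or> n = -1"
proof -
  obtain B wt where B: "weight_basis B wt" by (rule exists_weight_basis)
  have aux: "m \<le> 1" if "\<delta> \<in> roots T" "fun_scale (- of_nat m) \<delta> \<in> roots T" for m \<delta>
    using weight_basis_root[OF B that(2)] negative_multiple_weight[OF B that(1)] by metis
  have "n \<noteq> 0"
  proof
    assume "n = 0"
    then have "fun_scale (of_int n) \<gamma> = 0" by (simp add: fun_eq_iff)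
    then show False using n by (simp add: root_iff)
  qed
  moreover have "nat \<bar>n\<bar> \<le> 1"
  proof (cases "n \<ge> 0")
    case True
    have "fun_scale (- of_nat (nat \<bar>n\<bar>)) (- \<gamma>) = fun_scale (of_int n) \<gamma>"
      using True by (simp add: fun_eq_iff)
    then show ?thesis using aux[OF root_uminus[OF \<gamma>]] n by metis
  next
    case False
    have "fun_scale (- of_nat (nat \<bar>n\<bar>)) \<gamma> = fun_scale (of_int n) \<gamma>"
      using False by (simp add: fun_eq_iff)
    then show ?thesis using aux[OF \<gamma>] n by metis
  qed
  ultimately show ?thesis by linarith
qed

text \<open>Root spaces are one-dimensional, so in the trace of \<open>ad s ad t\<close> each root counts once.\<close>

lemma killing_sum_roots:
  assumes s: "s \<in> T" and t: "t \<in> T"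
  shows "killing s t = (\<Sum>\<gamma>\<in>roots T. \<gamma> s * \<gamma> t)"
proof -
  obtain B wt where B: "weight_basis B wt" by (rule exists_weight_basis)
  have "killing s t = trace_on B (\<lambda>z. bracket s (bracket t z))"
    unfolding killing_def
    by (rule trace_eq_trace_on[OF weight_basis_independent[OF B] weight_basis_span[OF B]
          endo_comp[OF endo_bracket endo_bracket]])
  also have "\<dots> = (\<Sum>b\<in>B. wt b s * wt b t)"
    by (rule trace_on_diagonal[OF weight_basis_independent[OF B]])
      (simp add: weight_spaceD[OF weight_basis_weight[OF B]] s t bracket_scale_right mult.commute)
  also have "\<dots> = (\<Sum>b | b \<in> B \<and> wt b \<noteq> 0. wt b s * wt b t)"
    using weight_basis_finite[OF B] by (intro sum.mono_neutral_right) auto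
  also have "\<dots> = (\<Sum>\<gamma>\<in>roots T. \<gamma> s * \<gamma> t)"
  proof (rule sum.reindex_bij_betw[of wt _ _ "\<lambda>\<gamma>. \<gamma> s * \<gamma> t"])
    show "bij_betw wt {b \<in> B. wt b \<noteq> 0} (roots T)"
      unfolding bij_betw_def inj_on_def
      using weight_basis_root_unique[OF B] weight_basis_root_iff[OF B] by auto
  qed
  finally show ?thesis .
qed

lemma form_sum_roots:
  assumes "\<mu> \<in> dual T" "\<nu> \<in> dual T"
  shows "form T \<mu> \<nu> = (\<Sum>\<gamma>\<in>roots T. form T \<gamma> \<mu> * form T \<gamma> \<nu>)"
  unfolding form_def[of T \<mu> \<nu>] killing_sum_roots[OF dual_vector(1)[OF assms(1)] dual_vector(1)[OF assms(2)]]
  using assms by (intro sum.cong refl) (simp add: form_eval root_in_dual)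

end

section \<open>Root strings\<close>

context based_simple_lie_algebra
begin

lemma string_end:
  assumes \<gamma>: "\<gamma> \<in> roots T" and \<beta>: "\<beta> \<in> roots T"
  obtains p :: nat where "\<And>n::nat. n \<le> p \<Longrightarrow> \<beta> + fun_scale (of_nat n) \<gamma> \<in> roots T"
    "\<beta> + fun_scale (of_nat (Suc p)) \<gamma> \<notin> roots T"
proof -
  let ?s = "\<lambda>n::nat. \<beta> + fun_scale (of_nat n) \<gamma>"
  have "\<gamma> \<noteq> 0" using \<gamma> by (simp add: root_iff)
  then have "inj ?s" by (intro injI) (drule (1) fun_scale_cancel, simp)
  have "\<exists>n. ?s n \<notin> roots T"
  proof (rule ccontr)
    assume "\<nexists>n. ?s n \<notin> roots T"
    then have "range ?s \<subseteq> roots T" by blast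
    then have "finite (range ?s)" using finite_roots finite_subset by blast
    then show False using finite_imageD[OF _ \<open>inj ?s\<close>] infinite_UNIV_nat by blast
  qed
  then obtain m where m: "?s m \<notin> roots T" "\<And>n. n < m \<Longrightarrow> ?s n \<in> roots T"
    using exists_least_iff[of "\<lambda>n. ?s n \<notin> roots T"] by blast
  have "?s 0 = \<beta>" by (simp add: fun_eq_iff)
  then have "m \<noteq> 0" using m(1) \<beta> by (intro notI) simp
  then obtain p where "m = Suc p" using not0_implies_Suc by blast
  show thesis
  proof (rule that[of p])
    show "?s n \<in> roots T" if "n \<le> p" for n using m(2)[of n] that \<open>m = Suc p\<close> by simp
    show "?s (Suc p) \<notin> roots T" using m(1) \<open>m = Suc p\<close> by (simp only:) simp
  qed
qed

text \<open>The trace of \<open>[e, f]\<close> over the string is the sum of an arithmetic progression with difference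
  \<open>(\<gamma>, \<gamma>)\<close>, so the progression is centred at zero.\<close>

lemma root_string:
  assumes \<gamma>: "\<gamma> \<in> roots T" and \<beta>: "\<beta> \<in> roots T"
    and no_0: "\<And>n::int. \<beta> + fun_scale (of_int n) \<gamma> \<noteq> 0"
  obtains p q :: int where "0 \<le> p" "0 \<le> q"
    "\<And>n. - q \<le> n \<Longrightarrow> n \<le> p \<Longrightarrow> \<beta> + fun_scale (of_int n) \<gamma> \<in> roots T"
    "\<beta> + fun_scale (of_int (p + 1)) \<gamma> \<notin> roots T"
    "\<beta> + fun_scale (of_int (- q - 1)) \<gamma> \<notin> roots T"
    "2 * form T \<beta> \<gamma> = of_int (q - p) * form T \<gamma> \<gamma>"
proof -
  let ?s = "\<lambda>n::int. \<beta> + fun_scale (of_int n) \<gamma>"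
  let ?h = "dual_vector T \<gamma>"
  note \<gamma>d = root_in_dual[OF \<gamma>] and \<beta>d = root_in_dual[OF \<beta>]
  have \<gamma>0: "\<gamma> \<noteq> 0" using \<gamma> by (simp add: root_iff)
  obtain p' :: nat where p': "\<And>n::nat. n \<le> p' \<Longrightarrow> \<beta> + fun_scale (of_nat n) \<gamma> \<in> roots T"
    "\<beta> + fun_scale (of_nat (Suc p')) \<gamma> \<notin> roots T" by (rule string_end[OF \<gamma> \<beta>]) blast
  obtain q' :: nat where q': "\<And>n::nat. n \<le> q' \<Longrightarrow> \<beta> + fun_scale (of_nat n) (- \<gamma>) \<in> roots T"
    "\<beta> + fun_scale (of_nat (Suc q')) (- \<gamma>) \<notin> roots T"
    by (rule string_end[OF root_uminus[OF \<gamma>] \<beta>]) blast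
  define p q where "p = int p'" and "q = int q'"
  have pos: "?s (int n) = \<beta> + fun_scale (of_nat n) \<gamma>" and neg: "?s (- int n) = \<beta> + fun_scale (of_nat n) (- \<gamma>)" for n
    by (auto simp: fun_eq_iff)
  have in_str: "?s n \<in> roots T" if "- q \<le> n" "n \<le> p" for n
  proof (cases "n \<ge> 0")
    case True
    then show ?thesis using p'(1)[of "nat n"] pos[of "nat n"] that by (simp add: p_def nat_le_iff)
  next
    case False
    then show ?thesis using q'(1)[of "nat (- n)"] neg[of "nat (- n)"] that by (simp add: q_def nat_le_iff)
  qed
  have top: "?s (p + 1) \<notin> roots T"
  proof -
    have "p + 1 = int (Suc p')" by (simp add: p_def)
    then show ?thesis using p'(2) pos[of "Suc p'"] by metis
  qed
  have bot: "?s (- q - 1) \<notin> roots T"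
  proof -
    have "- q - 1 = - int (Suc q')" by (simp add: q_def)
    then show ?thesis using q'(2) neg[of "Suc q'"] by metis
  qed
  obtain B wt where B: "weight_basis B wt" by (rule exists_weight_basis)
  define C where "C = {b \<in> B. wt b \<in> ?s ` {- q..p}}"
  have str: "?s n \<in> dual T" for n by (intro add_in_dual scale_in_dual \<beta>d \<gamma>d)
  have sub: "x \<in> span C" if n: "- q - 1 \<le> n" "n \<le> p + 1" and x: "x \<in> weight_space (?s n)" for x n
  proof (cases "- q \<le> n \<and> n \<le> p")
    case True
    then show ?thesis by (intro weight_space_subset_span[OF B str x]) (auto simp: C_def)
  next
    case False
    then have "n = p + 1 \<or> n = - q - 1" using n by linarith
    then have "?s n \<notin> roots T" using top bot by blast
    then show ?thesis using weight_space_trivial[OF str no_0 _ x] by (simp add: span_zero)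
  qed
  obtain e where e: "e \<noteq> 0" "e \<in> weight_space \<gamma>" using \<gamma> by (auto simp: root_iff)
  obtain f where f: "f \<in> weight_space (- \<gamma>)" "bracket e f = ?h" by (rule root_triple[OF \<gamma> e])
  have "(\<Sum>c\<in>C. wt c (bracket e f)) = 0"
  proof (rule trace_commutator_zero[OF B])
    show "C \<subseteq> B" by (auto simp: C_def)
    show "bracket e f \<in> T" using f dual_vector(1)[OF \<gamma>d] by simp
    fix c assume "c \<in> C"
    then have cB: "c \<in> B" and "wt c \<in> ?s ` {- q..p}" by (auto simp: C_def)
    from this(2) obtain n where "wt c = ?s n" "n \<in> {- q..p}" by (rule imageE)
    with cB have c: "c \<in> B" "wt c = ?s n" "- q \<le> n" "n \<le> p" by simp_all
    have eq: "\<gamma> + wt c = ?s (n + 1)" "- \<gamma> + wt c = ?s (n - 1)"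
      unfolding c(2) by (auto simp: fun_eq_iff algebra_simps)
    show "bracket e c \<in> span C"
      using bracket_weight_space[OF e(2) weight_basis_weight[OF B c(1)]] c(3,4)
      unfolding eq(1) by (intro sub[of "n + 1"]) auto
    show "bracket f c \<in> span C"
      using bracket_weight_space[OF f(1) weight_basis_weight[OF B c(1)]] c(3,4)
      unfolding eq(2) by (intro sub[of "n - 1"]) auto
  qed
  also have "(\<Sum>c\<in>C. wt c (bracket e f)) = (\<Sum>\<delta>\<in>?s ` {- q..p}. \<delta> ?h)"
    unfolding f(2)
  proof (rule sum.reindex_bij_betw[of wt C _ "\<lambda>\<delta>. \<delta> ?h"])
    have "?s ` {- q..p} \<subseteq> wt ` C"
    proof
      fix \<delta> assume \<delta>: "\<delta> \<in> ?s ` {- q..p}"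
      then have "\<delta> \<in> roots T" using in_str by auto
      then obtain b where "b \<in> B" "wt b = \<delta>" by (rule weight_basis_root[OF B])
      then show "\<delta> \<in> wt ` C" using \<delta> by (auto simp: C_def)
    qed
    moreover have "inj_on wt C"
      using weight_basis_root_unique[OF B] no_0 by (intro inj_onI) (auto simp: C_def)
    ultimately show "bij_betw wt C (?s ` {- q..p})" by (auto simp: bij_betw_def C_def)
  qed
  also have "\<dots> = (\<Sum>n\<in>{- q..p}. ?s n ?h)"
  proof (rule sum.reindex[unfolded o_def])
    show "inj_on ?s {- q..p}" by (intro inj_onI) (drule fun_scale_cancel[OF \<gamma>0], simp)
  qed
  finally have 0: "(\<Sum>n\<in>{- q..p}. ?s n ?h) = 0" by simp
  \<comment> \<open>Reverse the progression: its sum is the number of terms times the mean of the two end terms.\<close>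
  have "(\<Sum>n\<in>{- q..p}. ?s (p - q - n) ?h) = (\<Sum>n\<in>{- q..p}. ?s n ?h)"
    by (rule sum.reindex_bij_witness[of _ "\<lambda>n. p - q - n" "\<lambda>n. p - q - n"]) auto
  then have "0 = (\<Sum>n\<in>{- q..p}. ?s n ?h + ?s (p - q - n) ?h)"
    unfolding sum.distrib[of "\<lambda>n. ?s n ?h" "\<lambda>n. ?s (p - q - n) ?h"] using 0 by (simp only:) simp
  also have "\<dots> = (\<Sum>n\<in>{- q..p}. 2 * \<beta> ?h + of_int (p - q) * \<gamma> ?h)"
    by (intro sum.cong refl) (simp add: algebra_simps)
  also have "\<dots> = of_nat (nat (p + q + 1)) * (2 * \<beta> ?h + of_int (p - q) * \<gamma> ?h)"
    by (simp add: algebra_simps)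
  finally have "of_nat (nat (p + q + 1)) * (2 * \<beta> ?h + of_int (p - q) * \<gamma> ?h) = 0" by (rule sym)
  moreover have "of_nat (nat (p + q + 1)) \<noteq> (0::'k)"
    by (simp only: of_nat_eq_0_iff) (simp add: p_def q_def)
  ultimately have "2 * \<beta> ?h + of_int (p - q) * \<gamma> ?h = 0" by (simp only: mult_eq_0_iff) blast
  then have "2 * form T \<beta> \<gamma> = of_int (q - p) * form T \<gamma> \<gamma>"
    by (simp add: form_eval \<beta>d \<gamma>d algebra_simps)
  then show thesis using that[of p q] in_str top bot by (simp add: p_def q_def)
qed

end

section \<open>Cartan integers and positivity\<close>

context based_simple_lie_algebra
begin

definition cartan_int :: "('g \<Rightarrow> 'k) \<Rightarrow> ('g \<Rightarrow> 'k) \<Rightarrow> int" where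
  "cartan_int \<beta> \<gamma> = (THE a. 2 * form T \<beta> \<gamma> = of_int a * form T \<gamma> \<gamma>)"

lemma cartan_int_eqI:
  assumes "\<gamma> \<in> roots T" "2 * form T \<beta> \<gamma> = of_int a * form T \<gamma> \<gamma>"
  shows "cartan_int \<beta> \<gamma> = a"
  unfolding cartan_int_def using assms form_root_nonzero[OF assms(1)]
  by (intro the_equality) auto

lemma cartan_int_self: "\<gamma> \<in> roots T \<Longrightarrow> cartan_int \<gamma> \<gamma> = 2"
  by (rule cartan_int_eqI) simp_all

lemma no_zero_in_string:
  assumes \<gamma>: "\<gamma> \<in> roots T" and \<beta>: "\<beta> \<in> roots T" and "\<beta> \<noteq> \<gamma>" "\<beta> \<noteq> - \<gamma>"
  shows "\<beta> + fun_scale (of_int n) \<gamma> \<noteq> 0"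
proof
  assume "\<beta> + fun_scale (of_int n) \<gamma> = 0"
  then have *: "\<beta> = fun_scale (of_int (- n)) \<gamma>" by (auto simp: fun_eq_iff add_eq_0_iff)
  then have "- n = 1 \<or> - n = -1" using root_multiple[OF \<gamma>, of "- n"] \<beta> by simp
  then have "\<beta> = \<gamma> \<or> \<beta> = - \<gamma>"
    by (elim disjE) (use * in \<open>simp_all add: fun_eq_iff\<close>)
  then show False using assms by blast
qed

lemma cartan_string:
  assumes \<gamma>: "\<gamma> \<in> roots T" and \<beta>: "\<beta> \<in> roots T" and "\<beta> \<noteq> \<gamma>" "\<beta> \<noteq> - \<gamma>"
  obtains p q :: int where "0 \<le> p" "0 \<le> q"
    "\<And>n. - q \<le> n \<Longrightarrow> n \<le> p \<Longrightarrow> \<beta> + fun_scale (of_int n) \<gamma> \<in> roots T"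
    "\<beta> + fun_scale (of_int (p + 1)) \<gamma> \<notin> roots T"
    "\<beta> + fun_scale (of_int (- q - 1)) \<gamma> \<notin> roots T"
    "cartan_int \<beta> \<gamma> = q - p"
    "2 * form T \<beta> \<gamma> = of_int (q - p) * form T \<gamma> \<gamma>"
  by (rule root_string[OF \<gamma> \<beta> no_zero_in_string[OF assms]])
    (rule that, assumption+, rule cartan_int_eqI[OF \<gamma>])

lemma cartan_int:
  assumes \<gamma>: "\<gamma> \<in> roots T" and \<beta>: "\<beta> \<in> roots T"
  shows "2 * form T \<beta> \<gamma> = of_int (cartan_int \<beta> \<gamma>) * form T \<gamma> \<gamma>"
proof (cases "\<beta> = \<gamma> \<or> \<beta> = - \<gamma>")
  case True
  have "2 * form T (- \<gamma>) \<gamma> = of_int (-2) * form T \<gamma> \<gamma>"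
    using root_in_dual[OF \<gamma>] by (simp add: form_uminus_left)
  moreover from this have "cartan_int (- \<gamma>) \<gamma> = -2" by (rule cartan_int_eqI[OF \<gamma>])
  ultimately show ?thesis using True cartan_int_self[OF \<gamma>] by auto
next
  case False
  then have "\<beta> \<noteq> \<gamma>" "\<beta> \<noteq> - \<gamma>" by auto
  then show ?thesis by (rule cartan_string[OF \<gamma> \<beta>]) simp
qed

lemma cartan_int_uminus:
  assumes \<gamma>: "\<gamma> \<in> roots T" and \<beta>: "\<beta> \<in> roots T"
  shows "cartan_int (- \<beta>) \<gamma> = - cartan_int \<beta> \<gamma>"
  using cartan_int[OF assms] root_in_dual[OF \<gamma>] root_in_dual[OF \<beta>]
  by (intro cartan_int_eqI \<gamma>) (simp add: form_uminus_left)

definition reflect :: "('g \<Rightarrow> 'k) \<Rightarrow> ('g \<Rightarrow> 'k) \<Rightarrow> 'g \<Rightarrow> 'k" where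
  "reflect \<gamma> \<beta> = \<beta> + fun_scale (of_int (- cartan_int \<beta> \<gamma>)) \<gamma>"

lemma reflect_root:
  assumes \<gamma>: "\<gamma> \<in> roots T" and \<beta>: "\<beta> \<in> roots T"
  shows "reflect \<gamma> \<beta> \<in> roots T"
proof -
  consider "\<beta> = \<gamma>" | "\<beta> = - \<gamma>" | "\<beta> \<noteq> \<gamma>" "\<beta> \<noteq> - \<gamma>" by blast
  then show ?thesis
  proof cases
    case 1
    have "reflect \<gamma> \<gamma> = - \<gamma>" using cartan_int_self[OF \<gamma>] by (simp add: reflect_def fun_eq_iff)
    then show ?thesis using root_uminus[OF \<gamma>] 1 by simp
  next
    case 2
    have "reflect \<gamma> (- \<gamma>) = \<gamma>"
      using cartan_int_self[OF \<gamma>] cartan_int_uminus[OF \<gamma> \<gamma>] by (simp add: reflect_def fun_eq_iff)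
    then show ?thesis using \<gamma> 2 by simp
  next
    case 3
    obtain p q :: int where pq: "0 \<le> p" "0 \<le> q" "cartan_int \<beta> \<gamma> = q - p"
      "\<And>n. - q \<le> n \<Longrightarrow> n \<le> p \<Longrightarrow> \<beta> + fun_scale (of_int n) \<gamma> \<in> roots T"
      by (rule cartan_string[OF \<gamma> \<beta> 3]) blast
    show ?thesis unfolding reflect_def using pq(1-3) by (intro pq(4)) auto
  qed
qed

lemma form_reflect:
  assumes \<gamma>: "\<gamma> \<in> roots T" and \<beta>: "\<beta> \<in> roots T"
  shows "form T (reflect \<gamma> \<beta>) \<gamma> = - form T \<beta> \<gamma>"
proof -
  note d = root_in_dual[OF \<gamma>] root_in_dual[OF \<beta>]
  have "form T (reflect \<gamma> \<beta>) \<gamma> = form T \<beta> \<gamma> - of_int (cartan_int \<beta> \<gamma>) * form T \<gamma> \<gamma>"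
    unfolding reflect_def form_add_left[OF d(2) scale_in_dual[OF d(1)] d(1)]
      form_scale_left[OF d(1) d(1)] by simp
  then show ?thesis using cartan_int[OF assms, symmetric] by simp
qed

lemma reflect_reflect:
  assumes \<gamma>: "\<gamma> \<in> roots T" and \<beta>: "\<beta> \<in> roots T"
  shows "reflect \<gamma> (reflect \<gamma> \<beta>) = \<beta>"
proof -
  have "cartan_int (reflect \<gamma> \<beta>) \<gamma> = - cartan_int \<beta> \<gamma>"
    using form_reflect[OF assms] cartan_int[OF assms] by (intro cartan_int_eqI \<gamma>) simp
  then show ?thesis by (simp add: reflect_def[of \<gamma> "reflect \<gamma> \<beta>"]) (simp add: reflect_def fun_eq_iff)
qed

text \<open>The reflection permutes \<open>S\<close> and changes the sign of \<open>(\<beta>, \<gamma>)\<close>.\<close>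

lemma sum_form_reflection_invariant:
  assumes \<gamma>: "\<gamma> \<in> roots T" and S: "S \<subseteq> roots T" "\<And>\<beta>. \<beta> \<in> S \<Longrightarrow> reflect \<gamma> \<beta> \<in> S"
  shows "(\<Sum>\<beta>\<in>S. form T \<beta> \<gamma>) = 0"
proof -
  have rr: "reflect \<gamma> (reflect \<gamma> \<beta>) = \<beta>" if "\<beta> \<in> S" for \<beta>
    using reflect_reflect[OF \<gamma>] S(1) that by blast
  have "(\<Sum>\<beta>\<in>S. form T \<beta> \<gamma>) = (\<Sum>\<beta>\<in>S. form T (reflect \<gamma> \<beta>) \<gamma>)"
    by (rule sum.reindex_bij_witness[of _ "reflect \<gamma>" "reflect \<gamma>"]) (simp_all add: rr S(2))
  also have "\<dots> = - (\<Sum>\<beta>\<in>S. form T \<beta> \<gamma>)"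
    using form_reflect[OF \<gamma>] S(1) by (simp add: subset_iff sum_negf[symmetric])
  finally show ?thesis by (simp add: eq_neg_iff_add_eq_0)
qed

lemma root_diff:
  assumes \<gamma>: "\<gamma> \<in> roots T" and \<beta>: "\<beta> \<in> roots T" and a: "cartan_int \<beta> \<gamma> > 0" and ne: "\<beta> \<noteq> \<gamma>"
  shows "\<beta> - \<gamma> \<in> roots T"
proof -
  have "\<beta> \<noteq> - \<gamma>" using a cartan_int_self[OF \<gamma>] cartan_int_uminus[OF \<gamma> \<gamma>] by auto
  then obtain p q :: int where pq: "0 \<le> p" "0 \<le> q" "cartan_int \<beta> \<gamma> = q - p"
    "\<And>n. - q \<le> n \<Longrightarrow> n \<le> p \<Longrightarrow> \<beta> + fun_scale (of_int n) \<gamma> \<in> roots T"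
    by (rule cartan_string[OF \<gamma> \<beta> ne]) blast
  have "\<beta> + fun_scale (of_int (-1)) \<gamma> \<in> roots T" using pq(1-3) a by (intro pq(4)) auto
  moreover have "\<beta> + fun_scale (of_int (-1)) \<gamma> = \<beta> - \<gamma>" by (simp add: fun_eq_iff)
  ultimately show ?thesis by simp
qed

lemma root_add:
  assumes \<gamma>: "\<gamma> \<in> roots T" and \<beta>: "\<beta> \<in> roots T" and a: "cartan_int \<beta> \<gamma> < 0" and ne: "\<beta> \<noteq> - \<gamma>"
  shows "\<beta> + \<gamma> \<in> roots T"
proof -
  have "- \<beta> \<noteq> \<gamma>" using ne by auto
  then have "- \<beta> - \<gamma> \<in> roots T"
    using root_diff[OF \<gamma> root_uminus[OF \<beta>]] a cartan_int_uminus[OF \<gamma> \<beta>] by simp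
  from root_uminus[OF this] show ?thesis by (simp add: add.commute)
qed

text \<open>From \<open>(\<gamma>, \<gamma>) = \<Sum>\<beta>. (\<beta>, \<gamma>)\<^sup>2\<close> and \<open>2 (\<beta>, \<gamma>) \<in> \<int> (\<gamma>, \<gamma>)\<close>, the number \<open>4 / (\<gamma>, \<gamma>)\<close> is a sum of
  squares of integers.\<close>

lemma form_root_positive:
  assumes \<gamma>: "\<gamma> \<in> roots T"
  obtains N :: int where "N > 0" "form T \<gamma> \<gamma> * of_int N = 4"
proof
  note \<gamma>d = root_in_dual[OF \<gamma>]
  let ?N = "\<Sum>\<beta>\<in>roots T. (cartan_int \<beta> \<gamma>)\<^sup>2"
  show "?N > 0"
    using finite_roots \<gamma> cartan_int_self[OF \<gamma>] by (intro sum_pos2[of _ \<gamma>]) auto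
  have "4 * form T \<gamma> \<gamma> = (\<Sum>\<beta>\<in>roots T. (2 * form T \<beta> \<gamma>)\<^sup>2)"
    by (subst form_sum_roots[OF \<gamma>d \<gamma>d]) (simp add: sum_distrib_left power2_eq_square mult.assoc)
  also have "\<dots> = of_int ?N * (form T \<gamma> \<gamma>)\<^sup>2"
    using cartan_int[OF \<gamma>] by (simp add: power_mult_distrib sum_distrib_right)
  finally have "form T \<gamma> \<gamma> * (form T \<gamma> \<gamma> * of_int ?N) = form T \<gamma> \<gamma> * 4"
    by (simp add: power2_eq_square algebra_simps)
  then show "form T \<gamma> \<gamma> * of_int ?N = 4" using form_root_nonzero[OF \<gamma>] by simp
qed

text \<open>The form is rational on roots; its signs make sense only there, since the ground field is not ordered.\<close>

definition rat_form :: "('g \<Rightarrow> 'k) \<Rightarrow> ('g \<Rightarrow> 'k) \<Rightarrow> rat" where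
  "rat_form \<beta> \<gamma> = (THE r. of_rat r = form T \<beta> \<gamma>)"

lemma rat_form_cartan:
  assumes \<gamma>: "\<gamma> \<in> roots T" and \<beta>: "\<beta> \<in> roots T"
  obtains r :: rat where "r > 0" "rat_form \<beta> \<gamma> = of_int (cartan_int \<beta> \<gamma>) * r" "of_rat (rat_form \<beta> \<gamma>) = form T \<beta> \<gamma>"
proof -
  obtain N :: int where N: "N > 0" "form T \<gamma> \<gamma> * of_int N = 4" by (rule form_root_positive[OF \<gamma>])
  define r :: rat where "r = 2 / of_int N"
  have "(of_int N :: 'k) \<noteq> 0" using N(1) by simp
  then have "form T \<gamma> \<gamma> = 4 / of_int N" using N(2) by (simp add: eq_divide_eq)
  then have "2 * form T \<beta> \<gamma> = 2 * (of_int (cartan_int \<beta> \<gamma>) * (2 / of_int N))"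
    using cartan_int[OF assms] by simp
  then have "form T \<beta> \<gamma> = of_int (cartan_int \<beta> \<gamma>) * (2 / of_int N)"
    by (simp only: mult_cancel_left) simp
  then have "of_rat (of_int (cartan_int \<beta> \<gamma>) * r) = form T \<beta> \<gamma>"
    by (simp add: r_def of_rat_mult of_rat_divide)
  moreover from this have "rat_form \<beta> \<gamma> = of_int (cartan_int \<beta> \<gamma>) * r"
    unfolding rat_form_def by (intro the_equality) (auto simp flip: of_rat_eq_iff[where 'a = 'k])
  ultimately show thesis using that[of r] N(1) by (simp add: r_def)
qed

lemma of_rat_form: "\<beta> \<in> roots T \<Longrightarrow> \<gamma> \<in> roots T \<Longrightarrow> of_rat (rat_form \<beta> \<gamma>) = form T \<beta> \<gamma>"
  by (rule rat_form_cartan[of \<gamma> \<beta>]) auto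

lemma
  assumes \<beta>: "\<beta> \<in> roots T" and \<gamma>: "\<gamma> \<in> roots T"
  shows rat_form_pos_iff: "rat_form \<beta> \<gamma> > 0 \<longleftrightarrow> cartan_int \<beta> \<gamma> > 0"
    and rat_form_neg_iff: "rat_form \<beta> \<gamma> < 0 \<longleftrightarrow> cartan_int \<beta> \<gamma> < 0"
proof -
  obtain r where r: "r > 0" "rat_form \<beta> \<gamma> = of_int (cartan_int \<beta> \<gamma>) * r"
    by (rule rat_form_cartan[OF \<gamma> \<beta>])
  show "rat_form \<beta> \<gamma> > 0 \<longleftrightarrow> cartan_int \<beta> \<gamma> > 0" "rat_form \<beta> \<gamma> < 0 \<longleftrightarrow> cartan_int \<beta> \<gamma> < 0"
    using r by (simp_all add: zero_less_mult_iff mult_less_0_iff)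
qed

lemma rat_form_sym: "rat_form \<beta> \<gamma> = rat_form \<gamma> \<beta>"
  by (simp add: rat_form_def form_sym)

end

section \<open>Heights\<close>

context based_simple_lie_algebra
begin

lemma P_root: "\<beta> \<in> P \<Longrightarrow> \<beta> \<in> roots T"
  using P_roots by blast

lemma representation_add_scale:
  assumes "\<gamma> \<in> dual T" "\<delta> \<in> dual T"
  shows "weights.representation P (\<gamma> + fun_scale c \<delta>) \<beta> =
    weights.representation P \<gamma> \<beta> + c * weights.representation P \<delta> \<beta>"
  using assms independent_P span_P
  by (simp add: weights.representation_add weights.representation_scale scale_in_dual)

lemma ht_eqI: "of_int m = weights.representation P \<gamma> \<beta> \<Longrightarrow> ht \<beta> \<gamma> = m"
  unfolding ht_def by (rule the_equality) (auto simp flip: of_int_eq_iff[where 'a = 'k])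

lemma representation_combination:
  assumes "\<beta> \<in> P"
  shows "weights.representation P (\<Sum>\<delta>\<in>P. fun_scale (c \<delta>) \<delta>) \<beta> = c \<beta>"
proof -
  have "weights.representation P (\<Sum>\<delta>\<in>P. fun_scale (c \<delta>) \<delta>) \<beta> =
      (\<Sum>\<delta>\<in>P. c \<delta> * weights.representation P \<delta> \<beta>)"
    using independent_P P_in_dual span_P
    by (simp add: weights.representation_sum weights.representation_scale scale_in_dual)
  also have "\<dots> = (\<Sum>\<delta>\<in>P. if \<delta> = \<beta> then c \<beta> else 0)"
    using independent_P by (intro sum.cong refl) (simp add: weights.representation_basis)
  also have "\<dots> = c \<beta>" using finite_P assms by simp
  finally show ?thesis .
qed

lemma root_heights:
  assumes \<gamma>: "\<gamma> \<in> roots T"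
  obtains s :: int and n :: "('g \<Rightarrow> 'k) \<Rightarrow> nat" where "s = 1 \<or> s = -1"
    "\<And>\<beta>. \<beta> \<in> P \<Longrightarrow> ht \<beta> \<gamma> = s * int (n \<beta>)"
    "\<And>\<beta>. \<beta> \<in> P \<Longrightarrow> weights.representation P \<gamma> \<beta> = of_int (ht \<beta> \<gamma>)"
    "\<gamma> = (\<Sum>\<beta>\<in>P. fun_scale (of_int (ht \<beta> \<gamma>)) \<beta>)"
proof -
  obtain n s where s: "s = 1 \<or> s = -1" and g: "\<gamma> = (\<Sum>\<beta>\<in>P. fun_scale (of_int (s * int (n \<beta>))) \<beta>)"
    by (rule root_coefficients[OF \<gamma>])
  have rep: "weights.representation P \<gamma> \<beta> = of_int (s * int (n \<beta>))" if "\<beta> \<in> P" for \<beta>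
    by (subst g) (rule representation_combination[OF that])
  have ht: "ht \<beta> \<gamma> = s * int (n \<beta>)" if "\<beta> \<in> P" for \<beta>
    by (rule ht_eqI) (simp only: rep[OF that])
  have "\<gamma> = (\<Sum>\<beta>\<in>P. fun_scale (of_int (ht \<beta> \<gamma>)) \<beta>)"
    by (subst g, intro sum.cong refl) (simp only: ht)
  then show thesis using that[OF s ht] rep ht by simp
qed

lemma representation_ht: "\<gamma> \<in> roots T \<Longrightarrow> \<beta> \<in> P \<Longrightarrow> weights.representation P \<gamma> \<beta> = of_int (ht \<beta> \<gamma>)"
  by (rule root_heights)

lemma ht_expand: "\<gamma> \<in> roots T \<Longrightarrow> \<gamma> = (\<Sum>\<beta>\<in>P. fun_scale (of_int (ht \<beta> \<gamma>)) \<beta>)"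
  by (rule root_heights)

lemma ht_sign:
  assumes "\<gamma> \<in> roots T"
  shows "(\<forall>\<beta>\<in>P. 0 \<le> ht \<beta> \<gamma>) \<or> (\<forall>\<beta>\<in>P. ht \<beta> \<gamma> \<le> 0)"
  by (rule root_heights[OF assms]) auto

lemma ht_mixed_signs:
  assumes "\<beta> \<in> P" "\<delta> \<in> P" "ht \<beta> \<gamma> < 0" "0 < ht \<delta> \<gamma>"
  shows "\<gamma> \<notin> roots T"
  using ht_sign[of \<gamma>] assms by force

lemma ht_add_scale:
  assumes "\<gamma> \<in> roots T" "\<delta> \<in> roots T" "\<beta> \<in> P"
  shows "ht \<beta> (\<gamma> + fun_scale (of_int n) \<delta>) = ht \<beta> \<gamma> + n * ht \<beta> \<delta>"
  by (rule ht_eqI) (use assms in \<open>simp add: representation_add_scale root_in_dual representation_ht\<close>)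

lemma ht_add: "\<gamma> \<in> roots T \<Longrightarrow> \<delta> \<in> roots T \<Longrightarrow> \<beta> \<in> P \<Longrightarrow> ht \<beta> (\<gamma> + \<delta>) = ht \<beta> \<gamma> + ht \<beta> \<delta>"
  using ht_add_scale[of \<gamma> \<delta> \<beta> 1] by simp

lemma ht_diff: "\<gamma> \<in> roots T \<Longrightarrow> \<delta> \<in> roots T \<Longrightarrow> \<beta> \<in> P \<Longrightarrow> ht \<beta> (\<gamma> - \<delta>) = ht \<beta> \<gamma> - ht \<beta> \<delta>"
  using ht_add_scale[of \<gamma> \<delta> \<beta> "-1"] by simp

lemma ht_uminus:
  assumes "\<gamma> \<in> roots T" "\<beta> \<in> P"
  shows "ht \<beta> (- \<gamma>) = - ht \<beta> \<gamma>"
proof -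
  have "\<gamma> + fun_scale (of_int (-2)) \<gamma> = - \<gamma>" by (simp add: fun_eq_iff)
  then have "ht \<beta> (- \<gamma>) = ht \<beta> \<gamma> + (-2) * ht \<beta> \<gamma>" using ht_add_scale[OF assms(1,1,2), of "-2"] by metis
  then show ?thesis by simp
qed

lemma ht_simple: "\<beta> \<in> P \<Longrightarrow> \<delta> \<in> P \<Longrightarrow> ht \<beta> \<delta> = (if \<beta> = \<delta> then 1 else 0)"
  by (rule ht_eqI) (simp add: weights.representation_basis independent_P)

lemma root_eqI:
  assumes "\<gamma> \<in> roots T" "\<delta> \<in> roots T" "\<And>\<beta>. \<beta> \<in> P \<Longrightarrow> ht \<beta> \<gamma> = ht \<beta> \<delta>"
  shows "\<gamma> = \<delta>"
proof -
  have "\<gamma> = (\<Sum>\<beta>\<in>P. fun_scale (of_int (ht \<beta> \<gamma>)) \<beta>)" by (rule ht_expand[OF assms(1)])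
  also have "\<dots> = (\<Sum>\<beta>\<in>P. fun_scale (of_int (ht \<beta> \<delta>)) \<beta>)"
    using assms(3) by (intro sum.cong refl) simp
  also have "\<dots> = \<delta>" by (rule ht_expand[OF assms(2), symmetric])
  finally show ?thesis .
qed

lemma ht_nonzero:
  assumes "\<gamma> \<in> roots T"
  obtains \<beta> where "\<beta> \<in> P" "ht \<beta> \<gamma> \<noteq> 0"
proof (rule ccontr)
  assume "\<not> thesis"
  then have "\<forall>\<beta>\<in>P. ht \<beta> \<gamma> = 0" using that by blast
  then have "\<gamma> = (\<Sum>\<beta>\<in>P. 0)" by (subst ht_expand[OF assms]) (auto intro!: sum.cong simp: fun_eq_iff)
  then show False using assms by (simp add: root_iff)
qed

lemma form_root_left:
  assumes \<gamma>: "\<gamma> \<in> roots T" and \<nu>: "\<nu> \<in> dual T"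
  shows "form T \<gamma> \<nu> = (\<Sum>\<beta>\<in>P. of_int (ht \<beta> \<gamma>) * form T \<beta> \<nu>)"
proof -
  have "form T \<gamma> \<nu> = form T (\<Sum>\<beta>\<in>P. fun_scale (of_int (ht \<beta> \<gamma>)) \<beta>) \<nu>"
    using ht_expand[OF \<gamma>] by simp
  then show ?thesis
    using \<nu> P_in_dual by (simp add: form_sum_left scale_in_dual form_scale_left)
qed

lemma rat_form_root_left:
  assumes \<gamma>: "\<gamma> \<in> roots T" and \<delta>: "\<delta> \<in> roots T"
  shows "rat_form \<gamma> \<delta> = (\<Sum>\<beta>\<in>P. of_int (ht \<beta> \<gamma>) * rat_form \<beta> \<delta>)"
proof -
  have "(of_rat (rat_form \<gamma> \<delta>) :: 'k) = of_rat (\<Sum>\<beta>\<in>P. of_int (ht \<beta> \<gamma>) * rat_form \<beta> \<delta>)"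
    using form_root_left[OF \<gamma> root_in_dual[OF \<delta>]] of_rat_form[OF \<gamma> \<delta>] of_rat_form[OF P_root \<delta>]
    by (simp add: of_rat_sum of_rat_mult)
  then show ?thesis by simp
qed

lemma rat_form_self_positive: "\<gamma> \<in> roots T \<Longrightarrow> rat_form \<gamma> \<gamma> > 0"
  by (simp add: rat_form_pos_iff cartan_int_self)

text \<open>Otherwise \<open>\<beta> - \<delta>\<close> would be a root with coefficients of both signs.\<close>

lemma rat_form_simple_nonpos:
  assumes "\<beta> \<in> P" "\<delta> \<in> P" "\<beta> \<noteq> \<delta>"
  shows "rat_form \<beta> \<delta> \<le> 0"
proof (rule ccontr)
  assume "\<not> rat_form \<beta> \<delta> \<le> 0"
  then have "cartan_int \<beta> \<delta> > 0"
    using rat_form_pos_iff[OF P_root[OF assms(1)] P_root[OF assms(2)]] by simp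
  then have "\<beta> - \<delta> \<in> roots T" using assms by (intro root_diff P_root)
  moreover have "ht \<beta> (\<beta> - \<delta>) = 1" "ht \<delta> (\<beta> - \<delta>) = -1"
    using assms by (simp_all add: ht_diff P_root ht_simple)
  ultimately show False using ht_mixed_signs[of \<delta> \<beta> "\<beta> - \<delta>"] assms by simp
qed

end

section \<open>The highest root\<close>

context based_simple_lie_algebra
begin

abbreviation vanishes_on :: "('g \<Rightarrow> 'k) set \<Rightarrow> ('g \<Rightarrow> 'k) \<Rightarrow> bool" where
  "vanishes_on Q \<gamma> \<equiv> \<forall>\<beta>\<in>Q. ht \<beta> \<gamma> = 0"

text \<open>If \<open>\<delta>\<close> is supported on simple roots orthogonal to \<open>\<beta>\<close>, then the \<open>\<beta>\<close>-string through \<open>\<delta>\<close> is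
  symmetric about \<open>\<delta>\<close>, and \<open>\<delta> - \<beta>\<close> is excluded by its signs.\<close>

lemma orthogonal_sum_not_root:
  assumes \<beta>: "\<beta> \<in> P" and \<delta>: "\<delta> \<in> roots T" "ht \<beta> \<delta> = 0" "\<forall>\<beta>'\<in>P. 0 \<le> ht \<beta>' \<delta>"
    and orth: "\<And>\<beta>'. \<beta>' \<in> P \<Longrightarrow> ht \<beta>' \<delta> \<noteq> 0 \<Longrightarrow> form T \<beta>' \<beta> = 0"
  shows "\<delta> + \<beta> \<notin> roots T"
proof
  assume sum: "\<delta> + \<beta> \<in> roots T"
  note \<beta>r = P_root[OF \<beta>]
  have "ht \<beta> \<beta> = 1" "ht \<beta> (- \<beta>) = -1" using \<beta> \<beta>r by (simp_all add: ht_simple ht_uminus)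
  then have ne: "\<delta> \<noteq> \<beta>" "\<delta> \<noteq> - \<beta>" using \<delta>(2) by auto
  have "form T \<delta> \<beta> = 0"
    unfolding form_root_left[OF \<delta>(1) root_in_dual[OF \<beta>r]]
    using orth by (intro sum.neutral) (auto simp: mult_eq_0_iff)
  then have a: "cartan_int \<delta> \<beta> = 0" by (intro cartan_int_eqI[OF \<beta>r]) simp
  obtain p q :: int where pq: "0 \<le> p" "0 \<le> q" "cartan_int \<delta> \<beta> = q - p"
    "\<And>n. - q \<le> n \<Longrightarrow> n \<le> p \<Longrightarrow> \<delta> + fun_scale (of_int n) \<beta> \<in> roots T"
    "\<delta> + fun_scale (of_int (p + 1)) \<beta> \<notin> roots T"
    by (rule cartan_string[OF \<beta>r \<delta>(1) ne]) blast
  have "p \<noteq> 0" using pq(5) sum by (intro notI) simp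
  then have "\<delta> + fun_scale (of_int (-1)) \<beta> \<in> roots T" using pq(1-3) a by (intro pq(4)) auto
  moreover obtain \<beta>' where "\<beta>' \<in> P" "ht \<beta>' \<delta> \<noteq> 0" by (rule ht_nonzero[OF \<delta>(1)])
  moreover have "ht \<beta> (\<delta> + fun_scale (of_int (-1)) \<beta>) = -1"
    using \<beta> \<beta>r \<delta> by (subst ht_add_scale) (simp_all add: ht_simple)
  moreover have "ht \<beta>' (\<delta> + fun_scale (of_int (-1)) \<beta>) > 0"
    using \<open>\<beta>' \<in> P\<close> \<open>ht \<beta>' \<delta> \<noteq> 0\<close> \<beta> \<beta>r \<delta> by (subst ht_add_scale) (auto simp: ht_simple order_less_le)
  ultimately show False using ht_mixed_signs[OF \<beta>, of \<beta>' "\<delta> + fun_scale (of_int (-1)) \<beta>"] by simp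
qed

text \<open>The positive number \<open>(\<gamma>, \<gamma>) = \<Sum>\<beta>. ht\<^sub>\<beta>(\<gamma>) (\<beta>, \<gamma>)\<close> has a positive summand.\<close>

lemma simple_root_descent:
  assumes \<gamma>: "\<gamma> \<in> roots T" "\<forall>\<beta>\<in>P. 0 \<le> ht \<beta> \<gamma>"
  obtains \<beta> where "\<beta> \<in> P" "0 < ht \<beta> \<gamma>" "0 < cartan_int \<gamma> \<beta>"
proof -
  have "\<exists>\<beta>\<in>P. of_int (ht \<beta> \<gamma>) * rat_form \<beta> \<gamma> > 0"
  proof (rule ccontr)
    assume "\<not> ?thesis"
    then have "(\<Sum>\<beta>\<in>P. of_int (ht \<beta> \<gamma>) * rat_form \<beta> \<gamma>) \<le> 0" by (intro sum_nonpos) (auto simp: not_less)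
    then show False
      using rat_form_self_positive[OF \<gamma>(1)] rat_form_root_left[OF \<gamma>(1) \<gamma>(1)] by simp
  qed
  then obtain \<beta> where \<beta>: "\<beta> \<in> P" "of_int (ht \<beta> \<gamma>) * rat_form \<beta> \<gamma> > 0" by blast
  then have "0 < ht \<beta> \<gamma>" "0 < rat_form \<gamma> \<beta>"
    using \<gamma>(2) rat_form_sym[of \<beta> \<gamma>] by (auto simp: zero_less_mult_iff)
  then show thesis using that[OF \<beta>(1)] rat_form_pos_iff[OF \<gamma>(1) P_root[OF \<beta>(1)]] by simp
qed

text \<open>Induction on the height: subtracting a simple root \<open>\<beta>\<close> leaves a root \<open>\<delta>\<close> that is supported on one
  part, and \<open>\<delta> + \<beta>\<close> can only be a root if \<open>\<beta>\<close> belongs to the same part.\<close>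

lemma orthogonal_support_positive:
  assumes PQ: "P = P1 \<union> P2" "P1 \<inter> P2 = {}"
    and orth: "\<And>\<beta> \<delta>. \<beta> \<in> P1 \<Longrightarrow> \<delta> \<in> P2 \<Longrightarrow> form T \<beta> \<delta> = 0"
    and \<gamma>: "\<gamma> \<in> roots T" "\<forall>\<beta>\<in>P. 0 \<le> ht \<beta> \<gamma>"
  shows "vanishes_on P1 \<gamma> \<or> vanishes_on P2 \<gamma>"
  using \<gamma>
proof (induction "nat (\<Sum>\<beta>\<in>P. ht \<beta> \<gamma>)" arbitrary: \<gamma> rule: less_induct)
  case less
  obtain \<beta> where \<beta>: "\<beta> \<in> P" "0 < ht \<beta> \<gamma>" "0 < cartan_int \<gamma> \<beta>" by (rule simple_root_descent[OF less.prems])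
  show ?case
  proof (cases "\<gamma> = \<beta>")
    case True
    then have "\<forall>\<beta>'\<in>P. \<beta>' \<noteq> \<beta> \<longrightarrow> ht \<beta>' \<gamma> = 0" using \<beta>(1) by (simp add: ht_simple)
    moreover have "\<beta> \<notin> P1 \<or> \<beta> \<notin> P2" using PQ(2) by blast
    moreover have "P1 \<subseteq> P" "P2 \<subseteq> P" using PQ(1) by blast+
    ultimately show ?thesis by (cases "\<beta> \<in> P1") auto
  next
    case False
    define \<delta> where "\<delta> = \<gamma> - \<beta>"
    have \<delta>: "\<delta> \<in> roots T" unfolding \<delta>_def by (rule root_diff[OF P_root[OF \<beta>(1)] less.prems(1) \<beta>(3) False])
    have ht\<delta>: "ht \<beta>' \<delta> = ht \<beta>' \<gamma> - (if \<beta>' = \<beta> then 1 else 0)" if "\<beta>' \<in> P" for \<beta>'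
      unfolding \<delta>_def using that \<beta>(1) less.prems(1) by (simp add: ht_diff P_root ht_simple)
    have pos: "\<forall>\<beta>'\<in>P. 0 \<le> ht \<beta>' \<delta>" using ht\<delta> less.prems(2) \<beta>(2) by auto
    have "(\<Sum>\<beta>'\<in>P. ht \<beta>' \<delta>) = (\<Sum>\<beta>'\<in>P. ht \<beta>' \<gamma>) - 1"
      using ht\<delta> finite_P \<beta>(1) by (simp add: sum_subtractf)
    moreover have "0 \<le> (\<Sum>\<beta>'\<in>P. ht \<beta>' \<delta>)" using pos by (intro sum_nonneg) auto
    ultimately have IH: "vanishes_on P1 \<delta> \<or> vanishes_on P2 \<delta>" using \<delta> pos by (intro less.hyps) auto
    have \<gamma>\<delta>: "\<delta> + \<beta> \<in> roots T" using less.prems(1) by (simp add: \<delta>_def)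
    have main: "vanishes_on Q2 \<gamma>"
      if Q: "P = Q1 \<union> Q2" "Q1 \<inter> Q2 = {}" "\<And>\<beta> \<delta>. \<beta> \<in> Q1 \<Longrightarrow> \<delta> \<in> Q2 \<Longrightarrow> form T \<beta> \<delta> = 0"
        and "\<beta> \<in> Q1" and v: "vanishes_on Q1 \<delta> \<or> vanishes_on Q2 \<delta>" for Q1 Q2
    proof (cases "vanishes_on Q2 \<delta>")
      case True
      have "ht \<beta>' \<gamma> = ht \<beta>' \<delta>" if "\<beta>' \<in> Q2" for \<beta>'
      proof -
        have "\<beta>' \<in> P" "\<beta>' \<noteq> \<beta>" using that Q(1,2) \<open>\<beta> \<in> Q1\<close> by blast+
        then show ?thesis using ht\<delta> by simp
      qed
      then show ?thesis using True by simp
    next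
      case False
      then have "vanishes_on Q1 \<delta>" using v by blast
      then have "\<delta> + \<beta> \<notin> roots T"
        using \<beta>(1) \<delta> pos Q \<open>\<beta> \<in> Q1\<close> form_sym[of _ \<beta>] by (intro orthogonal_sum_not_root) auto
      then show ?thesis using \<gamma>\<delta> by blast
    qed
    show ?thesis
    proof (cases "\<beta> \<in> P1")
      case True
      then show ?thesis using main[OF PQ orth] IH by blast
    next
      case False
      then have "\<beta> \<in> P2" using PQ \<beta>(1) by blast
      moreover have "P = P2 \<union> P1" "P2 \<inter> P1 = {}" using PQ by auto
      moreover have "form T \<delta> \<beta> = 0" if "\<delta> \<in> P2" "\<beta> \<in> P1" for \<delta> \<beta> using orth[OF that(2,1)] form_sym by simp
      ultimately have "vanishes_on P1 \<gamma>" using IH by (intro main) auto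
      then show ?thesis by blast
    qed
  qed
qed

lemma orthogonal_support:
  assumes PQ: "P = P1 \<union> P2" "P1 \<inter> P2 = {}"
    and orth: "\<And>\<beta> \<delta>. \<beta> \<in> P1 \<Longrightarrow> \<delta> \<in> P2 \<Longrightarrow> form T \<beta> \<delta> = 0"
    and \<gamma>: "\<gamma> \<in> roots T"
  shows "vanishes_on P1 \<gamma> \<or> vanishes_on P2 \<gamma>"
proof -
  consider "\<forall>\<beta>\<in>P. 0 \<le> ht \<beta> \<gamma>" | "\<forall>\<beta>\<in>P. ht \<beta> \<gamma> \<le> 0" using ht_sign[OF \<gamma>] by blast
  then show ?thesis
  proof cases
    case 1
    then show ?thesis using orthogonal_support_positive[OF PQ _ \<gamma>] orth by blast
  next
    case 2
    then have "\<forall>\<beta>\<in>P. 0 \<le> ht \<beta> (- \<gamma>)" using ht_uminus[OF \<gamma>] by simp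
    then have "vanishes_on P1 (- \<gamma>) \<or> vanishes_on P2 (- \<gamma>)"
      using orthogonal_support_positive[OF PQ _ root_uminus[OF \<gamma>]] orth by blast
    then show ?thesis using ht_uminus[OF \<gamma>] PQ by auto
  qed
qed

text \<open>The Dynkin diagram is connected: otherwise the centralizer of the root spaces that belong to one
  part would be a proper nonzero ideal.\<close>

lemma simple_roots_connected:
  assumes PQ: "P = P1 \<union> P2" "P1 \<inter> P2 = {}" and ne: "P1 \<noteq> {}" "P2 \<noteq> {}"
  obtains \<beta> \<delta> where "\<beta> \<in> P1" "\<delta> \<in> P2" "form T \<beta> \<delta> \<noteq> 0"
proof (rule ccontr)
  assume "\<not> thesis"
  then have orth: "\<And>\<beta> \<delta>. \<beta> \<in> P1 \<Longrightarrow> \<delta> \<in> P2 \<Longrightarrow> form T \<beta> \<delta> = 0" using that by blast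
  have supp: "vanishes_on P1 \<gamma> \<or> vanishes_on P2 \<gamma>" if "\<gamma> \<in> roots T" for \<gamma>
    using orthogonal_support[OF PQ _ that] orth by blast
  define D where "D = {\<gamma> \<in> roots T. vanishes_on P1 \<gamma>}"
  define I where "I = {x. \<forall>\<gamma>\<in>D. \<forall>y\<in>weight_space \<gamma>. bracket x y = 0}"
  have commute: "bracket z y = 0"
    if \<delta>: "\<delta> \<in> roots T" "\<delta> \<notin> D" and \<gamma>: "\<gamma> \<in> D" and z: "z \<in> weight_space \<delta>" and y: "y \<in> weight_space \<gamma>"
    for z y \<gamma> \<delta>
  proof -
    have \<gamma>r: "\<gamma> \<in> roots T" "vanishes_on P1 \<gamma>" using \<gamma> by (auto simp: D_def)
    obtain \<beta>1 where \<beta>1: "\<beta>1 \<in> P1" "ht \<beta>1 \<delta> \<noteq> 0" using \<delta> by (auto simp: D_def)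
    then have "vanishes_on P2 \<delta>" using supp[OF \<delta>(1)] by blast
    obtain \<beta>2 where "\<beta>2 \<in> P" "ht \<beta>2 \<gamma> \<noteq> 0" by (rule ht_nonzero[OF \<gamma>r(1)])
    then have \<beta>2: "\<beta>2 \<in> P2" "ht \<beta>2 \<gamma> \<noteq> 0" using \<gamma>r(2) PQ(1) by auto
    have "\<beta>1 \<in> P" "\<beta>2 \<in> P" using \<beta>1(1) \<beta>2(1) PQ(1) by blast+
    then have h: "ht \<beta>1 (\<delta> + \<gamma>) \<noteq> 0" "ht \<beta>2 (\<delta> + \<gamma>) \<noteq> 0"
      using \<beta>1 \<beta>2 \<gamma>r \<open>vanishes_on P2 \<delta>\<close> \<delta>(1) by (simp_all add: ht_add)
    have "\<delta> + \<gamma> \<notin> roots T" using supp[of "\<delta> + \<gamma>"] \<beta>1(1) \<beta>2(1) h by blast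
    moreover have "\<delta> + \<gamma> \<noteq> 0"
    proof
      assume "\<delta> + \<gamma> = 0"
      then have "\<gamma> = - \<delta>" by (simp add: add_eq_0_iff)
      then have "ht \<beta>1 \<gamma> = - ht \<beta>1 \<delta>" using ht_uminus[OF \<delta>(1)] \<beta>1(1) PQ(1) by simp
      then show False using \<beta>1 \<gamma>r(2) by simp
    qed
    ultimately show ?thesis
      using weight_space_trivial[OF add_in_dual[OF root_in_dual[OF \<delta>(1)] root_in_dual[OF \<gamma>r(1)]]]
        bracket_weight_space[OF z y] by blast
  qed
  have "ideal I"
    unfolding ideal_def
  proof (intro conjI allI ballI)
    show I: "subspace I"
      unfolding I_def
      by (rule subspaceI) (auto simp: bracket_zero_left bracket_add_left bracket_scale_left)
    fix z x assume x: "x \<in> I"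
    obtain B wt where B: "weight_basis B wt" by (rule exists_weight_basis)
    have "bracket b x \<in> I" if b: "b \<in> B" for b
    proof -
      note bw = weight_basis_weight[OF B b]
      have "bracket (bracket b x) y = 0" if \<gamma>: "\<gamma> \<in> D" and y: "y \<in> weight_space \<gamma>" for \<gamma> y
      proof -
        have xy: "bracket x y = 0" using x \<gamma> y by (auto simp: I_def)
        consider "wt b = 0" | "wt b \<in> D" | "wt b \<in> roots T" "wt b \<notin> D"
          using weight_basis_root_iff[OF B, of "wt b"] b by blast
        then show ?thesis
        proof cases
          case 1
          then have "bracket b y = \<gamma> b *s y" using bw weight_space_0 weight_spaceD[OF y] by simp
          then show ?thesis by (simp add: bracket_bracket_left xy bracket_zero_right bracket_scale_right)
        next
          case 2
          then have "bracket x b = 0" using x bw by (auto simp: I_def)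
          then have "bracket b x = 0" using bracket_skew[of b x] by simp
          then show ?thesis by (simp add: bracket_zero_left)
        next
          case 3
          then have "bracket b y = 0" using commute[OF 3 \<gamma> bw y] by simp
          then show ?thesis by (simp add: bracket_bracket_left xy bracket_zero_right)
        qed
      qed
      then show ?thesis by (auto simp: I_def)
    qed
    then show "bracket z x \<in> I"
      by (rule endo_span_into[OF endo_bracket_left, where B = B and W = I and x = z]) (use I weight_basis_span[OF B] in auto)
  qed
  then have "I = {0} \<or> I = UNIV" by (rule ideal_trivial)
  then show False
  proof
    assume I0: "I = {0}"
    obtain \<beta> where \<beta>: "\<beta> \<in> P1" using ne by blast
    then have \<beta>P: "\<beta> \<in> P" using PQ(1) by blast
    have \<beta>r: "\<beta> \<in> roots T" "\<beta> \<notin> D"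
      using P_root[OF \<beta>P] \<beta> ht_simple[OF \<beta>P \<beta>P] by (auto simp: D_def intro!: bexI[of _ \<beta>])
    then obtain x where x: "x \<noteq> 0" "x \<in> weight_space \<beta>" by (auto simp: root_iff)
    have "x \<in> I" unfolding I_def using commute[OF \<beta>r _ x(2)] by blast
    then show False using I0 x(1) by simp
  next
    assume I1: "I = UNIV"
    obtain \<delta> where \<delta>: "\<delta> \<in> P2" using ne by blast
    then have \<delta>P: "\<delta> \<in> P" using PQ(1) by blast
    note \<delta>r = P_root[OF \<delta>P]
    have "ht \<beta> (- \<delta>) = 0" if "\<beta> \<in> P1" for \<beta>
    proof -
      have "\<beta> \<in> P" "\<beta> \<noteq> \<delta>" using that \<delta> PQ by blast+
      then show ?thesis using ht_uminus[OF \<delta>r] ht_simple[OF _ \<delta>P] by simp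
    qed
    then have "- \<delta> \<in> D" using root_uminus[OF \<delta>r] by (simp add: D_def)
    obtain e where e: "e \<noteq> 0" "e \<in> weight_space \<delta>" using \<delta>r by (auto simp: root_iff)
    obtain f where f: "f \<in> weight_space (- \<delta>)" "bracket e f = dual_vector T \<delta>" by (rule root_triple[OF \<delta>r e])
    have "e \<in> I" using I1 by simp
    then have "dual_vector T \<delta> = 0" using f \<open>- \<delta> \<in> D\<close> by (auto simp: I_def)
    then have "form T \<delta> \<delta> = 0" by (simp add: form_def killing_zero_left)
    then show False using form_root_nonzero[OF \<delta>r] by blast
  qed
qed

definition maximal_root :: "('g \<Rightarrow> 'k) \<Rightarrow> bool" where
  "maximal_root m \<longleftrightarrow> m \<in> roots T \<and> (\<forall>\<gamma>\<in>roots T. (\<forall>\<beta>\<in>P. ht \<beta> m \<le> ht \<beta> \<gamma>) \<longrightarrow> \<gamma> = m)"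

lemma below_maximal_root:
  assumes \<gamma>: "\<gamma> \<in> roots T"
  obtains m where "maximal_root m" "\<forall>\<beta>\<in>P. ht \<beta> \<gamma> \<le> ht \<beta> m"
proof -
  let ?S = "{\<delta> \<in> roots T. \<forall>\<beta>\<in>P. ht \<beta> \<gamma> \<le> ht \<beta> \<delta>}"
  let ?h = "\<lambda>\<delta>. \<Sum>\<beta>\<in>P. ht \<beta> \<delta>"
  have "finite ?S" "?S \<noteq> {}" using finite_roots \<gamma> by auto
  then have "Max (?h ` ?S) \<in> ?h ` ?S" by (intro Max_in) auto
  then obtain m where "m \<in> ?S" "Max (?h ` ?S) = ?h m" by (rule imageE)
  moreover have "?h \<delta> \<le> Max (?h ` ?S)" if "\<delta> \<in> ?S" for \<delta>
    by (rule Max_ge[OF finite_imageI[OF \<open>finite ?S\<close>] imageI[OF that]])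
  ultimately have m: "m \<in> ?S" "\<And>\<delta>. \<delta> \<in> ?S \<Longrightarrow> ?h \<delta> \<le> ?h m" by simp_all
  have "\<delta> = m" if \<delta>: "\<delta> \<in> roots T" "\<forall>\<beta>\<in>P. ht \<beta> m \<le> ht \<beta> \<delta>" for \<delta>
  proof (rule root_eqI[OF \<delta>(1)])
    show "m \<in> roots T" using m by simp
    have "\<delta> \<in> ?S" using m(1) \<delta> by (auto intro: order_trans)
    then have "?h \<delta> \<le> ?h m" by (rule m(2))
    then have eq: "?h m = ?h \<delta>" using sum_mono[of P "\<lambda>\<beta>. ht \<beta> m" "\<lambda>\<beta>. ht \<beta> \<delta>"] \<delta>(2) by simp
    show "ht \<beta> \<delta> = ht \<beta> m" if "\<beta> \<in> P" for \<beta>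
      using sum_mono_inv[OF eq _ that finite_P] \<delta>(2) by simp
  qed
  then have "maximal_root m" using m(1) by (auto simp: maximal_root_def)
  then show thesis using that m(1) by blast
qed

lemma maximal_root_nonneg:
  assumes m: "maximal_root m"
  shows "\<forall>\<beta>\<in>P. 0 \<le> ht \<beta> m"
proof (rule ccontr)
  assume *: "\<not> (\<forall>\<beta>\<in>P. 0 \<le> ht \<beta> m)"
  have mr: "m \<in> roots T" using m by (simp add: maximal_root_def)
  have neg: "\<forall>\<beta>\<in>P. ht \<beta> m \<le> 0" using ht_sign[OF mr] * by blast
  then have "\<forall>\<beta>\<in>P. ht \<beta> m \<le> ht \<beta> (- m)" using ht_uminus[OF mr] by fastforce
  then have eq: "- m = m" using m root_uminus[OF mr] unfolding maximal_root_def by blast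
  have "ht \<beta> m = 0" if "\<beta> \<in> P" for \<beta> using ht_uminus[OF mr that] unfolding eq by simp
  then show False using ht_nonzero[OF mr] by blast
qed

lemma maximal_root_dominant:
  assumes m: "maximal_root m" and \<beta>: "\<beta> \<in> P"
  shows "0 \<le> rat_form m \<beta>"
proof (rule ccontr)
  have mr: "m \<in> roots T" using m by (simp add: maximal_root_def)
  assume "\<not> 0 \<le> rat_form m \<beta>"
  then have a: "cartan_int m \<beta> < 0" using rat_form_neg_iff[OF mr P_root[OF \<beta>]] by simp
  have "ht \<beta> (- \<beta>) < 0" using \<beta> by (simp add: ht_uminus P_root ht_simple)
  then have "m \<noteq> - \<beta>" using maximal_root_nonneg[OF m] \<beta> by force
  then have sum: "m + \<beta> \<in> roots T" by (rule root_add[OF P_root[OF \<beta>] mr a])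
  have "\<forall>\<delta>\<in>P. ht \<delta> m \<le> ht \<delta> (m + \<beta>)" using mr \<beta> by (simp add: ht_add P_root ht_simple)
  then have "m + \<beta> = m" using m sum unfolding maximal_root_def by blast
  then show False using P_root[OF \<beta>] by (simp add: root_iff)
qed

text \<open>If some simple root were missing from \<open>m\<close>, then by connectedness some missing \<open>\<delta>\<close> would not be
  orthogonal to the support of \<open>m\<close>.  Different simple roots have nonpositive products, so \<open>(m, \<delta>) < 0\<close>,
  against dominance.\<close>

lemma maximal_root_full_support:
  assumes m: "maximal_root m" and \<beta>: "\<beta> \<in> P"
  shows "0 < ht \<beta> m"
proof (rule ccontr)
  assume n: "\<not> 0 < ht \<beta> m"
  have mr: "m \<in> roots T" using m by (simp add: maximal_root_def)
  define P1 where "P1 = {\<beta> \<in> P. 0 < ht \<beta> m}"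
  define P2 where "P2 = {\<beta> \<in> P. ht \<beta> m = 0}"
  note nonneg = maximal_root_nonneg[OF m]
  have PQ: "P = P1 \<union> P2" "P1 \<inter> P2 = {}" using nonneg by (auto simp: P1_def P2_def order_less_le)
  have "P2 \<noteq> {}" using n \<beta> nonneg by (force simp: P2_def)
  moreover have "P1 \<noteq> {}"
  proof -
    obtain \<beta>' where "\<beta>' \<in> P" "ht \<beta>' m \<noteq> 0" by (rule ht_nonzero[OF mr])
    then have "\<beta>' \<in> P1" using nonneg by (simp add: P1_def order_less_le)
    then show ?thesis by blast
  qed
  ultimately have ne: "P1 \<noteq> {}" "P2 \<noteq> {}" by blast+
  obtain \<beta>1 \<delta> where *: "\<beta>1 \<in> P1" "\<delta> \<in> P2" "form T \<beta>1 \<delta> \<noteq> 0"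
    by (rule simple_roots_connected[OF PQ ne])
  have P: "\<beta>1 \<in> P" "\<delta> \<in> P" using * PQ(1) by auto
  have nonpos: "of_int (ht \<beta>' m) * rat_form \<beta>' \<delta> \<le> 0" if "\<beta>' \<in> P" for \<beta>'
  proof (cases "\<beta>' = \<delta>")
    case True
    then show ?thesis using *(2) by (simp add: P2_def)
  next
    case False
    then have "rat_form \<beta>' \<delta> \<le> 0" using rat_form_simple_nonpos that P by blast
    then show ?thesis using nonneg that by (simp add: mult_nonneg_nonpos)
  qed
  have "rat_form \<beta>1 \<delta> \<noteq> 0" using *(3) of_rat_form[OF P_root[OF P(1)] P_root[OF P(2)]] by auto
  moreover have "0 < ht \<beta>1 m" using *(1) by (simp add: P1_def)
  ultimately have "of_int (ht \<beta>1 m) * rat_form \<beta>1 \<delta> < 0" using nonpos[OF P(1)] by (simp add: order_less_le)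
  then have "(\<Sum>\<beta>'\<in>P. of_int (ht \<beta>' m) * rat_form \<beta>' \<delta>) < (\<Sum>\<beta>'\<in>P. 0)"
    using nonpos P(1) by (intro sum_strict_mono_ex1 finite_P) auto
  then have "rat_form m \<delta> < 0" using rat_form_root_left[OF mr P_root[OF P(2)]] by simp
  then show False using maximal_root_dominant[OF m P(2)] by simp
qed

text \<open>Full support of \<open>m\<close> and dominance of \<open>m'\<close> give \<open>(m, m') > 0\<close>.  If \<open>m \<noteq> m'\<close>, then \<open>m - m'\<close> is a
  root, and its sign makes the two comparable.\<close>

lemma maximal_root_unique:
  assumes m: "maximal_root m" and m': "maximal_root m'"
  shows "m = m'"
proof (rule ccontr)
  assume ne: "m \<noteq> m'"
  have mr: "m \<in> roots T" "m' \<in> roots T" using m m' by (simp_all add: maximal_root_def)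
  obtain \<beta> where \<beta>: "\<beta> \<in> P" "0 < cartan_int m' \<beta>"
    using simple_root_descent[OF mr(2) maximal_root_nonneg[OF m']] by metis
  have "0 < (\<Sum>\<delta>\<in>P. of_int (ht \<delta> m) * rat_form \<delta> m')"
  proof (rule sum_pos2[OF finite_P \<beta>(1)])
    show "0 < of_int (ht \<beta> m) * rat_form \<beta> m'"
      using maximal_root_full_support[OF m \<beta>(1)] \<beta> rat_form_pos_iff[OF mr(2) P_root[OF \<beta>(1)]]
      by (simp add: rat_form_sym)
    show "0 \<le> of_int (ht \<delta> m) * rat_form \<delta> m'" if "\<delta> \<in> P" for \<delta>
      using maximal_root_nonneg[OF m] maximal_root_dominant[OF m' that] that by (simp add: rat_form_sym)
  qed
  then have "0 < cartan_int m m'"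
    using rat_form_root_left[OF mr] rat_form_pos_iff[OF mr] by simp
  then have diff: "m - m' \<in> roots T" by (rule root_diff[OF mr(2,1) _ ne])
  from ht_sign[OF this] show False
  proof
    assume "\<forall>\<beta>\<in>P. 0 \<le> ht \<beta> (m - m')"
    then have "\<forall>\<beta>\<in>P. ht \<beta> m' \<le> ht \<beta> m" using mr by (simp add: ht_diff)
    then show False using m' mr(1) ne unfolding maximal_root_def by blast
  next
    assume "\<forall>\<beta>\<in>P. ht \<beta> (m - m') \<le> 0"
    then have "\<forall>\<beta>\<in>P. ht \<beta> m \<le> ht \<beta> m'" using mr by (simp add: ht_diff)
    then show False using m mr(2) ne unfolding maximal_root_def by blast
  qed
qed

lemma highest_root:
  shows highest_root_root: "highest_root \<in> roots T"
    and ht_le_highest_root: "\<And>\<gamma> \<beta>. \<gamma> \<in> roots T \<Longrightarrow> \<beta> \<in> P \<Longrightarrow> ht \<beta> \<gamma> \<le> ht \<beta> highest_root"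
proof -
  obtain \<beta>0 where "\<beta>0 \<in> P" using P_nonempty by blast
  from below_maximal_root[OF P_root[OF this]] obtain m where m: "maximal_root m" by blast
  have mr: "m \<in> roots T" using m by (simp add: maximal_root_def)
  have "\<forall>\<gamma>\<in>roots T. \<forall>\<beta>\<in>P. ht \<beta> \<gamma> \<le> ht \<beta> m"
    using below_maximal_root maximal_root_unique[OF m] by metis
  then have "\<exists>!\<theta>. \<theta> \<in> roots T \<and> (\<forall>\<gamma>\<in>roots T. \<forall>\<beta>\<in>P. ht \<beta> \<gamma> \<le> ht \<beta> \<theta>)"
    using mr by (intro ex1I[of _ m]) (auto intro!: root_eqI order_antisym)
  from theI'[OF this] show "highest_root \<in> roots T"
    "\<And>\<gamma> \<beta>. \<gamma> \<in> roots T \<Longrightarrow> \<beta> \<in> P \<Longrightarrow> ht \<beta> \<gamma> \<le> ht \<beta> highest_root"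
    unfolding highest_root_def by blast+
qed

end

section \<open>The dual Coxeter number\<close>

context based_simple_lie_algebra
begin

lemma positive_root_iff: "\<gamma> \<in> positive_roots \<longleftrightarrow> \<gamma> \<in> roots T \<and> (\<forall>\<beta>\<in>P. 0 \<le> ht \<beta> \<gamma>)"
  by (simp add: positive_roots_def)

lemma finite_positive_roots: "finite positive_roots"
  using finite_roots by (rule finite_subset[rotated]) (auto simp: positive_root_iff)

lemma sum_roots_positive:
  fixes f :: "('g \<Rightarrow> 'k) \<Rightarrow> 'a::comm_monoid_add"
  shows "(\<Sum>\<gamma>\<in>roots T. f \<gamma>) = (\<Sum>\<gamma>\<in>positive_roots. f \<gamma> + f (- \<gamma>))"
proof -
  have "roots T = positive_roots \<union> uminus ` positive_roots"
  proof (intro equalityI subsetI)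
    fix \<gamma> assume \<gamma>: "\<gamma> \<in> roots T"
    then have "\<gamma> \<in> positive_roots \<or> - \<gamma> \<in> positive_roots"
      using ht_sign[OF \<gamma>] by (auto simp: positive_root_iff root_uminus ht_uminus)
    then show "\<gamma> \<in> positive_roots \<union> uminus ` positive_roots"
      using image_eqI[of \<gamma> uminus "- \<gamma>" positive_roots] by auto
  qed (auto simp: positive_root_iff root_uminus)
  moreover have "positive_roots \<inter> uminus ` positive_roots = {}"
  proof (rule ccontr)
    assume "positive_roots \<inter> uminus ` positive_roots \<noteq> {}"
    then obtain \<gamma> where \<gamma>: "\<gamma> \<in> positive_roots" "- \<gamma> \<in> positive_roots" by auto
    have "ht \<beta> \<gamma> = 0" if "\<beta> \<in> P" for \<beta>
      using \<gamma> that ht_uminus[of \<gamma> \<beta>] by (force simp: positive_root_iff)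
    then show False using ht_nonzero[of \<gamma>] \<gamma>(1) by (metis positive_root_iff)
  qed
  ultimately have "(\<Sum>\<gamma>\<in>roots T. f \<gamma>) = sum f positive_roots + sum f (uminus ` positive_roots)"
    using finite_positive_roots by (simp add: sum.union_disjoint)
  also have "sum f (uminus ` positive_roots) = (\<Sum>\<gamma>\<in>positive_roots. f (- \<gamma>))"
    by (subst sum.reindex) (auto simp: inj_on_def)
  finally show ?thesis by (simp add: sum.distrib)
qed

lemma ht_highest_root_pos: "\<beta> \<in> P \<Longrightarrow> 0 < ht \<beta> highest_root"
  using ht_le_highest_root[OF P_root, of \<beta> \<beta>] by (simp add: ht_simple)

lemma highest_root_positive: "highest_root \<in> positive_roots"
  using highest_root_root ht_highest_root_pos by (auto simp: positive_root_iff intro: less_imp_le)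

text \<open>Neither \<open>\<gamma> + \<theta>\<close> nor \<open>\<gamma> - 2\<theta>\<close> can be a root, so the \<open>\<theta>\<close>-string through \<open>\<gamma>\<close> has at most two
  members.\<close>

lemma cartan_int_highest_root:
  assumes \<gamma>: "\<gamma> \<in> positive_roots" and ne: "\<gamma> \<noteq> highest_root"
  shows "cartan_int \<gamma> highest_root = 0 \<or> cartan_int \<gamma> highest_root = 1"
proof -
  let ?\<theta> = highest_root
  note \<theta>r = highest_root_root
  have \<gamma>r: "\<gamma> \<in> roots T" and \<gamma>0: "\<And>\<beta>. \<beta> \<in> P \<Longrightarrow> 0 \<le> ht \<beta> \<gamma>" using \<gamma> by (auto simp: positive_root_iff)
  obtain \<beta>0 where \<beta>0: "\<beta>0 \<in> P" "0 < ht \<beta>0 \<gamma>"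
    using ht_nonzero[OF \<gamma>r] \<gamma>0 by (metis order_less_le)
  have "ht \<beta>0 (- ?\<theta>) < 0" using \<beta>0(1) ht_highest_root_pos by (simp add: ht_uminus[OF \<theta>r])
  then have "\<gamma> \<noteq> - ?\<theta>" using \<beta>0(2) by auto
  then obtain p q :: int where pq: "0 \<le> p" "0 \<le> q" "cartan_int \<gamma> ?\<theta> = q - p"
    "\<And>n. - q \<le> n \<Longrightarrow> n \<le> p \<Longrightarrow> \<gamma> + fun_scale (of_int n) ?\<theta> \<in> roots T"
    by (rule cartan_string[OF \<theta>r \<gamma>r ne]) blast
  have "p = 0"
  proof (rule ccontr)
    assume "p \<noteq> 0"
    then have "\<gamma> + fun_scale (of_int 1) ?\<theta> \<in> roots T" using pq(1,2) by (intro pq(4)) auto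
    from ht_le_highest_root[OF this \<beta>0(1)] show False
      using \<beta>0(2) unfolding ht_add_scale[OF \<gamma>r \<theta>r \<beta>0(1)] by simp
  qed
  moreover have "q \<le> 1"
  proof (rule ccontr)
    assume "\<not> q \<le> 1"
    then have r: "\<gamma> + fun_scale (of_int (-2)) ?\<theta> \<in> roots T" using pq(1,2) by (intro pq(4)) auto
    have "ht \<beta> \<gamma> = ht \<beta> ?\<theta>" if \<beta>: "\<beta> \<in> P" for \<beta>
      using ht_le_highest_root[OF root_uminus[OF r] \<beta>] ht_le_highest_root[OF \<gamma>r \<beta>]
      unfolding ht_uminus[OF r \<beta>] ht_add_scale[OF \<gamma>r \<theta>r \<beta>] by simp
    then have "\<gamma> = ?\<theta>" by (rule root_eqI[OF \<gamma>r \<theta>r])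
    then show False using ne by blast
  qed
  ultimately show ?thesis using pq(2,3) by auto
qed

text \<open>Here \<open>(\<theta>, \<theta>) = \<Sum>\<gamma>. (\<gamma>, \<theta>)\<^sup>2\<close>, and \<open>\<langle>\<gamma>, \<theta>\<^sup>\<or>\<rangle>\<^sup>2 = \<langle>\<gamma>, \<theta>\<^sup>\<or>\<rangle>\<close> for the positive roots \<open>\<gamma> \<noteq> \<theta>\<close>, so that the
  sum of squares is linear in the half-sum of the positive roots.\<close>

lemma dual_coxeter_norm: "form T highest_root highest_root * dual_coxeter = 1"
proof -
  let ?\<theta> = highest_root
  let ?a = "\<lambda>\<gamma>. cartan_int \<gamma> ?\<theta>"
  note \<theta>r = highest_root_root
  note \<theta>d = root_in_dual[OF \<theta>r]
  have pr: "\<gamma> \<in> roots T" if "\<gamma> \<in> positive_roots" for \<gamma> using that by (simp add: positive_root_iff)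
  have pd: "\<gamma> \<in> dual T" if "\<gamma> \<in> positive_roots" for \<gamma> using that pr root_in_dual by blast
  define A :: 'k where "A = of_int (\<Sum>\<gamma>\<in>positive_roots. ?a \<gamma>)"
  have a2: "form T \<gamma> ?\<theta> = of_int (?a \<gamma>) / 2 * form T ?\<theta> ?\<theta>" if "\<gamma> \<in> roots T" for \<gamma>
  proof -
    have "2 * form T \<gamma> ?\<theta> = 2 * (of_int (?a \<gamma>) / 2 * form T ?\<theta> ?\<theta>)" using cartan_int[OF \<theta>r that] by simp
    then show ?thesis by (simp only: mult_cancel_left) simp
  qed
  have "form T half_sum (coroot ?\<theta>) = 2 / form T ?\<theta> ?\<theta> * (1 / 2 * (\<Sum>\<gamma>\<in>positive_roots. form T \<gamma> ?\<theta>))"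
    unfolding half_sum_def coroot_def using \<theta>d pd
    by (simp add: form_scale_right form_scale_left form_sum_left sum_in_dual scale_in_dual)
  also have "(\<Sum>\<gamma>\<in>positive_roots. form T \<gamma> ?\<theta>) = (\<Sum>\<gamma>\<in>positive_roots. of_int (?a \<gamma>) / 2 * form T ?\<theta> ?\<theta>)"
    by (intro sum.cong refl a2 pr)
  also have "\<dots> = A / 2 * form T ?\<theta> ?\<theta>"
    unfolding A_def by (simp add: sum_distrib_right sum_divide_distrib)
  finally have h: "dual_coxeter = 1 + A / 2"
    using form_root_nonzero[OF \<theta>r] by (simp add: dual_coxeter_def)
  have "(\<Sum>\<gamma>\<in>positive_roots. (?a \<gamma>)\<^sup>2) = (\<Sum>\<gamma>\<in>positive_roots. ?a \<gamma> + (if \<gamma> = ?\<theta> then 2 else 0))"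
    using cartan_int_highest_root cartan_int_self[OF \<theta>r]
    by (intro sum.cong refl) (auto simp: power2_eq_square)
  also have "\<dots> = (\<Sum>\<gamma>\<in>positive_roots. ?a \<gamma>) + 2"
    using finite_positive_roots highest_root_positive by (simp add: sum.distrib)
  finally have sq: "of_int (\<Sum>\<gamma>\<in>positive_roots. (?a \<gamma>)\<^sup>2) = A + 2" by (simp add: A_def)
  have "form T ?\<theta> ?\<theta> = (\<Sum>\<gamma>\<in>positive_roots. (form T \<gamma> ?\<theta>)\<^sup>2 + (form T (- \<gamma>) ?\<theta>)\<^sup>2)"
    unfolding form_sum_roots[OF \<theta>d \<theta>d] power2_eq_square by (rule sum_roots_positive)
  also have "\<dots> = (\<Sum>\<gamma>\<in>positive_roots. of_int ((?a \<gamma>)\<^sup>2) * ((form T ?\<theta> ?\<theta>)\<^sup>2 / 2))"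
  proof (intro sum.cong refl)
    fix \<gamma> assume \<gamma>: "\<gamma> \<in> positive_roots"
    show "(form T \<gamma> ?\<theta>)\<^sup>2 + (form T (- \<gamma>) ?\<theta>)\<^sup>2 = of_int ((?a \<gamma>)\<^sup>2) * ((form T ?\<theta> ?\<theta>)\<^sup>2 / 2)"
      unfolding form_uminus_left[OF pd[OF \<gamma>] \<theta>d] a2[OF pr[OF \<gamma>]]
      by (simp add: power_mult_distrib power_divide)
  qed
  also have "\<dots> = (A + 2) * ((form T ?\<theta> ?\<theta>)\<^sup>2 / 2)"
    unfolding sq[symmetric] by (simp add: sum_distrib_right)
  also have "\<dots> = form T ?\<theta> ?\<theta> * (form T ?\<theta> ?\<theta> * dual_coxeter)"
    unfolding h by (simp add: power2_eq_square field_simps)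
  finally show ?thesis using form_root_nonzero[OF \<theta>r] by simp
qed

end

section \<open>The integers \<open>q\<^sub>\<alpha>(i)\<close>\<close>

context based_simple_lie_algebra
begin

lemma dual_eqI_simple:
  assumes d: "\<mu> \<in> dual T" "\<nu> \<in> dual T" and eq: "\<And>\<beta>. \<beta> \<in> P \<Longrightarrow> form T \<mu> \<beta> = form T \<nu> \<beta>"
  shows "\<mu> = \<nu>"
proof -
  let ?\<delta> = "\<mu> - \<nu>"
  have \<delta>: "?\<delta> \<in> dual T" by (rule diff_in_dual[OF d])
  have "dual_vector T ?\<delta> = 0"
  proof (rule simple_roots_separate[OF dual_vector(1)[OF \<delta>]])
    fix \<beta> assume \<beta>: "\<beta> \<in> P"
    then have "form T ?\<delta> \<beta> = 0" using d P_in_dual[OF \<beta>] eq by (simp add: form_diff_left)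
    then show "\<beta> (dual_vector T ?\<delta>) = 0"
      using form_eval[OF P_in_dual[OF \<beta>] \<delta>] form_sym[of \<beta> ?\<delta>] by simp
  qed
  then have "\<mu> t = \<nu> t" if "t \<in> T" for t
    using dual_vector(2)[OF \<delta> that] by (simp add: killing_zero_left)
  then show ?thesis by (rule dual_eqI[OF d])
qed

lemma fundamental_weight:
  assumes \<alpha>: "\<alpha> \<in> P"
  shows fundamental_weight_in_dual: "fundamental_weight \<alpha> \<in> dual T"
    and form_fundamental_weight: "\<And>\<beta>. \<beta> \<in> P \<Longrightarrow>
      form T (fundamental_weight \<alpha>) \<beta> = (if \<beta> = \<alpha> then form T \<alpha> \<alpha> / 2 else 0)"
proof -
  let ?c = "\<lambda>\<beta>. if \<beta> = \<alpha> then form T \<alpha> \<alpha> / 2 else 0"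
  have iff: "form T \<phi> (coroot \<beta>) = (if \<beta> = \<alpha> then 1 else 0) \<longleftrightarrow> form T \<phi> \<beta> = ?c \<beta>"
    if "\<phi> \<in> dual T" "\<beta> \<in> P" for \<phi> \<beta>
    using form_root_nonzero[OF P_root[OF that(2)]] that P_in_dual
    by (auto simp: coroot_def form_scale_right field_simps)
  obtain t where t: "t \<in> T" "\<And>\<beta>. \<beta> \<in> P \<Longrightarrow> \<beta> t = ?c \<beta>"
    by (rule simple_root_values[of ?c]) blast
  define \<phi> where "\<phi> s = (if s \<in> T then killing t s else 0)" for s
  have \<phi>d: "\<phi> \<in> dual T"
    using subspace_T
    by (auto simp: dual_def \<phi>_def killing_add_right killing_scale_right subspace_add subspace_scale)
  have \<phi>: "form T \<phi> \<beta> = ?c \<beta>" if \<beta>: "\<beta> \<in> P" for \<beta>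
  proof -
    note d = P_in_dual[OF \<beta>]
    have "form T \<phi> \<beta> = killing (dual_vector T \<beta>) t"
      using form_eval[OF \<phi>d d] dual_vector(1)[OF d] by (simp add: \<phi>_def killing_sym[of t])
    then show ?thesis using dual_vector(2)[OF d t(1)] t(2)[OF \<beta>] by simp
  qed
  have "\<exists>!\<phi>. \<phi> \<in> dual T \<and> (\<forall>\<beta>\<in>P. form T \<phi> (coroot \<beta>) = (if \<beta> = \<alpha> then 1 else 0))"
  proof (intro ex1I[of _ \<phi>] conjI ballI \<phi>d)
    show "form T \<phi> (coroot \<beta>) = (if \<beta> = \<alpha> then 1 else 0)" if "\<beta> \<in> P" for \<beta>
      unfolding iff[OF \<phi>d that] by (rule \<phi>[OF that])
    show "\<psi> = \<phi>" if \<psi>: "\<psi> \<in> dual T \<and> (\<forall>\<beta>\<in>P. form T \<psi> (coroot \<beta>) = (if \<beta> = \<alpha> then 1 else 0))" for \<psi>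
    proof (rule dual_eqI_simple[OF _ \<phi>d])
      show "\<psi> \<in> dual T" using \<psi> by blast
      show "form T \<psi> \<beta> = form T \<phi> \<beta>" if "\<beta> \<in> P" for \<beta>
        using \<psi> iff[of \<psi> \<beta>] that \<phi>[OF that] by metis
    qed
  qed
  from theI'[OF this] have *: "fundamental_weight \<alpha> \<in> dual T"
    "\<forall>\<beta>\<in>P. form T (fundamental_weight \<alpha>) (coroot \<beta>) = (if \<beta> = \<alpha> then 1 else 0)"
    unfolding fundamental_weight_def by blast+
  show "fundamental_weight \<alpha> \<in> dual T" by (rule *(1))
  show "form T (fundamental_weight \<alpha>) \<beta> = ?c \<beta>" if "\<beta> \<in> P" for \<beta>
    using iff[OF *(1) that] *(2) that by blast
qed

lemma form_root_fundamental_weight: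
  assumes \<alpha>: "\<alpha> \<in> P" and \<gamma>: "\<gamma> \<in> roots T"
  shows "form T \<gamma> (fundamental_weight \<alpha>) = of_int (ht \<alpha> \<gamma>) * (form T \<alpha> \<alpha> / 2)"
proof -
  have "form T \<gamma> (fundamental_weight \<alpha>) =
      (\<Sum>\<beta>\<in>P. if \<beta> = \<alpha> then of_int (ht \<alpha> \<gamma>) * (form T \<alpha> \<alpha> / 2) else 0)"
    unfolding form_root_left[OF \<gamma> fundamental_weight_in_dual[OF \<alpha>]]
    by (intro sum.cong refl) (simp add: form_sym[of _ "fundamental_weight \<alpha>"] form_fundamental_weight[OF \<alpha>])
  then show ?thesis using finite_P \<alpha> by simp
qed

lemma roots_of_ht_subset: "roots_of_ht \<alpha> i \<subseteq> roots T"
  by (auto simp: roots_of_ht_def)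

lemma ht_reflect:
  "\<gamma> \<in> roots T \<Longrightarrow> \<delta> \<in> roots T \<Longrightarrow> \<beta> \<in> P \<Longrightarrow> ht \<beta> (reflect \<delta> \<gamma>) = ht \<beta> \<gamma> - cartan_int \<gamma> \<delta> * ht \<beta> \<delta>"
  unfolding reflect_def by (subst ht_add_scale) simp_all

text \<open>The reflections in the simple roots other than \<open>\<alpha>\<close> preserve \<open>\<Delta>\<^sub>\<alpha>(i)\<close>.  So the sum of \<open>\<Delta>\<^sub>\<alpha>(i)\<close> is
  orthogonal to these roots, hence a multiple of the fundamental weight.  The factor is the sum of the
  Cartan integers of the members with respect to \<open>\<alpha>\<close>.\<close>

lemma sum_roots_of_ht:
  assumes \<alpha>: "\<alpha> \<in> P"
  shows "(\<Sum>\<gamma>\<in>roots_of_ht \<alpha> i. \<gamma>) = fun_scale (of_int (q_at \<alpha> i)) (fundamental_weight \<alpha>)"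
proof -
  let ?\<phi> = "fundamental_weight \<alpha>"
  note \<alpha>r = P_root[OF \<alpha>] and \<phi>d = fundamental_weight_in_dual[OF \<alpha>]
  have d: "\<gamma> \<in> dual T" if "\<gamma> \<in> roots_of_ht \<alpha> i" for \<gamma>
    using that roots_of_ht_subset root_in_dual by blast
  define q where "q = (\<Sum>\<gamma>\<in>roots_of_ht \<alpha> i. cartan_int \<gamma> \<alpha>)"
  have sum: "(\<Sum>\<gamma>\<in>roots_of_ht \<alpha> i. \<gamma>) = fun_scale (of_int q) ?\<phi>"
  proof (rule dual_eqI_simple[OF sum_in_dual[OF d] scale_in_dual[OF \<phi>d]])
    fix \<beta> assume \<beta>: "\<beta> \<in> P"
    have lhs: "form T (\<Sum>\<gamma>\<in>roots_of_ht \<alpha> i. \<gamma>) \<beta> = (\<Sum>\<gamma>\<in>roots_of_ht \<alpha> i. form T \<gamma> \<beta>)"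
      by (rule form_sum_left[OF d P_in_dual[OF \<beta>]])
    have rhs: "form T (fun_scale (of_int q) ?\<phi>) \<beta> = of_int q * form T ?\<phi> \<beta>"
      by (rule form_scale_left[OF \<phi>d P_in_dual[OF \<beta>]])
    show "form T (\<Sum>\<gamma>\<in>roots_of_ht \<alpha> i. \<gamma>) \<beta> = form T (fun_scale (of_int q) ?\<phi>) \<beta>"
    proof (cases "\<beta> = \<alpha>")
      case True
      have "2 * (\<Sum>\<gamma>\<in>roots_of_ht \<alpha> i. form T \<gamma> \<alpha>) = (\<Sum>\<gamma>\<in>roots_of_ht \<alpha> i. of_int (cartan_int \<gamma> \<alpha>) * form T \<alpha> \<alpha>)"
        unfolding sum_distrib_left using cartan_int[OF \<alpha>r] roots_of_ht_subset by (intro sum.cong refl) blast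
      also have "\<dots> = 2 * (of_int q * (form T \<alpha> \<alpha> / 2))" by (simp add: q_def sum_distrib_right)
      finally have "(\<Sum>\<gamma>\<in>roots_of_ht \<alpha> i. form T \<gamma> \<alpha>) = of_int q * (form T \<alpha> \<alpha> / 2)"
        by (simp only: mult_cancel_left) simp
      moreover have "form T ?\<phi> \<alpha> = form T \<alpha> \<alpha> / 2" using form_fundamental_weight[OF \<alpha> \<alpha>] by simp
      ultimately show ?thesis unfolding lhs rhs unfolding True by (simp only:)
    next
      case False
      have "(\<Sum>\<gamma>\<in>roots_of_ht \<alpha> i. form T \<gamma> \<beta>) = 0"
      proof (rule sum_form_reflection_invariant[OF P_root[OF \<beta>] roots_of_ht_subset])
        fix \<gamma> assume "\<gamma> \<in> roots_of_ht \<alpha> i"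
        then show "reflect \<beta> \<gamma> \<in> roots_of_ht \<alpha> i"
          using False \<alpha> \<beta> by (simp add: roots_of_ht_def reflect_root P_root ht_reflect ht_simple)
      qed
      then show ?thesis using False lhs rhs form_fundamental_weight[OF \<alpha> \<beta>] by simp
    qed
  qed
  have "?\<phi> \<noteq> 0"
  proof
    assume "?\<phi> = 0"
    then have "form T \<alpha> ?\<phi> = 0" using form_eval[OF zero_in_dual root_in_dual[OF \<alpha>r]] form_sym[of \<alpha> 0] by simp
    then show False
      using form_fundamental_weight[OF \<alpha> \<alpha>] form_root_nonzero[OF \<alpha>r] form_sym[of \<alpha> ?\<phi>] by simp
  qed
  then have "q_at \<alpha> i = q"
    unfolding q_at_def sum by (intro the_equality) (auto simp del: fun_scale_apply)
  then show ?thesis using sum by simp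
qed

lemma sum_form_roots_of_ht:
  assumes \<alpha>: "\<alpha> \<in> P" and \<nu>: "\<nu> \<in> dual T"
  shows "(\<Sum>\<gamma>\<in>roots_of_ht \<alpha> i. form T \<gamma> \<nu>) = of_int (q_at \<alpha> i) * form T (fundamental_weight \<alpha>) \<nu>"
proof -
  have "(\<Sum>\<gamma>\<in>roots_of_ht \<alpha> i. form T \<gamma> \<nu>) = form T (\<Sum>\<gamma>\<in>roots_of_ht \<alpha> i. \<gamma>) \<nu>"
    using \<nu> roots_of_ht_subset root_in_dual by (intro form_sum_left[symmetric]) auto
  then show ?thesis
    using form_scale_left[OF fundamental_weight_in_dual[OF \<alpha>] \<nu>] sum_roots_of_ht[OF \<alpha>] by simp
qed

lemma q_at_zero:
  assumes \<alpha>: "\<alpha> \<in> P" and i: "ht \<alpha> highest_root < i"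
  shows "q_at \<alpha> i = 0"
proof -
  have "roots_of_ht \<alpha> i = {}" using ht_le_highest_root[OF _ \<alpha>] i by (force simp: roots_of_ht_def)
  then have "of_int (q_at \<alpha> i) * form T (fundamental_weight \<alpha>) \<alpha> = 0"
    using sum_form_roots_of_ht[OF \<alpha> P_in_dual[OF \<alpha>], of i] by simp
  then show ?thesis using form_fundamental_weight[OF \<alpha> \<alpha>] form_root_nonzero[OF P_root[OF \<alpha>]] by simp
qed

lemma q_total_eq:
  assumes \<alpha>: "\<alpha> \<in> P"
  shows "q_total \<alpha> = (\<Sum>i\<in>{1..ht \<alpha> highest_root}. q_at \<alpha> i)"
  unfolding q_total_def using q_at_zero[OF \<alpha>]
  by (intro sum.mono_neutral_left) (auto simp: not_less[symmetric])

text \<open>Evaluate \<open>(\<phi>\<^sub>\<alpha>, \<alpha>) = \<Sum>\<gamma>. (\<gamma>, \<phi>\<^sub>\<alpha>) (\<gamma>, \<alpha>)\<close> with \<open>(\<gamma>, \<phi>\<^sub>\<alpha>) = ht\<^sub>\<alpha>(\<gamma>) (\<alpha>, \<alpha>) / 2\<close>, grouping the roots by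
  their \<open>\<alpha>\<close>-height.\<close>

lemma weighted_sum_q:
  assumes \<alpha>: "\<alpha> \<in> P"
  shows "of_int (\<Sum>i\<in>{1..ht \<alpha> highest_root}. i * q_at \<alpha> i) * form T \<alpha> \<alpha> = 1"
proof -
  let ?\<phi> = "fundamental_weight \<alpha>" and ?d = "ht \<alpha> highest_root"
  let ?n = "form T \<alpha> \<alpha>"
  note \<alpha>r = P_root[OF \<alpha>] and \<phi>d = fundamental_weight_in_dual[OF \<alpha>]
  note \<alpha>d = root_in_dual[OF \<alpha>r]
  let ?g = "\<lambda>\<gamma>. of_int (ht \<alpha> \<gamma>) * form T \<gamma> \<alpha>"
  have n0: "?n \<noteq> 0" by (rule form_root_nonzero[OF \<alpha>r])
  have "?n / 2 = form T ?\<phi> \<alpha>" using form_fundamental_weight[OF \<alpha> \<alpha>] by simp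
  also have "\<dots> = (\<Sum>\<gamma>\<in>roots T. form T \<gamma> ?\<phi> * form T \<gamma> \<alpha>)" by (rule form_sum_roots[OF \<phi>d \<alpha>d])
  also have "\<dots> = (\<Sum>\<gamma>\<in>roots T. ?g \<gamma>) * (?n / 2)"
    unfolding sum_distrib_right
    by (intro sum.cong refl) (simp add: form_root_fundamental_weight[OF \<alpha>] mult_ac)
  finally have "(\<Sum>\<gamma>\<in>roots T. ?g \<gamma>) = 1" using n0 by simp
  then have "1 = (\<Sum>\<gamma>\<in>positive_roots. ?g \<gamma> + ?g (- \<gamma>))" by (simp add: sum_roots_positive)
  also have "\<dots> = 2 * (\<Sum>\<gamma>\<in>positive_roots. ?g \<gamma>)"
    unfolding sum_distrib_left using \<alpha> \<alpha>d root_in_dual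
    by (intro sum.cong refl) (auto simp: positive_root_iff ht_uminus form_uminus_left)
  also have "(\<Sum>\<gamma>\<in>positive_roots. ?g \<gamma>) = (\<Sum>\<gamma> | \<gamma> \<in> roots T \<and> ht \<alpha> \<gamma> \<in> {1..?d}. ?g \<gamma>)"
  proof (rule sum.mono_neutral_right[OF finite_positive_roots])
    show "{\<gamma> \<in> roots T. ht \<alpha> \<gamma> \<in> {1..?d}} \<subseteq> positive_roots"
    proof safe
      fix \<gamma> assume "\<gamma> \<in> roots T" "ht \<alpha> \<gamma> \<in> {1..?d}"
      then show "\<gamma> \<in> positive_roots" using ht_sign[of \<gamma>] \<alpha> by (auto simp: positive_root_iff)
    qed
    show "\<forall>\<gamma>\<in>positive_roots - {\<gamma> \<in> roots T. ht \<alpha> \<gamma> \<in> {1..?d}}. ?g \<gamma> = 0"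
    proof
      fix \<gamma> assume \<gamma>: "\<gamma> \<in> positive_roots - {\<gamma> \<in> roots T. ht \<alpha> \<gamma> \<in> {1..?d}}"
      then have "ht \<alpha> \<gamma> = 0"
        using \<alpha> ht_le_highest_root[of \<gamma> \<alpha>] by (force simp: positive_root_iff)
      then show "?g \<gamma> = 0" by simp
    qed
  qed
  also have "\<dots> = (\<Sum>i\<in>{1..?d}. \<Sum>\<gamma> | \<gamma> \<in> {\<gamma> \<in> roots T. ht \<alpha> \<gamma> \<in> {1..?d}} \<and> ht \<alpha> \<gamma> = i. ?g \<gamma>)"
    by (rule sum.group[symmetric]) (use finite_roots in auto)
  also have "\<dots> = (\<Sum>i\<in>{1..?d}. of_int i * (\<Sum>\<gamma>\<in>roots_of_ht \<alpha> i. form T \<gamma> \<alpha>))"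
    unfolding sum_distrib_left by (intro sum.cong refl) (auto simp: roots_of_ht_def)
  also have "\<dots> = of_int (\<Sum>i\<in>{1..?d}. i * q_at \<alpha> i) * (?n / 2)"
    unfolding sum_form_roots_of_ht[OF \<alpha> \<alpha>d] form_fundamental_weight[OF \<alpha> \<alpha>]
    by (simp add: sum_distrib_right mult.assoc)
  finally show ?thesis by simp
qed

text \<open>For \<open>0 < i < d\<close> the reflection in \<open>\<theta>\<close> changes the \<open>\<alpha>\<close>-height of a root of height \<open>i\<close> or
  \<open>i - d\<close> by \<open>0\<close> or \<open>\<plusminus>d\<close>, and so permutes \<open>\<Delta>\<^sub>\<alpha>(i) \<union> \<Delta>\<^sub>\<alpha>(i - d)\<close>.  The sum of this set, which is
  \<open>(q\<^sub>\<alpha>(i) - q\<^sub>\<alpha>(d - i)) \<phi>\<^sub>\<alpha>\<close>, is therefore orthogonal to \<open>\<theta>\<close>, whereas \<open>\<phi>\<^sub>\<alpha>\<close> is not.\<close>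

lemma q_at_symmetric:
  assumes \<alpha>: "\<alpha> \<in> P" and i: "0 < i" "i < ht \<alpha> highest_root"
  shows "q_at \<alpha> i = q_at \<alpha> (ht \<alpha> highest_root - i)"
proof -
  let ?\<theta> = highest_root and ?\<phi> = "fundamental_weight \<alpha>"
  let ?d = "ht \<alpha> ?\<theta>"
  note \<theta>r = highest_root_root and \<alpha>r = P_root[OF \<alpha>]
  note \<theta>d = root_in_dual[OF \<theta>r]
  have val: "cartan_int \<gamma> ?\<theta> = 0 \<or> cartan_int \<gamma> ?\<theta> = 1"
    if "\<gamma> \<in> roots T" "ht \<alpha> \<gamma> = j" "0 < j" "j < ?d" for \<gamma> j
  proof (rule cartan_int_highest_root)
    show "\<gamma> \<in> positive_roots" using ht_sign[OF that(1)] that \<alpha> by (auto simp: positive_root_iff)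
    show "\<gamma> \<noteq> ?\<theta>" using that by auto
  qed
  let ?S = "roots_of_ht \<alpha> i \<union> roots_of_ht \<alpha> (i - ?d)"
  have "(\<Sum>\<gamma>\<in>?S. form T \<gamma> ?\<theta>) = 0"
  proof (rule sum_form_reflection_invariant[OF \<theta>r])
    show "?S \<subseteq> roots T" using roots_of_ht_subset by blast
    fix \<gamma> assume "\<gamma> \<in> ?S"
    then have \<gamma>: "\<gamma> \<in> roots T" and "ht \<alpha> \<gamma> = i \<or> ht \<alpha> \<gamma> = i - ?d" by (auto simp: roots_of_ht_def)
    from this(2) have "ht \<alpha> (reflect ?\<theta> \<gamma>) = i \<or> ht \<alpha> (reflect ?\<theta> \<gamma>) = i - ?d"
    proof
      assume h: "ht \<alpha> \<gamma> = i"
      then show ?thesis using val[OF \<gamma> h i] unfolding ht_reflect[OF \<gamma> \<theta>r \<alpha>] by auto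
    next
      assume h: "ht \<alpha> \<gamma> = i - ?d"
      have "cartan_int (- \<gamma>) ?\<theta> = 0 \<or> cartan_int (- \<gamma>) ?\<theta> = 1"
        using val[OF root_uminus[OF \<gamma>], of "?d - i"] h i ht_uminus[OF \<gamma> \<alpha>] by simp
      then have "cartan_int \<gamma> ?\<theta> = 0 \<or> cartan_int \<gamma> ?\<theta> = -1"
        using cartan_int_uminus[OF \<theta>r \<gamma>] by auto
      then show ?thesis using h unfolding ht_reflect[OF \<gamma> \<theta>r \<alpha>] by auto
    qed
    then show "reflect ?\<theta> \<gamma> \<in> ?S" using reflect_root[OF \<theta>r \<gamma>] by (auto simp: roots_of_ht_def)
  qed
  moreover have "(\<Sum>\<gamma>\<in>?S. form T \<gamma> ?\<theta>) =
      (\<Sum>\<gamma>\<in>roots_of_ht \<alpha> i. form T \<gamma> ?\<theta>) + (\<Sum>\<gamma>\<in>roots_of_ht \<alpha> (i - ?d). form T \<gamma> ?\<theta>)"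
    using i finite_subset[OF roots_of_ht_subset finite_roots]
    by (intro sum.union_disjoint) (auto simp: roots_of_ht_def)
  moreover have "(\<Sum>\<gamma>\<in>roots_of_ht \<alpha> (i - ?d). form T \<gamma> ?\<theta>) = - (\<Sum>\<gamma>\<in>roots_of_ht \<alpha> (?d - i). form T \<gamma> ?\<theta>)"
    unfolding sum_negf[symmetric]
  proof (rule sum.reindex_bij_witness[of _ uminus uminus])
    fix \<gamma> assume "\<gamma> \<in> roots_of_ht \<alpha> (i - ?d)"
    then show "- \<gamma> \<in> roots_of_ht \<alpha> (?d - i)" "- form T (- \<gamma>) ?\<theta> = form T \<gamma> ?\<theta>"
      using \<alpha> \<theta>d by (auto simp: roots_of_ht_def root_uminus ht_uminus form_uminus_left root_in_dual)
  next
    fix \<gamma> assume "\<gamma> \<in> roots_of_ht \<alpha> (?d - i)"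
    then show "- \<gamma> \<in> roots_of_ht \<alpha> (i - ?d)"
      using \<alpha> by (auto simp: roots_of_ht_def root_uminus ht_uminus)
  qed auto
  ultimately have eq: "of_int (q_at \<alpha> i) * form T ?\<phi> ?\<theta> = of_int (q_at \<alpha> (?d - i)) * form T ?\<phi> ?\<theta>"
    unfolding sum_form_roots_of_ht[OF \<alpha> \<theta>d] by simp
  have "form T ?\<phi> ?\<theta> = of_int ?d * (form T \<alpha> \<alpha> / 2)"
    using form_root_fundamental_weight[OF \<alpha> \<theta>r] form_sym[of ?\<phi> ?\<theta>] by simp
  moreover have "of_int ?d * (form T \<alpha> \<alpha> / 2) \<noteq> 0" using i form_root_nonzero[OF \<alpha>r] by simp
  ultimately have "form T ?\<phi> ?\<theta> \<noteq> 0" by metis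
  then show ?thesis using eq by simp
qed

text \<open>Average \<open>i q(i)\<close> with \<open>(d - i) q(d - i)\<close> for \<open>0 < i < d\<close>.\<close>

lemma sum_symmetric_weights:
  fixes q :: "int \<Rightarrow> int"
  assumes d: "0 < d" and sym: "\<And>i. 0 < i \<Longrightarrow> i < d \<Longrightarrow> q i = q (d - i)"
  shows "2 * (\<Sum>i\<in>{1..d}. i * q i) = d * ((\<Sum>i\<in>{1..d}. q i) + q d)"
proof -
  have split: "(\<Sum>i\<in>{1..d}. f i) = (\<Sum>i\<in>{1..<d}. f i) + f d" for f :: "int \<Rightarrow> int"
  proof -
    have "{1..d} = insert d {1..<d}" using d by auto
    then show ?thesis by simp
  qed
  have "(\<Sum>i\<in>{1..<d}. i * q i) = (\<Sum>i\<in>{1..<d}. (d - i) * q i)"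
    by (rule sum.reindex_bij_witness[of _ "\<lambda>i. d - i" "\<lambda>i. d - i"]) (auto simp: sym[symmetric])
  then have "2 * (\<Sum>i\<in>{1..<d}. i * q i) = (\<Sum>i\<in>{1..<d}. i * q i + (d - i) * q i)"
    by (simp add: sum.distrib)
  also have "\<dots> = d * (\<Sum>i\<in>{1..<d}. q i)"
    unfolding sum_distrib_left by (intro sum.cong refl) (simp add: algebra_simps)
  finally show ?thesis unfolding split by (simp add: algebra_simps)
qed

lemma q_identity:
  assumes \<alpha>: "\<alpha> \<in> P" and d: "d = ht \<alpha> highest_root"
  shows "of_int (d * (q_total \<alpha> + q_at \<alpha> d)) = 2 * dual_coxeter * length_ratio \<alpha>"
    and "0 < d" "0 < q_total \<alpha> + q_at \<alpha> d"
proof -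
  define M where "M = (\<Sum>i\<in>{1..d}. i * q_at \<alpha> i)"
  have M: "of_int M * form T \<alpha> \<alpha> = 1" unfolding M_def d by (rule weighted_sum_q[OF \<alpha>])
  show d0: "0 < d" unfolding d by (rule ht_highest_root_pos[OF \<alpha>])
  have "q_at \<alpha> i = q_at \<alpha> (d - i)" if "0 < i" "i < d" for i
    using that unfolding d by (rule q_at_symmetric[OF \<alpha>])
  then have eq: "d * (q_total \<alpha> + q_at \<alpha> d) = 2 * M"
    unfolding M_def q_total_eq[OF \<alpha>] d[symmetric] by (rule sum_symmetric_weights[OF d0, symmetric])
  have "dual_coxeter * length_ratio \<alpha> = 1 / form T \<alpha> \<alpha>"
    using dual_coxeter_norm by (simp add: length_ratio_def mult.commute)
  also have "\<dots> = of_int M" using M form_root_nonzero[OF P_root[OF \<alpha>]] by (simp add: divide_eq_eq)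
  finally show "of_int (d * (q_total \<alpha> + q_at \<alpha> d)) = 2 * dual_coxeter * length_ratio \<alpha>"
    unfolding eq by (simp add: mult.assoc)
  \<comment> \<open>The ground field is not ordered, so \<open>M > 0\<close> is read off from the positive integer \<open>N = 4 / (\<alpha>, \<alpha>)\<close>.\<close>
  obtain N :: int where N: "N > 0" "form T \<alpha> \<alpha> * of_int N = 4" by (rule form_root_positive[OF P_root[OF \<alpha>]])
  have "of_int N = of_int M * form T \<alpha> \<alpha> * of_int N" using M by simp
  also have "\<dots> = of_int (4 * M)" using N(2) by (simp add: mult.assoc)
  finally have "N = 4 * M" by (simp only: of_int_eq_iff)
  then have "0 < d * (q_total \<alpha> + q_at \<alpha> d)" using N(1) eq by simp
  then show "0 < q_total \<alpha> + q_at \<alpha> d" using d0 by (simp add: zero_less_mult_iff)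
qed

end

theorem corollary3p7:
  fixes scale :: "'k::{alg_closed_field,field_char_0} \<Rightarrow> 'g::ab_group_add \<Rightarrow> 'g"
    and bracket :: "'g \<Rightarrow> 'g \<Rightarrow> 'g"
    and T :: "'g set"
    and P :: "('g \<Rightarrow> 'k) set"
    and \<alpha> :: "'g \<Rightarrow> 'k"
  assumes "based_simple_lie_algebra scale bracket T P"
    and "\<alpha> \<in> P"
  shows "let \<theta> = based_simple_lie_algebra.highest_root scale bracket T P;
             d = based_simple_lie_algebra.ht P \<alpha> \<theta>;
             q = based_simple_lie_algebra.q_total scale bracket T P \<alpha>;
             q\<^sub>i = based_simple_lie_algebra.q_at scale bracket T P \<alpha>;
             h = based_simple_lie_algebra.dual_coxeter scale bracket T P;
             r = based_simple_lie_algebra.length_ratio scale bracket T P \<alpha>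
         in of_int (d * (q + q\<^sub>i d)) = 2 * h * r
            \<and> 2 * h * r / of_int d \<in> \<nat>
            \<and> (d = 2 \<longrightarrow> of_int (q + q\<^sub>i 2) = h * r)"
proof -
  interpret based_simple_lie_algebra scale bracket T P by fact
  define d where "d = ht \<alpha> highest_root"
  note q = q_identity[OF assms(2) d_def]
  let ?s = "q_total \<alpha> + q_at \<alpha> d"
  have "2 * dual_coxeter * length_ratio \<alpha> / of_int d = (of_int ?s :: 'k)"
    using q(2) unfolding q(1)[symmetric] by simp
  also have "\<dots> = of_nat (nat ?s)" using q(3) by simp
  finally have "2 * dual_coxeter * length_ratio \<alpha> / of_int d \<in> \<nat>" by simp
  moreover have "of_int (q_total \<alpha> + q_at \<alpha> 2) = dual_coxeter * length_ratio \<alpha>" if "d = 2"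
  proof -
    have "2 * of_int (q_total \<alpha> + q_at \<alpha> 2) = 2 * (dual_coxeter * length_ratio \<alpha>)"
      using q(1) unfolding that by (simp add: mult.assoc)
    then show ?thesis by (simp only: mult_cancel_left) simp
  qed
  ultimately show ?thesis using q(1) unfolding Let_def d_def[symmetric] by blast
qed

end
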